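(* For every $f\in\mathcal{SCF}_q$, the expected value $\mathbb{E}_N[f]$ of $f$ on $G_N$ (with respect to the uniform measure) stabilizes for large enough $N$, i.e. it is constant in $N$ for all large enough $N$; denote the stable value by $\mathbb{E}_\infty[f]$. Moreover, for every $m\in\mathbb{Z}_{\ge0}$: - For every $B\in G_m$, $\mathbb{E}_\infty[\tilde B]$ is a positive integer. - For every $B\in G_m$, $\mathbb{E}_\infty[\tilde B^{\mathrm{f.r.}}]=1$. - For $\chi\in\mathrm{IrrChar}(G_m)$, $\mathbb{E}_\infty[\chi\circ1]=1$ if $\chi$ is the trivial character of $G_m$, and $\mathbb{E}_\infty[\chi\circ1]=0$ otherwise. - For every finitely supported $\vec\mu\colon\mathscr{C}\to\mathscr{P}$, $\mathbb{E}_\infty[\chi_{\vec\mu[N]}]=1$ if $\|\vec\mu\|=0$, and $\mathbb{E}_\infty[\chi_{\vec\mu[N]}]=0$ otherwise.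
   Context: Fix a prime power $q$. For $N\in\mathbb{Z}_{\ge0}$ let $G_N=\mathrm{GL}_N(q)$ be the general linear group over the field $\mathbb{F}_q$ with $q$ elements ($G_0$ is the trivial group). $\mathrm{IrrChar}(G)$ denotes the set of irreducible complex characters of $G$. $\mathbb{E}_N[f]=\frac1{|G_N|}\sum_{g\in G_N}f(g)$. $\mathcal{CF}_q$ is the $\mathbb{C}$-algebra whose elements are equivalence classes of families of complex class functions, one on $G_N$ for every large enough $N$, where two families are equivalent if they coincide for every large enough $N$; addition and multiplication are pointwise. For $m\ge0$ and $B\in G_m$ define, for every $N\ge0$ and $g\in G_N$, $\tilde B(g)=\#\{M\in \mathrm{Mat}_{m\times N}(\mathbb{F}_q): Mg=BM\}$ and $\tilde B^{\mathrm{f.r.}}(g)=\#\{M\in \mathrm{Mat}_{m\times N}(\mathbb{F}_q): Mg=BM,\ \mathrm{rank}(M)=m\}$. These define elements of $\mathcal{CF}_q$. Parabolic induction: for $N=m+r$ let $P_{m,r}\le G_N$ be the subgroup of matrices $\begin{pmatrix}g_{11}&g_{12}\\0&g_{22}\end{pmatrix}$ with $g_{11}\in G_m$, $g_{22}\in G_r$. For representations $\pi_1$ of $G_m$ and $\pi_2$ of $G_r$ with characters $\chi_1,\chi_2$, $\pi_1\circ\pi_2$ is the representation of $G_N$ induced from the pullback of $\pi_1\boxtimes\pi_2$ along $P_{m,r}\to G_m\times G_r$, $\begin{pmatrix}g_{11}&g_{12}\\0&g_{22}\end{pmatrix}\mapsto(g_{11},g_{22})$; its character is $\chi_1\circ\chi_2$.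 For a character $\chi$ of $G_m$, $\chi\circ1\in\mathcal{CF}_q$ is the class function equal on $G_N$, $N\ge m$, to $\chi\circ 1_{N-m}$, where $1_{N-m}$ is the trivial character of $G_{N-m}$. Stable irreducible characters: an irreducible complex representation $\rho$ of $G_n$, $n\ge1$, is cuspidal if it is not a constituent of any $\pi_1\circ\pi_2$ with $\pi_1$ an irreducible representation of $G_k$ and $\pi_2$ one of $G_{n-k}$, $1\le k\le n-1$. Let $\mathscr{C}_n$ be the set of (isomorphism classes of) cuspidal irreducible representations of $G_n$, $\mathscr{C}=\bigsqcup_{n\ge1}\mathscr{C}_n$, and $d(\rho)=n$ for $\rho\in\mathscr{C}_n$. Let $\mathscr{P}$ be the set of all partitions of non-negative integers (including the empty one). For finitely supported $\vec\mu\colon\mathscr{C}\to\mathscr{P}$ (almost every $\rho$ maps to the empty partition) let $\|\vec\mu\|=\sum_{\rho}d(\rho)|\vec\mu(\rho)|$. Isomorphism classes of irreducible representations of $G_n$ are parametrized (Zelevinsky) by the finitely supported $\vec\mu$ with $\|\vec\mu\|=n$; write $\varphi(\vec\mu)$ for the corresponding representation and $\chi_{\vec\mu}$ for its character. Explicitly: for $\rho\in\mathscr{C}$ the free abelian group on the irreducible constituents of the powers $\rho^{\circ n}$, $n\ge0$, with product $\circ$, is isomorphic as a graded ring to the ring of symmetric functions, with irreducible representations corresponding to Schur functions; let $\varphi_\rho(\lambda)$ be the one corresponding to $s_\lambda$, where for the trivial representation $\mathbf{1}\in\mathscr{C}_1$ of $G_1$ the isomorphism is normalized so that $\varphi_{\mathbf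 1}((n))$ is the trivial representation of $G_n$ (for $\rho\ne\mathbf 1$ the isomorphism is unique up to transposing partitions, and either choice may be fixed). Then $\varphi(\vec\mu)$ is the $\circ$-product over $\rho$ of the $\varphi_\rho(\vec\mu(\rho))$, which is irreducible. For $\vec\mu$ with $\vec\mu(\mathbf 1)=\nu=(\nu_1,\nu_2,\dots)$ (with $\nu_1=0$ if $\nu$ is empty) and $N\ge\|\vec\mu\|+\nu_1$, define $\vec\mu[N]$ by $\vec\mu[N](\mathbf 1)=(N-\|\vec\mu\|,\nu_1,\nu_2,\dots)$ and $\vec\mu[N](\rho)=\vec\mu(\rho)$ for $\rho\ne\mathbf 1$. The characters $\chi_{\vec\mu[N]}$ of $G_N$ define an element of $\mathcal{CF}_q$, also written $\chi_{\vec\mu[N]}$. The algebra of stable class functions is $\mathcal{SCF}_q=\mathrm{span}_{\mathbb{C}}\{\tilde B: B\in G_m, m\ge0\}\subseteq\mathcal{CF}_q$; it also equals the span of all $\tilde B^{\mathrm{f.r.}}$, the span of all $\chi\circ1$ ($\chi\in\mathrm{IrrChar}(G_m)$, $m\ge0$), and the span of all $\chi_{\vec\mu[N]}$. *)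

theory Defs
  imports "Jordan_Normal_Form.VS_Connect" "Jordan_Normal_Form.DL_Rank"
begin

text \<open>
  The field with \<open>q\<close> elements is an arbitrary type \<open>'a :: {field, finite}\<close>, so that
  \<open>q = CARD('a)\<close>.
\<close>

definition GL :: "nat \<Rightarrow> 'a :: comm_ring_1 mat monoid" where
  "GL n = units_of (ring_mat TYPE('a) n ())"

definition mat_trace :: "'a :: comm_monoid_add mat \<Rightarrow> 'a" where
  "mat_trace A = (\<Sum>i<dim_row A. A $$ (i, i))"


section \<open>The algebra of eventual families of class functions\<close>

text \<open>
  A family is a total function \<open>f\<close>, where \<open>f N\<close> is the function on \<open>G\<^sub>N\<close>; its values at small \<open>N\<close>
  and outside \<open>G\<^sub>N\<close> are junk, which the equivalence relation discards.
\<close>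

definition class_family :: "(nat \<Rightarrow> 'a :: {field, finite} mat \<Rightarrow> complex) \<Rightarrow> bool" where
  "class_family f \<longleftrightarrow> (\<forall>\<^sub>F N in sequentially. \<forall>x\<in>carrier (GL N). \<forall>g\<in>carrier (GL N).
     f N (x \<otimes>\<^bsub>GL N\<^esub> g \<otimes>\<^bsub>GL N\<^esub> inv\<^bsub>GL N\<^esub> x) = f N g)"

definition cf_rel ::
  "(nat \<Rightarrow> 'a :: {field, finite} mat \<Rightarrow> complex) \<Rightarrow> (nat \<Rightarrow> 'a mat \<Rightarrow> complex) \<Rightarrow> bool" where
  "cf_rel f h \<longleftrightarrow> class_family f \<and> class_family h \<and>
     (\<forall>\<^sub>F N in sequentially. \<forall>g\<in>carrier (GL N). f N g = h N g)"

lemma class_family_const: "class_family (\<lambda>N g. c)"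
  by (simp add: class_family_def)

lemma class_family_map2:
  assumes "class_family f" "class_family h"
  shows "class_family (\<lambda>N g. F (f N g) (h N g))"
  using assms unfolding class_family_def by eventually_elim simp

lemmas class_family_intros =
  class_family_const
  class_family_map2[of _ _ "(+)"] class_family_map2[of _ _ "(*)"] class_family_map2[of _ _ "(-)"]

lemma cf_rel_map2:
  assumes "cf_rel f f'" "cf_rel h h'"
  shows "cf_rel (\<lambda>N g. F (f N g) (h N g)) (\<lambda>N g. F (f' N g) (h' N g))"
proof -
  have "\<forall>\<^sub>F N in sequentially. \<forall>g\<in>carrier (GL N). f N g = f' N g"
    and "\<forall>\<^sub>F N in sequentially. \<forall>g\<in>carrier (GL N). h N g = h' N g"
    using assms by (simp_all add: cf_rel_def)
  then have "\<forall>\<^sub>F N in sequentially. \<forall>g\<in>carrier (GL N). F (f N g) (h N g) = F (f' N g) (h' N g)"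
    by eventually_elim simp
  then show ?thesis
    using assms by (auto simp: cf_rel_def intro: class_family_map2)
qed

lemma cf_rel_map:
  assumes "cf_rel f f'"
  shows "cf_rel (\<lambda>N g. F (f N g)) (\<lambda>N g. F (f' N g))"
  using cf_rel_map2[OF assms assms, of "\<lambda>a b. F a"] .

lemma cf_rel_eqI: "class_family f \<Longrightarrow> f = h \<Longrightarrow> cf_rel f h"
  by (simp add: cf_rel_def)

lemma part_equivp_cf_rel:
  "part_equivp (cf_rel :: (nat \<Rightarrow> 'a :: {field, finite} mat \<Rightarrow> complex) \<Rightarrow> _)"
proof (rule part_equivpI)
  show "\<exists>f :: nat \<Rightarrow> 'a mat \<Rightarrow> complex. cf_rel f f"
    using class_family_const[of 0] by (auto simp: cf_rel_def)
  show "symp (cf_rel :: (nat \<Rightarrow> 'a mat \<Rightarrow> complex) \<Rightarrow> _)"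
    by (auto simp: symp_def cf_rel_def elim: eventually_mono)
  show "transp (cf_rel :: (nat \<Rightarrow> 'a mat \<Rightarrow> complex) \<Rightarrow> _)"
  proof (rule transpI)
    fix f h k :: "nat \<Rightarrow> 'a mat \<Rightarrow> complex"
    assume *: "cf_rel f h" "cf_rel h k"
    then have "\<forall>\<^sub>F N in sequentially. \<forall>g\<in>carrier (GL N). f N g = h N g"
      and "\<forall>\<^sub>F N in sequentially. \<forall>g\<in>carrier (GL N). h N g = k N g"
      by (simp_all add: cf_rel_def)
    then have "\<forall>\<^sub>F N in sequentially. \<forall>g\<in>carrier (GL N). f N g = k N g"
      by eventually_elim simp
    then show "cf_rel f k" using * by (simp add: cf_rel_def)
  qed
qed

quotient_type (overloaded) 'a cf = "nat \<Rightarrow> 'a :: {field, finite} mat \<Rightarrow> complex" / partial: cf_rel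
  by (rule part_equivp_cf_rel)

lemma one_in_GL: "1\<^sub>m n \<in> carrier (GL n)"
  by (auto simp: GL_def units_of_carrier Units_def ring_mat_simps
      intro!: bexI[of _ "1\<^sub>m n"])

instantiation cf :: ("{field, finite}") comm_ring_1
begin

lift_definition zero_cf :: "'a cf" is "\<lambda>N g. 0"
  by (rule cf_rel_eqI[OF class_family_const refl])

lift_definition one_cf :: "'a cf" is "\<lambda>N g. 1"
  by (rule cf_rel_eqI[OF class_family_const refl])

lift_definition plus_cf :: "'a cf \<Rightarrow> 'a cf \<Rightarrow> 'a cf" is "\<lambda>f h N g. f N g + h N g"
  by (rule cf_rel_map2)

lift_definition minus_cf :: "'a cf \<Rightarrow> 'a cf \<Rightarrow> 'a cf" is "\<lambda>f h N g. f N g - h N g"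
  by (rule cf_rel_map2)

lift_definition times_cf :: "'a cf \<Rightarrow> 'a cf \<Rightarrow> 'a cf" is "\<lambda>f h N g. f N g * h N g"
  by (rule cf_rel_map2)

lift_definition uminus_cf :: "'a cf \<Rightarrow> 'a cf" is "\<lambda>f N g. - f N g"
  by (rule cf_rel_map)

instance
proof
  fix a b c :: "'a cf"
  show "a * b * c = a * (b * c)"
    by (transfer, rule cf_rel_eqI) (simp_all add: cf_rel_def class_family_intros mult.assoc)
  show "a * b = b * a"
    by (transfer, rule cf_rel_eqI) (simp_all add: cf_rel_def class_family_intros mult.commute)
  show "1 * a = a"
    by transfer simp
  show "a + b + c = a + (b + c)"
    by (transfer, rule cf_rel_eqI) (simp_all add: cf_rel_def class_family_intros add.assoc)
  show "a + b = b + a"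
    by (transfer, rule cf_rel_eqI) (simp_all add: cf_rel_def class_family_intros add.commute)
  show "0 + a = a"
    by transfer simp
  show "- a + a = 0"
    by transfer (simp add: cf_rel_def class_family_const)
  show "a - b = a + - b"
    by (transfer, rule cf_rel_eqI) (simp_all add: cf_rel_def class_family_intros)
  show "(a + b) * c = a * c + b * c"
    by (transfer, rule cf_rel_eqI) (simp_all add: cf_rel_def class_family_intros distrib_right)
  show "(0 :: 'a cf) \<noteq> 1"
  proof transfer
    show "\<not> cf_rel (\<lambda>N (g :: 'a mat). 0) (\<lambda>N g. 1)"
      using one_in_GL by (fastforce simp: cf_rel_def eventually_sequentially)
  qed
qed

end

lift_definition cf_scale :: "complex \<Rightarrow> 'a :: {field, finite} cf \<Rightarrow> 'a cf" is "\<lambda>c f N g. c * f N g"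
  by (rule cf_rel_map)

interpretation cf: vector_space cf_scale
proof
  fix a b :: complex and x y :: "'a :: {field, finite} cf"
  show "cf_scale a (x + y) = cf_scale a x + cf_scale a y"
    by (transfer, rule cf_rel_eqI)
      (simp_all add: cf_rel_def class_family_intros distrib_left)
  show "cf_scale (a + b) x = cf_scale a x + cf_scale b x"
    by (transfer, rule cf_rel_eqI) (simp_all add: cf_rel_def class_family_intros distrib_right)
  show "cf_scale a (cf_scale b x) = cf_scale (a * b) x"
    by (transfer, rule cf_rel_eqI) (simp_all add: cf_rel_def class_family_intros mult.assoc)
  show "cf_scale 1 x = x"
    by transfer simp
qed

definition expect :: "nat \<Rightarrow> ('a :: {field, finite} mat \<Rightarrow> complex) \<Rightarrow> complex" where
  "expect N f = (\<Sum>g\<in>carrier (GL N). f g) / of_nat (card (carrier (GL N :: 'a mat monoid)))"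

text \<open>
  \<open>has_stable_mean f c\<close>: the expected value of \<open>f\<close> over \<open>G\<^sub>N\<close> equals \<open>c\<close> for all large
  enough \<open>N\<close>, that is, the stable expected value of \<open>f\<close> exists and equals \<open>c\<close>.
\<close>

lift_definition has_stable_mean :: "'a :: {field, finite} cf \<Rightarrow> complex \<Rightarrow> bool" is
  "\<lambda>f c. \<forall>\<^sub>F N in sequentially. expect N (f N) = c"
proof -
  have *: "\<forall>\<^sub>F N in sequentially. expect N (h N) = c"
    if "\<forall>\<^sub>F N in sequentially. \<forall>g\<in>carrier (GL N). f N g = h N g"
      and "\<forall>\<^sub>F N in sequentially. expect N (f N) = c"
    for f h :: "nat \<Rightarrow> 'a mat \<Rightarrow> complex" and c
    using that by eventually_elim (simp add: expect_def)
  fix f h :: "nat \<Rightarrow> 'a mat \<Rightarrow> complex"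
  assume "cf_rel f h"
  then have fh: "\<forall>\<^sub>F N in sequentially. \<forall>g\<in>carrier (GL N). f N g = h N g"
    by (simp add: cf_rel_def)
  then have hf: "\<forall>\<^sub>F N in sequentially. \<forall>g\<in>carrier (GL N). h N g = f N g"
    by eventually_elim simp
  show "(\<lambda>c. \<forall>\<^sub>F N in sequentially. expect N (f N) = c) =
        (\<lambda>c. \<forall>\<^sub>F N in sequentially. expect N (h N) = c)"
    using *[OF fh] *[OF hf] by blast
qed


section \<open>Stable class functions\<close>

definition Btilde :: "nat \<Rightarrow> 'a :: {field, finite} mat \<Rightarrow> 'a cf" where
  "Btilde m B = abs_cf (\<lambda>N g. of_nat (card {M \<in> carrier_mat m N. M * g = B * M}))"

definition Btilde_fr :: "nat \<Rightarrow> 'a :: {field, finite} mat \<Rightarrow> 'a cf" where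
  "Btilde_fr m B =
     abs_cf (\<lambda>N g. of_nat (card {M \<in> carrier_mat m N. M * g = B * M \<and> vec_space.rank m M = m}))"

definition SCF :: "'a :: {field, finite} cf set" where
  "SCF = cf.span {Btilde m B | m B. B \<in> carrier (GL m)}"


section \<open>Complex representations of the general linear groups\<close>

text \<open>
  A representation of \<open>G\<^sub>n\<close> on \<open>\<complex>\<^sup>d\<close> is stored with its \<open>rk\<close> \<open>n\<close> and degree \<open>dg\<close> \<open>d\<close>;
  the values of \<open>act\<close> outside \<open>G\<^sub>n\<close> are irrelevant.
\<close>

datatype 'a gl_rep = GLRep (rk: nat) (dg: nat) (act: "'a mat \<Rightarrow> complex mat")

definition is_rep :: "'a :: {field, finite} gl_rep \<Rightarrow> bool" where
  "is_rep \<pi> \<longleftrightarrow> act \<pi> \<in> hom (GL (rk \<pi>)) (GL (dg \<pi>))"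

definition character :: "'a :: {field, finite} gl_rep \<Rightarrow> 'a mat \<Rightarrow> complex" where
  "character \<pi> g = (if g \<in> carrier (GL (rk \<pi>)) then mat_trace (act \<pi> g) else 0)"

definition irreducible_rep :: "'a :: {field, finite} gl_rep \<Rightarrow> bool" where
  "irreducible_rep \<pi> \<longleftrightarrow> is_rep \<pi> \<and> dg \<pi> > 0 \<and>
     (\<forall>W. VectorSpace.subspace class_ring W (module_vec TYPE(complex) (dg \<pi>)) \<and>
          (\<forall>g\<in>carrier (GL (rk \<pi>)). \<forall>v\<in>W. act \<pi> g *\<^sub>v v \<in> W)
        \<longrightarrow> W = {0\<^sub>v (dg \<pi>)} \<or> W = carrier_vec (dg \<pi>))"

definition intertwines ::
  "complex mat \<Rightarrow> 'a :: {field, finite} gl_rep \<Rightarrow> 'a gl_rep \<Rightarrow> bool" where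
  "intertwines T \<sigma> \<pi> \<longleftrightarrow> rk \<sigma> = rk \<pi> \<and> T \<in> carrier_mat (dg \<pi>) (dg \<sigma>) \<and>
     (\<forall>g\<in>carrier (GL (rk \<pi>)). T * act \<sigma> g = act \<pi> g * T)"

definition iso_rep :: "('a :: {field, finite} gl_rep \<times> 'a gl_rep) set" where
  "iso_rep = {(\<sigma>, \<pi>). is_rep \<sigma> \<and> is_rep \<pi> \<and> dg \<sigma> = dg \<pi> \<and>
     (\<exists>T\<in>carrier (GL (dg \<pi>)). intertwines T \<sigma> \<pi>)}"

text \<open>Over \<open>\<complex>\<close> constituents are the same as irreducible subrepresentations.\<close>

definition constituent :: "'a :: {field, finite} gl_rep \<Rightarrow> 'a gl_rep \<Rightarrow> bool" where
  "constituent \<sigma> \<pi> \<longleftrightarrow> irreducible_rep \<sigma> \<and>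
     (\<exists>T. intertwines T \<sigma> \<pi> \<and> (\<forall>v\<in>carrier_vec (dg \<sigma>). T *\<^sub>v v = 0\<^sub>v (dg \<pi>) \<longrightarrow> v = 0\<^sub>v (dg \<sigma>)))"

definition triv_rep :: "nat \<Rightarrow> 'a :: {field, finite} gl_rep" where
  "triv_rep n = GLRep n 1 (\<lambda>g. 1\<^sub>m 1)"

definition dsum :: "nat \<Rightarrow> 'a :: {field, finite} gl_rep list \<Rightarrow> 'a gl_rep" where
  "dsum n \<pi>s = GLRep n (sum_list (map dg \<pi>s)) (\<lambda>g. diag_block_mat (map (\<lambda>\<pi>. act \<pi> g) \<pi>s))"


subsection \<open>Parabolic induction\<close>

definition kronecker :: "complex mat \<Rightarrow> complex mat \<Rightarrow> complex mat" where
  "kronecker A B = mat (dim_row A * dim_row B) (dim_col A * dim_col B)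
     (\<lambda>(i, j). A $$ (i div dim_row B, j div dim_col B) * B $$ (i mod dim_row B, j mod dim_col B))"

definition parabolic :: "nat \<Rightarrow> nat \<Rightarrow> 'a :: {field, finite} mat set" where
  "parabolic m r = {four_block_mat g11 g12 (0\<^sub>m r m) g22 | g11 g12 g22.
     g11 \<in> carrier (GL m) \<and> g12 \<in> carrier_mat m r \<and> g22 \<in> carrier (GL r)}"

definition left_transversal :: "'a :: {field, finite} mat monoid \<Rightarrow> 'a mat set \<Rightarrow> 'a mat list \<Rightarrow> bool" where
  "left_transversal G H ts \<longleftrightarrow> distinct ts \<and> set ts \<subseteq> carrier G \<and>
     (\<forall>g\<in>carrier G. \<exists>!t. t \<in> set ts \<and> inv\<^bsub>G\<^esub> t \<otimes>\<^bsub>G\<^esub> g \<in> H)"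

text \<open>
  The representation of \<open>G\<^sub>n\<close> induced from a representation \<open>\<sigma>\<close> of degree \<open>d\<close> of a subgroup \<open>H\<close>, on
  the direct sum of copies of \<open>\<complex>\<^sup>d\<close> indexed by representatives \<open>t\<close> of the cosets \<open>t H\<close>:
  the block of \<open>g\<close> at \<open>(s, t)\<close> is \<open>\<sigma> (s\<inverse> g t)\<close> if \<open>s\<inverse> g t \<in> H\<close> and zero otherwise.
  Up to isomorphism the choice of representatives is immaterial.
\<close>

definition induced_rep ::
  "nat \<Rightarrow> 'a :: {field, finite} mat set \<Rightarrow> nat \<Rightarrow> ('a mat \<Rightarrow> complex mat) \<Rightarrow> 'a gl_rep" where
  "induced_rep n H d \<sigma> =
     (let G = GL n; ts = (SOME ts. left_transversal G H ts); D = length ts * d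
      in GLRep n D (\<lambda>g. mat D D (\<lambda>(i, j).
           let h = inv\<^bsub>G\<^esub> (ts ! (i div d)) \<otimes>\<^bsub>G\<^esub> g \<otimes>\<^bsub>G\<^esub> (ts ! (j div d))
           in if h \<in> H then \<sigma> h $$ (i mod d, j mod d) else 0)))"

definition par_ind :: "'a :: {field, finite} gl_rep \<Rightarrow> 'a gl_rep \<Rightarrow> 'a gl_rep" where
  "par_ind \<pi>1 \<pi>2 = induced_rep (rk \<pi>1 + rk \<pi>2) (parabolic (rk \<pi>1) (rk \<pi>2)) (dg \<pi>1 * dg \<pi>2)
     (\<lambda>p. case split_block p (rk \<pi>1) (rk \<pi>1) of
            (g11, g12, g21, g22) \<Rightarrow> kronecker (act \<pi>1 g11) (act \<pi>2 g22))"

fun par_pow :: "'a :: {field, finite} gl_rep \<Rightarrow> nat \<Rightarrow> 'a gl_rep" where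
  "par_pow \<pi> 0 = triv_rep 0"
| "par_pow \<pi> (Suc n) = par_ind \<pi> (par_pow \<pi> n)"

text \<open>The element \<open>\<chi> \<circ> 1\<close>, where \<open>\<chi>\<close> is the character of \<open>\<pi>\<close>.\<close>

definition circ_one :: "'a :: {field, finite} gl_rep \<Rightarrow> 'a cf" where
  "circ_one \<pi> = abs_cf (\<lambda>N. character (par_ind \<pi> (triv_rep (N - rk \<pi>))))"


section \<open>Partitions and Schur functions\<close>

definition is_partition :: "nat list \<Rightarrow> bool" where
  "is_partition \<alpha> \<longleftrightarrow> sorted_wrt (\<ge>) \<alpha> \<and> 0 \<notin> set \<alpha>"

definition ssyt :: "nat list \<Rightarrow> nat list list \<Rightarrow> bool" where
  "ssyt \<alpha> T \<longleftrightarrow> map length T = \<alpha> \<and> (\<forall>row\<in>set T. sorted row) \<and>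
     (\<forall>i j. Suc i < length T \<and> j < length (T ! Suc i) \<longrightarrow> T ! i ! j < T ! Suc i ! j)"

text \<open>
  Symmetric functions in the variables \<open>x\<^sub>0, x\<^sub>1, \<dots>\<close> are represented by their coefficients;
  a monomial is the multiset of the indices of its variables.
\<close>

definition schur :: "nat list \<Rightarrow> nat multiset \<Rightarrow> int" where
  "schur \<alpha> M = int (card {T. ssyt \<alpha> T \<and> mset (concat T) = M})"

definition symf_mult :: "(nat multiset \<Rightarrow> int) \<Rightarrow> (nat multiset \<Rightarrow> int) \<Rightarrow> nat multiset \<Rightarrow> int" where
  "symf_mult f h M = (\<Sum>A | A \<subseteq># M. f A * h (M - A))"


section \<open>Zelevinsky's parametrization\<close>

definition cuspidal :: "'a :: {field, finite} gl_rep \<Rightarrow> bool" where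
  "cuspidal \<rho> \<longleftrightarrow> irreducible_rep \<rho> \<and> rk \<rho> \<ge> 1 \<and>
     \<not> (\<exists>\<pi>1 \<pi>2. irreducible_rep \<pi>1 \<and> irreducible_rep \<pi>2 \<and> rk \<pi>1 \<ge> 1 \<and> rk \<pi>2 \<ge> 1 \<and>
          rk \<pi>1 + rk \<pi>2 = rk \<rho> \<and> constituent \<rho> (par_ind \<pi>1 \<pi>2))"

definition cuspidal_classes :: "'a :: {field, finite} gl_rep set set" where
  "cuspidal_classes = {\<rho>. cuspidal \<rho>} // iso_rep"

definition triv_class :: "'a :: {field, finite} gl_rep set" where
  "triv_class = iso_rep `` {triv_rep 1}"

definition class_deg :: "'a :: {field, finite} gl_rep set \<Rightarrow> nat" where
  "class_deg C = rk (SOME \<rho>. \<rho> \<in> C)"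

text \<open>
  \<open>schur_labelling \<rho> \<phi>\<close>: the map sending the class of \<open>\<phi> \<alpha>\<close> to the Schur function \<open>s\<^sub>\<alpha>\<close> is a graded
  ring isomorphism from the free abelian group on the irreducible constituents of the powers of \<open>\<rho>\<close>
  onto the ring of symmetric functions, normalized as in Zelevinsky's theorem if \<open>\<rho>\<close> is the trivial
  representation of \<open>G\<^sub>1\<close>. As the Schur functions form a \<open>\<int>\<close>-basis, being a graded isomorphism
  of groups means that \<open>\<phi>\<close> is a degree-preserving bijection from partitions to isomorphism classes of
  constituents; multiplicativity is imposed on the basis, where an element with non-negative
  coefficients of the free abelian group is a direct sum of irreducible representations.
\<close>

definition schur_labelling ::
  "'a :: {field, finite} gl_rep \<Rightarrow> (nat list \<Rightarrow> 'a gl_rep) \<Rightarrow> bool" where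
  "schur_labelling \<rho> \<phi> \<longleftrightarrow>
     (\<forall>\<alpha>. is_partition \<alpha> \<longrightarrow> constituent (\<phi> \<alpha>) (par_pow \<rho> (sum_list \<alpha>))) \<and>
     (\<forall>n \<sigma>. constituent \<sigma> (par_pow \<rho> n) \<longrightarrow>
        (\<exists>!\<alpha>. is_partition \<alpha> \<and> sum_list \<alpha> = n \<and> (\<sigma>, \<phi> \<alpha>) \<in> iso_rep)) \<and>
     (\<forall>\<alpha> \<beta>. is_partition \<alpha> \<and> is_partition \<beta> \<longrightarrow>
        (\<exists>\<gamma>s. (\<forall>\<gamma>\<in>set \<gamma>s. is_partition \<gamma>) \<and>
           (\<forall>M. symf_mult (schur \<alpha>) (schur \<beta>) M = (\<Sum>\<gamma>\<leftarrow>\<gamma>s. schur \<gamma> M)) \<and>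
           (par_ind (\<phi> \<alpha>) (\<phi> \<beta>), dsum (rk (\<phi> \<alpha>) + rk (\<phi> \<beta>)) (map \<phi> \<gamma>s)) \<in> iso_rep)) \<and>
     (\<rho> \<in> triv_class \<longrightarrow> (\<forall>n\<ge>1. (\<phi> [n], triv_rep n) \<in> iso_rep))"

text \<open>
  A system \<open>\<Phi>\<close> of representations \<open>\<Phi> C \<alpha> = \<phi>\<^sub>\<rho>(\<alpha>)\<close>, for \<open>C\<close> the isomorphism class of \<open>\<rho>\<close>.
  For nontrivial \<open>\<rho>\<close> there are two labellings, exchanged by transposing partitions; either may be
  chosen, independently for each class.
\<close>

definition zelevinsky_system ::
  "('a :: {field, finite} gl_rep set \<Rightarrow> nat list \<Rightarrow> 'a gl_rep) \<Rightarrow> bool" where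
  "zelevinsky_system \<Phi> \<longleftrightarrow> (\<forall>C\<in>cuspidal_classes. \<exists>\<rho>\<in>C. schur_labelling \<rho> (\<Phi> C))"

definition multi_supp ::
  "('a :: {field, finite} gl_rep set \<Rightarrow> nat list) \<Rightarrow> 'a gl_rep set set" where
  "multi_supp \<mu> = {C \<in> cuspidal_classes. \<mu> C \<noteq> []}"

definition multipartition :: "('a :: {field, finite} gl_rep set \<Rightarrow> nat list) \<Rightarrow> bool" where
  "multipartition \<mu> \<longleftrightarrow> (\<forall>C\<in>cuspidal_classes. is_partition (\<mu> C)) \<and> finite (multi_supp \<mu>)"

definition multi_norm :: "('a :: {field, finite} gl_rep set \<Rightarrow> nat list) \<Rightarrow> nat" where
  "multi_norm \<mu> = (\<Sum>C\<in>multi_supp \<mu>. class_deg C * sum_list (\<mu> C))"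

text \<open>
  The representation \<open>\<phi>(\<mu>)\<close>: parabolic induction is commutative and associative up to isomorphism,
  so the order of the factors is immaterial.
\<close>

definition irrep_of ::
  "('a :: {field, finite} gl_rep set \<Rightarrow> nat list \<Rightarrow> 'a gl_rep) \<Rightarrow>
   ('a gl_rep set \<Rightarrow> nat list) \<Rightarrow> 'a gl_rep" where
  "irrep_of \<Phi> \<mu> = foldr (\<lambda>C. par_ind (\<Phi> C (\<mu> C)))
     (SOME Cs. distinct Cs \<and> set Cs = multi_supp \<mu>) (triv_rep 0)"

text \<open>The multipartition \<open>\<mu>[N]\<close>; a zero first row (\<open>N = \<parallel>\<mu>\<parallel>\<close>) is dropped.\<close>

definition multi_pad ::
  "('a :: {field, finite} gl_rep set \<Rightarrow> nat list) \<Rightarrow> nat \<Rightarrow> 'a gl_rep set \<Rightarrow> nat list" where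
  "multi_pad \<mu> N = \<mu>(triv_class := filter (\<lambda>k. k \<noteq> 0) ((N - multi_norm \<mu>) # \<mu> triv_class))"

definition chi_stable ::
  "('a :: {field, finite} gl_rep set \<Rightarrow> nat list \<Rightarrow> 'a gl_rep) \<Rightarrow>
   ('a gl_rep set \<Rightarrow> nat list) \<Rightarrow> 'a cf" where
  "chi_stable \<Phi> \<mu> = abs_cf (\<lambda>N. character (irrep_of \<Phi> (multi_pad \<mu> N)))"

end

theory Submission
  imports Defs
begin

text \<open>
  All four values are instances of the principle that an average over \<open>G\<^sub>N\<close> counts invariants.

  The counts \<open>Btilde\<close> and \<open>Btilde_fr\<close>. The matrices \<open>M\<close> of size \<open>m \<times> N\<close> form a right \<open>G\<^sub>N\<close>-set on
  which left multiplication by \<open>B\<close> acts by an equivariant map. Averaging the number of \<open>M\<close> with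
  \<open>M g = B M\<close> over \<open>g\<close> gives the number of \<open>G\<^sub>N\<close>-orbits that \<open>B\<close> maps to themselves
  (\<open>fixed_orbit_count\<close>, a twisted form of Burnside's lemma). Two matrices lie in one orbit exactly if
  they satisfy the same linear relations between rows, that is, have the same left kernel
  (\<open>left_kernel_eq_iff\<close>), and for \<open>N \<ge> m\<close> the possible left kernels no longer depend on \<open>N\<close>
  (\<open>left_kernels_stable\<close>). So the mean is the number of \<open>B\<close>-stable left kernels; the whole space is
  one of them, so it is positive. The matrices of rank \<open>m\<close> are those with zero left kernel; they
  form a single orbit, so there the mean is \<open>1\<close>. Existence of the stable mean on the whole span
  follows by linearity.

  Parabolic induction. By Frobenius reciprocity the mean of an induced character is the mean of the
  inducing character over the subgroup (\<open>expect_induced_rep\<close>); on a parabolic subgroup this makes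
  the mean multiplicative with respect to parabolic induction (\<open>mean_par_ind\<close>). An irreducible
  representation without nonzero invariant vectors has mean \<open>0\<close>, and any other one is trivial and
  has mean \<open>1\<close> (\<open>irreducible_rep_cases\<close>). This settles \<open>\<chi> \<circ> 1\<close>.

  Stable irreducible characters. The character of \<open>\<phi>(\<mu>[N])\<close> has as its mean the product of the means
  of the factors \<open>\<phi>\<^sub>\<rho>(\<mu>[N](\<rho>))\<close>, so it suffices to find one nontrivial factor unless \<open>\<mu>\<close> is empty. If
  \<open>\<rho>\<close> is cuspidal and not the trivial representation of \<open>G\<^sub>1\<close>, then \<open>\<rho>\<close> has no invariants: the
  trivial representations of the larger groups are not cuspidal. Invariants of an induced
  representation come from invariants of the inducing one, so no constituent of a power \<open>\<rho>\<^bsup>n\<^esup>\<close>,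
  \<open>n \<ge> 1\<close>, has invariants either (\<open>no_invariants_nontrivial_class\<close>). For the trivial \<open>\<rho>\<close> the trivial
  representation of \<open>G\<^sub>n\<close> carries the label \<open>[n]\<close> and labels are unique, so a partition with at least
  two parts labels a nontrivial representation (\<open>no_invariants_triv_class\<close>); and \<open>\<mu>[N]\<close> has at least
  two parts at the trivial \<open>\<rho>\<close> as soon as \<open>\<mu>\<close> is nonempty there.
\<close>

section \<open>General linear groups over a finite field\<close>

lemma mult_GL [simp]: "mult (GL n) = (*)"
  and one_GL [simp]: "one (GL n) = 1\<^sub>m n"
  by (simp_all add: GL_def units_of_mult units_of_one ring_mat_simps)

lemma group_GL: "group (GL n)"
proof -
  interpret ring "ring_mat TYPE('a) n ()" by (rule ring_mat)
  show "group (GL n :: 'a mat monoid)" unfolding GL_def by (rule units_group)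
qed

lemma GL_carrier_mat: "g \<in> carrier (GL n) \<Longrightarrow> g \<in> carrier_mat n n"
  by (auto simp: GL_def units_of_carrier Units_def ring_mat_simps)

lemma GL_I:
  "A \<in> carrier_mat n n \<Longrightarrow> B \<in> carrier_mat n n \<Longrightarrow> A * B = 1\<^sub>m n \<Longrightarrow> B * A = 1\<^sub>m n \<Longrightarrow>
     A \<in> carrier (GL n)"
  by (auto simp: GL_def units_of_carrier Units_def ring_mat_simps)

lemma GL_E:
  assumes "A \<in> carrier (GL n)"
  obtains B where "B \<in> carrier (GL n)" "A * B = 1\<^sub>m n" "B * A = 1\<^sub>m n"
  using assms by (auto simp: GL_def units_of_carrier Units_def ring_mat_simps)

lemma GL_if_injective:
  fixes A :: "'a :: field mat"
  assumes A: "A \<in> carrier_mat n n"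
    and inj: "\<And>v. v \<in> carrier_vec n \<Longrightarrow> A *\<^sub>v v = 0\<^sub>v n \<Longrightarrow> v = 0\<^sub>v n"
  shows "A \<in> carrier (GL n)"
proof -
  have "det A \<noteq> 0" using det_0_iff_vec_prod_zero[OF A] inj by auto
  then show ?thesis
    using det_non_zero_imp_unit[OF A] by (auto simp: GL_def units_of_carrier)
qed

lemma transpose_in_GL:
  assumes "h \<in> carrier (GL n)" shows "transpose_mat h \<in> carrier (GL n)"
proof -
  from assms obtain B where B: "B \<in> carrier (GL n)" "h * B = 1\<^sub>m n" "B * h = 1\<^sub>m n" by (rule GL_E)
  note c = GL_carrier_mat[OF assms] GL_carrier_mat[OF B(1)]
  show ?thesis
    by (rule GL_I[of _ _ "transpose_mat B"])
       (use c B in \<open>auto simp: transpose_mult[symmetric]\<close>)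
qed

lemma finite_carrier_mat: "finite (carrier_mat nr nc :: 'a :: finite mat set)"
proof -
  let ?S = "PiE ({..<nr} \<times> {..<nc}) (\<lambda>_. UNIV :: 'a set)"
  have "carrier_mat nr nc \<subseteq> (\<lambda>f. mat nr nc f) ` ?S"
  proof
    fix A :: "'a mat" assume A: "A \<in> carrier_mat nr nc"
    then have "A = mat nr nc (restrict (\<lambda>p. A $$ p) ({..<nr} \<times> {..<nc}))"
      by (intro eq_matI) auto
    then show "A \<in> (\<lambda>f. mat nr nc f) ` ?S"
      by (subst \<open>A = _\<close>) (intro imageI restrict_PiE_iff[THEN iffD2], simp)
  qed
  moreover have "finite ?S" by (intro finite_PiE) auto
  ultimately show ?thesis by (meson finite_imageI finite_subset)
qed

lemma finite_GL: "finite (carrier (GL n :: 'a :: {field, finite} mat monoid))"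
  by (rule finite_subset[OF _ finite_carrier_mat[of n n]]) (auto dest: GL_carrier_mat)

lemma card_GL_pos: "card (carrier (GL n :: 'a :: {field, finite} mat monoid)) > 0"
  using finite_GL one_in_GL by (metis card_gt_0_iff empty_iff)

section \<open>Counting orbits fixed by an equivariant map\<close>

text \<open>
  Burnside's lemma is the case \<open>b = id\<close>. The orbits are recorded by a complete invariant \<open>\<kappa>\<close>, and
  \<open>b\<close> acts on the set of invariants through \<open>\<beta>\<close>. For \<open>x\<close> in an orbit that \<open>b\<close> preserves, the
  solutions \<open>g\<close> of \<open>x g = b x\<close> form a coset of the stabilizer of \<open>x\<close>, and stabilizer times orbit has
  the size of the group, so each preserved orbit contributes exactly \<open>|G|\<close>.
\<close>

lemma fixed_orbit_count:
  fixes G (structure) and act :: "'x \<Rightarrow> 'g \<Rightarrow> 'x"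
  assumes G: "group G" and fG: "finite (carrier G)" and fX: "finite X"
    and closed: "\<And>x g. x \<in> X \<Longrightarrow> g \<in> carrier G \<Longrightarrow> act x g \<in> X"
    and mult: "\<And>x g h. x \<in> X \<Longrightarrow> g \<in> carrier G \<Longrightarrow> h \<in> carrier G \<Longrightarrow>
      act (act x g) h = act x (g \<otimes> h)"
    and orbits: "\<And>x y. x \<in> X \<Longrightarrow> y \<in> X \<Longrightarrow> \<kappa> x = \<kappa> y \<longleftrightarrow> (\<exists>g\<in>carrier G. act x g = y)"
    and b: "\<And>x. x \<in> X \<Longrightarrow> b x \<in> X" "\<And>x. x \<in> X \<Longrightarrow> \<kappa> (b x) = \<beta> (\<kappa> x)"
  shows "(\<Sum>g\<in>carrier G. card {x \<in> X. act x g = b x})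
       = card (carrier G) * card {k \<in> \<kappa> ` X. \<beta> k = k}"
proof -
  interpret group G by (rule G)
  let ?fib = "\<lambda>x y. {g \<in> carrier G. act x g = y}"
  let ?cls = "\<lambda>k. {y \<in> X. \<kappa> y = k}"
  have fib_le: "card (?fib x y) \<le> card (?fib x z)"
    if x: "x \<in> X" and y: "y \<in> X" "\<kappa> y = \<kappa> x" and z: "z \<in> X" "\<kappa> z = \<kappa> x" for x y z
  proof -
    obtain h where h: "h \<in> carrier G" "act y h = z" using orbits[OF y(1) z(1)] y z by auto
    show ?thesis
    proof (rule card_inj_on_le[of "\<lambda>g. g \<otimes> h"])
      show "inj_on (\<lambda>g. g \<otimes> h) (?fib x y)"
        by (rule inj_onI) (use right_cancel[OF h(1)] in blast)
      show "(\<lambda>g. g \<otimes> h) ` ?fib x y \<subseteq> ?fib x z"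
        using h mult[OF x _ h(1), symmetric] m_closed[OF _ h(1)] by force
    qed (use fG in simp)
  qed
  have fib: "card (?fib x y) * card (?cls (\<kappa> x)) = card (carrier G)"
    if x: "x \<in> X" and y: "y \<in> X" "\<kappa> y = \<kappa> x" for x y
  proof -
    have kap: "\<kappa> (act x g) = \<kappa> x" if "g \<in> carrier G" for g
      using orbits[OF x closed[OF x that]] that by auto
    have "card (carrier G) = card (\<Union>z\<in>?cls (\<kappa> x). ?fib x z)"
      by (rule arg_cong[where f = card]) (auto simp: closed[OF x] dest: kap)
    also have "\<dots> = (\<Sum>z\<in>?cls (\<kappa> x). card (?fib x z))"
      by (rule card_UN_disjoint) (use fX fG in auto)
    also have "\<dots> = (\<Sum>z\<in>?cls (\<kappa> x). card (?fib x y))"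
      by (rule sum.cong[OF refl], rule antisym) (use fib_le x y in auto)
    finally show ?thesis by simp
  qed
  have "(\<Sum>g\<in>carrier G. card {x \<in> X. act x g = b x})
      = (\<Sum>g\<in>carrier G. \<Sum>x\<in>X. if act x g = b x then 1 else 0)"
    using fX by (simp add: sum.If_cases Int_def)
  also have "\<dots> = (\<Sum>x\<in>X. card (?fib x (b x)))"
    by (subst sum.swap) (use fG in \<open>simp add: sum.If_cases Int_def\<close>)
  also have "\<dots> = (\<Sum>k\<in>\<kappa> ` X. \<Sum>x\<in>?cls k. card (?fib x (b x)))"
    by (rule sum.image_gen[OF fX])
  also have "\<dots> = (\<Sum>k\<in>\<kappa> ` X. if \<beta> k = k then card (carrier G) else 0)"
  proof (rule sum.cong[OF refl])
    fix k assume k: "k \<in> \<kappa> ` X"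
    show "(\<Sum>x\<in>?cls k. card (?fib x (b x))) = (if \<beta> k = k then card (carrier G) else 0)"
    proof (cases "\<beta> k = k")
      case True
      obtain x0 where x0: "x0 \<in> X" "\<kappa> x0 = k" using k by auto
      have ne: "card (?cls k) > 0" using x0 fX by (auto simp: card_gt_0_iff)
      have "card (?fib x (b x)) = card (carrier G) div card (?cls k)" if "x \<in> ?cls k" for x
      proof -
        have "card (?fib x (b x)) * card (?cls k) = card (carrier G)"
          using fib[of x "b x"] b[of x] that True by simp
        then show ?thesis using ne by (metis less_not_refl nonzero_mult_div_cancel_right)
      qed
      then have "(\<Sum>x\<in>?cls k. card (?fib x (b x))) = card (?cls k) * (card (carrier G) div card (?cls k))"
        by simp
      also have "\<dots> = card (carrier G)"
        using fib[OF x0(1) x0(1) refl] dvd_triv_right[of "card (?cls k)" "card (?fib x0 x0)"] x0(2)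
        by (simp add: dvd_mult_div_cancel)
      finally show ?thesis using True by simp
    next
      case False
      have "?fib x (b x) = {}" if "x \<in> ?cls k" for x
        using orbits[of x "b x"] b[of x] that False by auto
      then have "(\<Sum>x\<in>?cls k. card (?fib x (b x))) = 0"
        by (intro sum.neutral ballI) (simp only: card.empty)
      then show ?thesis using False by simp
    qed
  qed
  also have "\<dots> = card (carrier G) * card {k \<in> \<kappa> ` X. \<beta> k = k}"
    using fX by (simp add: sum.If_cases Int_def)
  finally show ?thesis .
qed

section \<open>Orbits of matrices under column operations\<close>

text \<open>
  A functional that vanishes wherever finitely many given functionals vanish is a linear
  combination of them; functionals are represented by vectors through the standard bilinear form. The induction adds one functional at a time: if it does not vanish on the common
  kernel of the earlier ones, a multiple of it is subtracted from \<open>a\<close>.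
\<close>

lemma double_annihilator:
  fixes r :: "nat \<Rightarrow> 'a :: field vec"
  assumes "a \<in> carrier_vec N" and "\<And>i. i < m \<Longrightarrow> r i \<in> carrier_vec N"
    and "\<And>\<phi>. \<phi> \<in> carrier_vec N \<Longrightarrow> (\<forall>i<m. r i \<bullet> \<phi> = 0) \<Longrightarrow> a \<bullet> \<phi> = 0"
  shows "\<exists>c. \<forall>j<N. a $ j = (\<Sum>i<m. c i * r i $ j)"
  using assms
proof (induction m arbitrary: a)
  case 0
  have "a $ j = 0" if "j < N" for j
    using 0(3)[of "unit_vec N j"] 0(1) that by simp
  then show ?case by simp
next
  case (Suc m)
  note rc = Suc.prems(2)
  show ?case
  proof (cases "\<exists>\<psi>\<in>carrier_vec N. (\<forall>i<m. r i \<bullet> \<psi> = 0) \<and> r m \<bullet> \<psi> \<noteq> 0")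
    case True
    then obtain \<psi> where \<psi>: "\<psi> \<in> carrier_vec N" "\<forall>i<m. r i \<bullet> \<psi> = 0" "r m \<bullet> \<psi> \<noteq> 0" by blast
    define t where "t = (a \<bullet> \<psi>) / (r m \<bullet> \<psi>)"
    have "\<exists>c. \<forall>j<N. (a - t \<cdot>\<^sub>v r m) $ j = (\<Sum>i<m. c i * r i $ j)"
    proof (rule Suc.IH)
      show "a - t \<cdot>\<^sub>v r m \<in> carrier_vec N" using Suc.prems(1) rc[of m] by simp
      show "r i \<in> carrier_vec N" if "i < m" for i using rc that by simp
      fix \<phi> assume \<phi>: "\<phi> \<in> carrier_vec N" "\<forall>i<m. r i \<bullet> \<phi> = 0"
      define s where "s = (r m \<bullet> \<phi>) / (r m \<bullet> \<psi>)"
      have dot: "x \<bullet> (\<phi> - s \<cdot>\<^sub>v \<psi>) = x \<bullet> \<phi> - s * (x \<bullet> \<psi>)" if "x \<in> carrier_vec N" for x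
        using that \<phi>(1) \<psi>(1) by (simp add: scalar_prod_minus_distrib)
      have "a \<bullet> (\<phi> - s \<cdot>\<^sub>v \<psi>) = 0"
      proof (rule Suc.prems(3))
        show "\<phi> - s \<cdot>\<^sub>v \<psi> \<in> carrier_vec N" using \<phi>(1) \<psi>(1) by simp
        show "\<forall>i<Suc m. r i \<bullet> (\<phi> - s \<cdot>\<^sub>v \<psi>) = 0"
          unfolding less_Suc_eq using \<phi>(2) \<psi>(2) dot[OF rc] \<psi>(3)
          by (auto simp: s_def)
      qed
      then have "a \<bullet> \<phi> = s * (a \<bullet> \<psi>)" using dot[OF Suc.prems(1)] by simp
      then show "(a - t \<cdot>\<^sub>v r m) \<bullet> \<phi> = 0"
        using \<phi>(1) Suc.prems(1) rc[of m]
        by (simp add: minus_scalar_prod_distrib t_def s_def)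
    qed
    then obtain c where c: "\<And>j. j < N \<Longrightarrow> (a - t \<cdot>\<^sub>v r m) $ j = (\<Sum>i<m. c i * r i $ j)" by blast
    have "a $ j = (\<Sum>i<Suc m. (c(m := t)) i * r i $ j)" if "j < N" for j
      using c[OF that] that Suc.prems(1) rc[of m] by (simp add: algebra_simps)
    then show ?thesis by blast
  next
    case False
    have "\<exists>c. \<forall>j<N. a $ j = (\<Sum>i<m. c i * r i $ j)"
    proof (rule Suc.IH)
      show "a \<bullet> \<phi> = 0" if "\<phi> \<in> carrier_vec N" "\<forall>i<m. r i \<bullet> \<phi> = 0" for \<phi>
        using Suc.prems(3)[OF that(1)] False that by (auto simp: less_Suc_eq)
    qed (use Suc.prems in auto)
    then obtain c where c: "\<forall>j<N. a $ j = (\<Sum>i<m. c i * r i $ j)" by blast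
    then have "\<forall>j<N. a $ j = (\<Sum>i<Suc m. (c(m := 0)) i * r i $ j)" by simp
    then show ?thesis by blast
  qed
qed

lemma mult_vec_index_sum:
  "A \<in> carrier_mat n k \<Longrightarrow> v \<in> carrier_vec k \<Longrightarrow> i < n \<Longrightarrow>
     (A *\<^sub>v v) $ i = (\<Sum>j<k. A $$ (i, j) * v $ j)"
  by (simp add: scalar_prod_def lessThan_atLeast0)

text \<open>
  The map \<open>v \<mapsto> v + (v \<bullet> \<phi>) u\<close>, where \<open>u\<close> is chosen so that \<open>s \<mapsto> t\<close>, fixes the hyperplane
  \<open>\<phi> = 0\<close> pointwise; since \<open>\<phi>\<close> is nonzero at \<open>s\<close> and at the image \<open>t\<close> of \<open>s\<close>, it is injective.
\<close>

lemma transvection: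
  fixes s t :: "'a :: field vec"
  assumes c: "s \<in> carrier_vec N" "t \<in> carrier_vec N" "\<phi> \<in> carrier_vec N"
    and s: "s \<bullet> \<phi> \<noteq> 0" and t: "t \<bullet> \<phi> \<noteq> 0"
  shows "\<exists>h\<in>carrier (GL N). h *\<^sub>v s = t \<and> (\<forall>v\<in>carrier_vec N. v \<bullet> \<phi> = 0 \<longrightarrow> h *\<^sub>v v = v)"
proof -
  define u where "u = inverse (s \<bullet> \<phi>) \<cdot>\<^sub>v (t - s)"
  define h where "h = mat N N (\<lambda>(i, j). (if i = j then 1 else 0) + u $ i * \<phi> $ j)"
  have u: "u \<in> carrier_vec N" using c by (simp add: u_def)
  have zero: "v + 0 \<cdot>\<^sub>v u = v" if "v \<in> carrier_vec N" for v
    using that u by (intro eq_vecI) auto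
  have h: "h \<in> carrier_mat N N" by (simp add: h_def)
  have hv: "h *\<^sub>v v = v + (v \<bullet> \<phi>) \<cdot>\<^sub>v u" if v: "v \<in> carrier_vec N" for v
  proof (rule eq_vecI)
    fix i assume "i < dim_vec (v + (v \<bullet> \<phi>) \<cdot>\<^sub>v u)"
    then have i: "i < N" using u by simp
    have "(h *\<^sub>v v) $ i = (\<Sum>j<N. (if i = j then v $ j else 0) + u $ i * (v $ j * \<phi> $ j))"
      unfolding mult_vec_index_sum[OF h v i]
      by (rule sum.cong[OF refl]) (use i in \<open>simp add: h_def algebra_simps\<close>)
    also have "\<dots> = v $ i + u $ i * (v \<bullet> \<phi>)"
      using i c(3) by (simp add: sum.distrib sum_distrib_left scalar_prod_def lessThan_atLeast0)
    finally show "(h *\<^sub>v v) $ i = (v + (v \<bullet> \<phi>) \<cdot>\<^sub>v u) $ i" using i u by (simp add: mult.commute)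
  qed (use u h in simp)
  have u\<phi>: "u \<bullet> \<phi> = (t \<bullet> \<phi>) / (s \<bullet> \<phi>) - 1"
    using c s by (simp add: u_def minus_scalar_prod_distrib field_simps)
  have "h \<in> carrier (GL N)"
  proof (rule GL_if_injective[OF h])
    fix v assume v: "v \<in> carrier_vec N" and "h *\<^sub>v v = 0\<^sub>v N"
    then have eq: "v + (v \<bullet> \<phi>) \<cdot>\<^sub>v u = 0\<^sub>v N" using hv by simp
    have "(v + (v \<bullet> \<phi>) \<cdot>\<^sub>v u) \<bullet> \<phi> = (v \<bullet> \<phi>) * ((t \<bullet> \<phi>) / (s \<bullet> \<phi>))"
      using v u c by (simp add: add_scalar_prod_distrib u\<phi> algebra_simps)
    then have "v \<bullet> \<phi> = 0" using s t c unfolding eq by simp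
    then show "v = 0\<^sub>v N" using eq u v zero by simp
  qed
  moreover have "h *\<^sub>v s = t"
    using c s by (intro eq_vecI) (simp_all add: hv[OF c(1)] u_def field_simps del: index_mult_mat_vec)
  moreover have "h *\<^sub>v v = v" if "v \<in> carrier_vec N" "v \<bullet> \<phi> = 0" for v
    using hv[OF that(1)] that zero by simp
  ultimately show ?thesis by blast
qed

lemma relations_image:
  fixes r :: "nat \<Rightarrow> 'a :: field vec"
  assumes h: "h \<in> carrier_mat N N" and r: "\<And>i. i < k \<Longrightarrow> r i \<in> carrier_vec N"
    and rel: "\<forall>j<N. (\<Sum>i<k. c i * r i $ j) = 0"
  shows "\<forall>j<N. (\<Sum>i<k. c i * (h *\<^sub>v r i) $ j) = 0"
proof (intro allI impI)
  fix j assume j: "j < N"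
  have "(\<Sum>i<k. c i * (h *\<^sub>v r i) $ j) = (\<Sum>i<k. \<Sum>l<N. h $$ (j, l) * (c i * r i $ l))"
    by (rule sum.cong[OF refl])
      (use r j in \<open>simp del: index_mult_mat_vec add: mult_vec_index_sum[OF h] sum_distrib_left algebra_simps\<close>)
  also have "\<dots> = (\<Sum>l<N. h $$ (j, l) * (\<Sum>i<k. c i * r i $ l))"
    by (subst sum.swap) (simp add: sum_distrib_left)
  also have "\<dots> = 0" using rel by simp
  finally show "(\<Sum>i<k. c i * (h *\<^sub>v r i) $ j) = 0" .
qed

text \<open>
  Induction on the number of vectors. Once the first \<open>k\<close> vectors have been moved into place, the
  image \<open>s\<close> of the next one must be moved to \<open>r' k\<close> without disturbing them. If \<open>s\<close> depends on the
  earlier vectors, the common relations force \<open>s = r' k\<close>. Otherwise neither \<open>s\<close> nor \<open>r' k\<close> depends on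
  them, so \<open>double_annihilator\<close> gives a functional that kills the earlier vectors and is nonzero on
  both, and the corresponding transvection does the job.
\<close>

lemma GL_equivalent_if_same_relations:
  fixes r r' :: "nat \<Rightarrow> 'a :: field vec"
  assumes "\<And>i. i < k \<Longrightarrow> r i \<in> carrier_vec N" "\<And>i. i < k \<Longrightarrow> r' i \<in> carrier_vec N"
    and "\<And>c. (\<forall>j<N. (\<Sum>i<k. c i * r i $ j) = 0) \<longleftrightarrow> (\<forall>j<N. (\<Sum>i<k. c i * r' i $ j) = 0)"
  shows "\<exists>h\<in>carrier (GL N). \<forall>i<k. h *\<^sub>v r i = r' i"
  using assms
proof (induction k)
  case 0
  then show ?case using one_in_GL by blast
next
  case (Suc k)
  note r = Suc.prems(1) and r' = Suc.prems(2) and same = Suc.prems(3)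
  have "\<exists>h\<in>carrier (GL N). \<forall>i<k. h *\<^sub>v r i = r' i"
  proof (rule Suc.IH)
    show "(\<forall>j<N. (\<Sum>i<k. c i * r i $ j) = 0) \<longleftrightarrow> (\<forall>j<N. (\<Sum>i<k. c i * r' i $ j) = 0)" for c
      using same[of "c(k := 0)"] by simp
  qed (use r r' in auto)
  then obtain h where h: "h \<in> carrier (GL N)" "\<And>i. i < k \<Longrightarrow> h *\<^sub>v r i = r' i" by blast
  note hc = GL_carrier_mat[OF h(1)]
  obtain h' where h': "h' \<in> carrier (GL N)" "h' * h = 1\<^sub>m N" using h(1) by (rule GL_E)
  define s where "s = h *\<^sub>v r k"
  have s: "s \<in> carrier_vec N" unfolding s_def by (rule mult_mat_vec_carrier[OF hc r]) simp
  have same_s: "(\<forall>j<N. (\<Sum>i<k. c i * r' i $ j) + c k * s $ j = 0) \<longleftrightarrow>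
      (\<forall>j<N. (\<Sum>i<k. c i * r' i $ j) + c k * r' k $ j = 0)" (is "?L = ?R") for c
  proof -
    have hr: "(\<forall>j<N. (\<Sum>i<Suc k. c i * (h *\<^sub>v r i) $ j) = 0) \<longleftrightarrow> ?L"
      using h(2) by (simp del: index_mult_mat_vec add: s_def)
    have undo: "h' *\<^sub>v (h *\<^sub>v r i) = r i" if "i < Suc k" for i
      using assoc_mult_mat_vec[OF GL_carrier_mat[OF h'(1)] hc r[OF that]] h'(2) r[OF that]
      by (simp del: index_mult_mat_vec)
    have "(\<forall>j<N. (\<Sum>i<Suc k. c i * (h *\<^sub>v r i) $ j) = 0) \<longleftrightarrow> (\<forall>j<N. (\<Sum>i<Suc k. c i * r i $ j) = 0)"
    proof
      assume "\<forall>j<N. (\<Sum>i<Suc k. c i * (h *\<^sub>v r i) $ j) = 0"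
      then have "\<forall>j<N. (\<Sum>i<Suc k. c i * (h' *\<^sub>v (h *\<^sub>v r i)) $ j) = 0"
        by (intro relations_image[OF GL_carrier_mat[OF h'(1)]])
          (use hc in \<open>auto intro: mult_mat_vec_carrier r\<close>)
      then show "\<forall>j<N. (\<Sum>i<Suc k. c i * r i $ j) = 0"
        by (simp add: undo del: index_mult_mat_vec sum.lessThan_Suc)
    qed (rule relations_image[OF hc r])
    then show ?thesis using hr same[of c] by simp
  qed
  show ?case
  proof (cases "\<exists>c. \<forall>j<N. s $ j = (\<Sum>i<k. c i * r' i $ j)")
    case True
    then obtain c where c: "\<forall>j<N. s $ j = (\<Sum>i<k. c i * r' i $ j)" by blast
    have "\<forall>j<N. r' k $ j = (\<Sum>i<k. c i * r' i $ j)"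
      using c same_s[of "c(k := -1)"] by simp
    then have "s = r' k" using c s r'[of k] by (intro eq_vecI) auto
    then have "\<forall>i<Suc k. h *\<^sub>v r i = r' i" using h(2) by (metis less_Suc_eq s_def)
    then show ?thesis using h(1) by blast
  next
    case False
    have no: "\<not> (\<exists>c. \<forall>j<N. r' k $ j = (\<Sum>i<k. c i * r' i $ j))"
    proof
      assume "\<exists>c. \<forall>j<N. r' k $ j = (\<Sum>i<k. c i * r' i $ j)"
      then obtain c where c: "\<forall>j<N. r' k $ j = (\<Sum>i<k. c i * r' i $ j)" by blast
      then have "\<forall>j<N. s $ j = (\<Sum>i<k. c i * r' i $ j)"
        using same_s[of "c(k := -1)"] by simp
      then show False using False by blast
    qed
    have sep: "\<exists>\<phi>\<in>carrier_vec N. (\<forall>i<k. r' i \<bullet> \<phi> = 0) \<and> a \<bullet> \<phi> \<noteq> 0"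
      if "a \<in> carrier_vec N" "\<not> (\<exists>c. \<forall>j<N. a $ j = (\<Sum>i<k. c i * r' i $ j))" for a
      using double_annihilator[of a N k r', OF that(1) r'] that(2) by (meson less_SucI)
    obtain \<phi>1 where \<phi>1: "\<phi>1 \<in> carrier_vec N" "\<forall>i<k. r' i \<bullet> \<phi>1 = 0" "s \<bullet> \<phi>1 \<noteq> 0"
      using sep[OF s False] by blast
    obtain \<phi>2 where \<phi>2: "\<phi>2 \<in> carrier_vec N" "\<forall>i<k. r' i \<bullet> \<phi>2 = 0" "r' k \<bullet> \<phi>2 \<noteq> 0"
      using sep[OF r'[OF lessI] no] by blast
    \<comment> \<open>One of \<open>\<phi>1\<close>, \<open>\<phi>2\<close>, \<open>\<phi>1 + \<phi>2\<close> is nonzero on both vectors.\<close>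
    have "\<exists>\<phi>\<in>carrier_vec N. (\<forall>i<k. r' i \<bullet> \<phi> = 0) \<and> s \<bullet> \<phi> \<noteq> 0 \<and> r' k \<bullet> \<phi> \<noteq> 0"
    proof (cases "r' k \<bullet> \<phi>1 = 0 \<and> s \<bullet> \<phi>2 = 0")
      case True
      have add: "x \<bullet> (\<phi>1 + \<phi>2) = x \<bullet> \<phi>1 + x \<bullet> \<phi>2" if "x \<in> carrier_vec N" for x
        using that \<phi>1(1) \<phi>2(1) by (simp add: scalar_prod_add_distrib)
      show ?thesis
      proof (intro bexI[of _ "\<phi>1 + \<phi>2"] conjI allI impI)
        show "\<phi>1 + \<phi>2 \<in> carrier_vec N" using \<phi>1(1) \<phi>2(1) by simp
      qed (use True \<phi>1 \<phi>2 in \<open>simp_all add: add r' s\<close>)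
    qed (use \<phi>1 \<phi>2 in blast)
    then obtain \<phi> where \<phi>: "\<phi> \<in> carrier_vec N" "\<forall>i<k. r' i \<bullet> \<phi> = 0" "s \<bullet> \<phi> \<noteq> 0" "r' k \<bullet> \<phi> \<noteq> 0"
      by blast
    obtain t where t: "t \<in> carrier (GL N)" "t *\<^sub>v s = r' k"
      "\<And>v. v \<in> carrier_vec N \<Longrightarrow> v \<bullet> \<phi> = 0 \<Longrightarrow> t *\<^sub>v v = v"
      using transvection[OF s r'[of k] \<phi>(1,3,4)] by auto
    have th: "t * h \<in> carrier (GL N)"
      using group.is_monoid[OF group_GL, THEN monoid.m_closed, of t N h] t(1) h(1) by simp
    have "(t * h) *\<^sub>v r i = t *\<^sub>v (h *\<^sub>v r i)" if "i < Suc k" for i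
      by (rule assoc_mult_mat_vec[OF GL_carrier_mat[OF t(1)] hc r[OF that]])
    then have "\<forall>i<Suc k. (t * h) *\<^sub>v r i = r' i"
      using t(2,3) h(2) r' \<phi>(2) by (simp add: less_Suc_eq all_conj_distrib imp_conjR s_def del: index_mult_mat_vec)
    then show ?thesis using th by blast
  qed
qed

text \<open>
  Column operations on a matrix are a simultaneous linear map on its rows, up to a transposition.
\<close>

lemma row_mult_transpose:
  fixes M :: "'a :: field mat"
  assumes M: "M \<in> carrier_mat m N" and M': "M' \<in> carrier_mat m N" and h: "h \<in> carrier_mat N N"
  shows "M * transpose_mat h = M' \<longleftrightarrow> (\<forall>i<m. h *\<^sub>v row M i = row M' i)"
proof
  assume eq: "M * transpose_mat h = M'"
  show "\<forall>i<m. h *\<^sub>v row M i = row M' i"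
  proof (intro allI impI)
    fix i assume i: "i < m"
    show "h *\<^sub>v row M i = row M' i"
      unfolding eq[symmetric]
      by (rule eq_vecI) (use M h i in \<open>auto intro: comm_scalar_prod[of _ N]\<close>)
  qed
next
  assume eq: "\<forall>i<m. h *\<^sub>v row M i = row M' i"
  show "M * transpose_mat h = M'"
  proof (rule eq_matI)
    fix i j assume "i < dim_row M'" "j < dim_col M'"
    then have ij: "i < m" "j < N" using M' by auto
    have "(M * transpose_mat h) $$ (i, j) = (h *\<^sub>v row M i) $ j"
      using M h ij by (auto intro: comm_scalar_prod[of _ N])
    also have "\<dots> = M' $$ (i, j)" using eq ij M' by (simp del: index_mult_mat_vec)
    finally show "(M * transpose_mat h) $$ (i, j) = M' $$ (i, j)" .
  qed (use M M' h in auto)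
qed

definition left_kernel :: "'a :: field mat \<Rightarrow> 'a vec set" where
  "left_kernel M = {c \<in> carrier_vec (dim_row M). transpose_mat M *\<^sub>v c = 0\<^sub>v (dim_col M)}"

lemma left_kernel_iff:
  assumes M: "M \<in> carrier_mat m N"
  shows "c \<in> left_kernel M \<longleftrightarrow> c \<in> carrier_vec m \<and> (\<forall>j<N. (\<Sum>i<m. c $ i * M $$ (i, j)) = 0)"
proof -
  have "transpose_mat M *\<^sub>v c = 0\<^sub>v N \<longleftrightarrow> (\<forall>j<N. (\<Sum>i<m. c $ i * M $$ (i, j)) = 0)"
    if c: "c \<in> carrier_vec m"
  proof -
    have MT: "transpose_mat M \<in> carrier_mat N m" using M by simp
    have *: "(transpose_mat M *\<^sub>v c) $ j = (\<Sum>i<m. c $ i * M $$ (i, j))" if "j < N" for j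
      unfolding mult_vec_index_sum[OF MT c that]
      by (rule sum.cong) (use M that in \<open>auto simp: mult.commute\<close>)
    have "transpose_mat M *\<^sub>v c = 0\<^sub>v N \<longleftrightarrow> (\<forall>j<N. (transpose_mat M *\<^sub>v c) $ j = 0)"
      using M by (auto simp: vec_eq_iff simp del: index_mult_mat_vec)
    then show ?thesis using * by simp
  qed
  then show ?thesis using M by (auto simp: left_kernel_def)
qed

lemma left_kernel_mult:
  assumes B: "B \<in> carrier_mat m m" and M: "M \<in> carrier_mat m N"
  shows "left_kernel (B * M) = {c \<in> carrier_vec m. transpose_mat B *\<^sub>v c \<in> left_kernel M}"
proof -
  have "transpose_mat (B * M) *\<^sub>v c = transpose_mat M *\<^sub>v (transpose_mat B *\<^sub>v c)"
    if "c \<in> carrier_vec m" for c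
    unfolding transpose_mult[OF B M]
    by (rule assoc_mult_mat_vec) (use B M that in auto)
  then show ?thesis
    using B M by (auto simp: left_kernel_def simp del: index_mult_mat_vec)
qed

lemma left_kernel_mult_GL:
  assumes M: "M \<in> carrier_mat m N" and g: "g \<in> carrier (GL N)"
  shows "left_kernel (M * g) = left_kernel M"
proof -
  have sub: "left_kernel A \<subseteq> left_kernel (A * h)" if A: "A \<in> carrier_mat m N" and h: "h \<in> carrier_mat N N"
    for A h :: "'a mat"
  proof
    fix c assume c: "c \<in> left_kernel A"
    then have cc: "c \<in> carrier_vec m" and c0: "transpose_mat A *\<^sub>v c = 0\<^sub>v N"
      using A by (auto simp: left_kernel_def)
    have "transpose_mat (A * h) *\<^sub>v c = transpose_mat h *\<^sub>v (transpose_mat A *\<^sub>v c)"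
      unfolding transpose_mult[OF A h] by (rule assoc_mult_mat_vec) (use A h cc in auto)
    also have "\<dots> = 0\<^sub>v N" unfolding c0 using h by (intro eq_vecI) auto
    finally show "c \<in> left_kernel (A * h)" using A h cc by (simp add: left_kernel_def)
  qed
  obtain h where h: "h \<in> carrier (GL N)" "g * h = 1\<^sub>m N" using g by (rule GL_E)
  note gc = GL_carrier_mat[OF g] and hc = GL_carrier_mat[OF h(1)]
  have "M * g * h = M" using assoc_mult_mat[OF M gc hc] h(2) M by simp
  then show ?thesis
    using sub[OF M gc] sub[OF mult_carrier_mat[OF M gc] hc] by auto
qed

text \<open>
  The left kernel is a complete invariant of a matrix under column operations: it is the space of
  linear relations between the rows.
\<close>

lemma left_kernel_eq_iff:
  assumes M: "M \<in> carrier_mat m N" and M': "M' \<in> carrier_mat m N"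
  shows "left_kernel M = left_kernel M' \<longleftrightarrow> (\<exists>g\<in>carrier (GL N). M * g = M')"
proof
  assume eq: "left_kernel M = left_kernel M'"
  have rel: "(\<forall>j<N. (\<Sum>i<m. c i * row A i $ j) = 0) \<longleftrightarrow> vec m c \<in> left_kernel A"
    if A: "A \<in> carrier_mat m N" for A c
    unfolding left_kernel_iff[OF A] using A by simp
  have "\<exists>h\<in>carrier (GL N). \<forall>i<m. h *\<^sub>v row M i = row M' i"
  proof (rule GL_equivalent_if_same_relations)
    show "(\<forall>j<N. (\<Sum>i<m. c i * row M i $ j) = 0) \<longleftrightarrow> (\<forall>j<N. (\<Sum>i<m. c i * row M' i $ j) = 0)" for c
      unfolding rel[OF M] rel[OF M'] eq ..
  qed (use M M' in auto)
  then obtain h where h: "h \<in> carrier (GL N)" "\<forall>i<m. h *\<^sub>v row M i = row M' i" by blast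
  then have "M * transpose_mat h = M'"
    using row_mult_transpose[OF M M' GL_carrier_mat[OF h(1)]] by blast
  then show "\<exists>g\<in>carrier (GL N). M * g = M'" using transpose_in_GL[OF h(1)] by blast
qed (use left_kernel_mult_GL[OF M] in blast)

lemma wide_matrix_kernel:
  fixes M :: "'a :: field mat"
  assumes M: "M \<in> carrier_mat m N" and "m < N"
  obtains y where "y \<in> carrier_vec N" "y \<noteq> 0\<^sub>v N" "M *\<^sub>v y = 0\<^sub>v m"
proof -
  define A where "A = mat N N (\<lambda>(i, j). if i < m then M $$ (i, j) else 0)"
  have A: "A \<in> carrier_mat N N" by (simp add: A_def)
  have "A \<notin> carrier (GL N)"
  proof
    assume "A \<in> carrier (GL N)"
    then obtain B where B: "B \<in> carrier (GL N)" "A * B = 1\<^sub>m N" by (rule GL_E)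
    have "(A * B) $$ (m, m) = 0"
      using \<open>m < N\<close> GL_carrier_mat[OF B(1)] by (simp add: A_def scalar_prod_def)
    then show False using B(2) \<open>m < N\<close> by simp
  qed
  then obtain y where y: "y \<in> carrier_vec N" "A *\<^sub>v y = 0\<^sub>v N" "y \<noteq> 0\<^sub>v N"
    using GL_if_injective[OF A] by blast
  have "M *\<^sub>v y = 0\<^sub>v m"
  proof (rule eq_vecI)
    fix i assume "i < dim_vec (0\<^sub>v m :: 'a vec)"
    then have i: "i < m" "i < N" using \<open>m < N\<close> by auto
    have "(M *\<^sub>v y) $ i = (A *\<^sub>v y) $ i"
      unfolding mult_vec_index_sum[OF M y(1) i(1)] mult_vec_index_sum[OF A y(1) i(2)]
      using i by (simp add: A_def)
    then show "(M *\<^sub>v y) $ i = 0\<^sub>v m $ i" using y(2) i by simp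
  qed (use M in auto)
  then show ?thesis using that y by blast
qed

text \<open>
  A zero column can be appended without changing the left kernel. Conversely a matrix with more
  columns than rows has a column that is a combination of the others, so it can be deleted.
\<close>

lemma left_kernels_Suc:
  assumes "m \<le> N"
  shows "left_kernel ` carrier_mat m (Suc N) = (left_kernel ` carrier_mat m N :: 'a :: field vec set set)"
proof (intro equalityI subsetI)
  fix K :: "'a vec set" assume "K \<in> left_kernel ` carrier_mat m (Suc N)"
  then obtain M where M: "M \<in> carrier_mat m (Suc N)" and K: "K = left_kernel M" by blast
  obtain y where y: "y \<in> carrier_vec (Suc N)" "y \<noteq> 0\<^sub>v (Suc N)" "M *\<^sub>v y = 0\<^sub>v m"
    using wide_matrix_kernel[OF M] assms by auto
  obtain l where l: "l < Suc N" "y $ l \<noteq> 0"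
    using y(1,2) by (metis carrier_vecD eq_vecI index_zero_vec)
  define M' where "M' = mat m N (\<lambda>(i, j). M $$ (i, if j < l then j else Suc j))"
  have M': "M' \<in> carrier_mat m N" by (simp add: M'_def)
  have "c \<in> left_kernel M \<longleftrightarrow> c \<in> left_kernel M'" for c
  proof -
    let ?s = "\<lambda>j. \<Sum>i<m. c $ i * M $$ (i, j)"
    have "(\<Sum>j<Suc N. y $ j * ?s j) = (\<Sum>j<Suc N. \<Sum>i<m. c $ i * (M $$ (i, j) * y $ j))"
      by (simp only: sum_distrib_left mult_ac)
    also have "\<dots> = (\<Sum>i<m. c $ i * (M *\<^sub>v y) $ i)"
      by (subst sum.swap)
        (simp add: mult_vec_index_sum[OF M y(1)] sum_distrib_left del: sum.lessThan_Suc index_mult_mat_vec)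
    also have "\<dots> = 0" unfolding y(3) by simp
    finally have "(\<Sum>j<Suc N. y $ j * ?s j) = 0" .
    then have tot: "y $ l * ?s l + (\<Sum>j\<in>{..<Suc N} - {l}. y $ j * ?s j) = 0"
      using l(1) by (simp add: sum.remove[of "{..<Suc N}" l] del: sum.lessThan_Suc)
    have "(\<forall>j<Suc N. ?s j = 0) \<longleftrightarrow> (\<forall>j<N. ?s (if j < l then j else Suc j) = 0)" (is "?L = ?R")
    proof
      assume R: ?R
      have ne: "?s j = 0" if j: "j < Suc N" "j \<noteq> l" for j
      proof (cases "j < l")
        case True
        then show ?thesis using R[rule_format, of j] l by simp
      next
        case False
        then obtain j' where "j = Suc j'" using less_imp_Suc_add[of l j] j(2) False by auto
        then show ?thesis using R[rule_format, of j'] False j by auto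
      qed
      have "?s l = 0" using tot ne l(2) by simp
      then show ?L using ne by blast
    qed (use l(1) in auto)
    then show ?thesis
      unfolding left_kernel_iff[OF M] left_kernel_iff[OF M'] by (simp add: M'_def)
  qed
  then show "K \<in> left_kernel ` carrier_mat m N" using M' K by blast
next
  fix K :: "'a vec set" assume "K \<in> left_kernel ` carrier_mat m N"
  then obtain M where M: "M \<in> carrier_mat m N" and K: "K = left_kernel M" by blast
  define M' where "M' = mat m (Suc N) (\<lambda>(i, j). if j < N then M $$ (i, j) else 0)"
  have M': "M' \<in> carrier_mat m (Suc N)" by (simp add: M'_def)
  have "left_kernel M' = left_kernel M"
    unfolding set_eq_iff left_kernel_iff[OF M] left_kernel_iff[OF M']
    by (auto simp: M'_def less_Suc_eq)
  then show "K \<in> left_kernel ` carrier_mat m (Suc N)" using M' K by blast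
qed

lemma left_kernels_stable:
  assumes "m \<le> N"
  shows "left_kernel ` carrier_mat m N = (left_kernel ` carrier_mat m m :: 'a :: field vec set set)"
  using assms by (induction N rule: dec_induct) (simp_all add: left_kernels_Suc)

text \<open>
  The left kernel is the annihilator of the column space, so it is zero exactly if the column space is
  everything.
\<close>

lemma full_rank_iff_left_kernel:
  fixes M :: "'a :: field mat"
  assumes M: "M \<in> carrier_mat m N"
  shows "vec_space.rank m M = m \<longleftrightarrow> left_kernel M = {0\<^sub>v m}"
proof -
  interpret vec_space "TYPE('a)" m .
  have cols: "set (cols M) \<subseteq> carrier_vec m" using M cols_dim by blast
  have colsp: "span (set (cols M)) = {y \<in> carrier_vec m. \<exists>x\<in>carrier_vec N. M *\<^sub>v x = y}"
    using col_space_eq[of M] M unfolding col_space_def by auto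
  have dotMx: "c \<bullet> (M *\<^sub>v x) = (transpose_mat M *\<^sub>v c) \<bullet> x"
    if "c \<in> carrier_vec m" "x \<in> carrier_vec N" for c x
    using transpose_vec_mult_scalar[OF M that(2,1)] by simp
  show ?thesis
  proof
    assume rk: "rank M = m"
    have "span (set (cols M)) = carrier_vec m"
    proof -
      obtain S where S: "finite S" "maximal S (\<lambda>T. T \<subseteq> set (cols M) \<and> lin_indpt T)"
        using maximal_exists_superset[of "set (cols M)" "\<lambda>T. T \<subseteq> set (cols M) \<and> lin_indpt T" "{}"]
          lin_dep_def by auto
      then have Ssub: "S \<subseteq> set (cols M)" "lin_indpt S" by (auto simp: maximal_def)
      have "card S = m" using rank_card_indpt[OF M S(2)] rk by simp
      then have "basis S"
        using dim_li_is_basis[OF fin_dim S(1) _ Ssub(2)] Ssub(1) cols by (auto simp: dim_is_n)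
      then have "carrier_vec m = span S" by (simp add: basis_def)
      also have "\<dots> \<subseteq> span (set (cols M))" by (rule span_is_monotone[OF Ssub(1)])
      finally show ?thesis using colsp by auto
    qed
    then have onto: "\<exists>x\<in>carrier_vec N. M *\<^sub>v x = y" if "y \<in> carrier_vec m" for y
      using colsp that by blast
    have "c = 0\<^sub>v m" if c: "c \<in> left_kernel M" for c
    proof (rule eq_vecI)
      have cc: "c \<in> carrier_vec m" "transpose_mat M *\<^sub>v c = 0\<^sub>v N"
        using c M by (auto simp: left_kernel_def)
      then show "dim_vec c = dim_vec (0\<^sub>v m)" by simp
      fix i assume "i < dim_vec (0\<^sub>v m :: 'a vec)"
      then have i: "i < m" by simp
      obtain x where x: "x \<in> carrier_vec N" "M *\<^sub>v x = unit_vec m i" using onto[of "unit_vec m i"] by auto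
      have "c $ i = c \<bullet> (M *\<^sub>v x)" unfolding x(2) using cc(1) i by simp
      also have "\<dots> = 0" unfolding dotMx[OF cc(1) x(1)] cc(2) using x(1) by simp
      finally show "c $ i = 0\<^sub>v m $ i" using i by simp
    qed
    moreover have "0\<^sub>v m \<in> left_kernel M" unfolding left_kernel_iff[OF M] by simp
    ultimately show "left_kernel M = {0\<^sub>v m}" by blast
  next
    assume ker: "left_kernel M = {0\<^sub>v m}"
    have "y \<in> span (set (cols M))" if y: "y \<in> carrier_vec m" for y
    proof -
      have "\<exists>c. \<forall>i<m. y $ i = (\<Sum>j<N. c j * col M j $ i)"
      proof (rule double_annihilator[OF y])
        show "col M j \<in> carrier_vec m" for j using M by auto
        fix \<phi> :: "'a vec" assume \<phi>: "\<phi> \<in> carrier_vec m" "\<forall>j<N. col M j \<bullet> \<phi> = 0"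
        have "transpose_mat M *\<^sub>v \<phi> = 0\<^sub>v N"
          by (rule eq_vecI) (use \<phi>(2) M in simp_all)
        then have "\<phi> \<in> left_kernel M" using \<phi>(1) M by (simp add: left_kernel_def)
        then show "y \<bullet> \<phi> = 0" using ker y by simp
      qed
      then obtain c where c: "\<And>i. i < m \<Longrightarrow> y $ i = (\<Sum>j<N. c j * col M j $ i)" by blast
      have "M *\<^sub>v vec N c = y"
      proof (rule eq_vecI)
        fix i assume "i < dim_vec y"
        then have i: "i < m" using y by simp
        show "(M *\<^sub>v vec N c) $ i = y $ i"
          unfolding mult_vec_index_sum[OF M vec_carrier i] c[OF i]
          by (rule sum.cong) (use M i in \<open>auto simp: mult.commute\<close>)
      qed (use M y in auto)
      then show ?thesis using colsp y vec_carrier by blast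
    qed
    then have "span (set (cols M)) = carrier_vec m" using colsp by auto
    then have "span_vs (set (cols M)) = V" by (simp add: module_vec_def)
    then show "rank M = m" by (simp add: rank_def dim_is_n)
  qed
qed

section \<open>The stable means of the counting functions\<close>

text \<open>
  The matrices counted for a conjugate of \<open>g\<close> correspond to those counted for \<open>g\<close> under a column
  operation; hence the counts are class functions.
\<close>

lemma card_twisted_fixed_conj:
  fixes B :: "'a :: {field, finite} mat"
  assumes X: "X \<subseteq> carrier_mat m N" and closed: "\<And>M g. M \<in> X \<Longrightarrow> g \<in> carrier (GL N) \<Longrightarrow> M * g \<in> X"
    and B: "B \<in> carrier_mat m m" and x: "x \<in> carrier (GL N)" and g: "g \<in> carrier (GL N)"
  shows "card {M \<in> X. M * (x \<otimes>\<^bsub>GL N\<^esub> g \<otimes>\<^bsub>GL N\<^esub> inv\<^bsub>GL N\<^esub> x) = B * M} = card {M \<in> X. M * g = B * M}"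
proof -
  interpret G: group "GL N :: 'a mat monoid" by (rule group_GL)
  define y where "y = inv\<^bsub>GL N\<^esub> x"
  have y: "y \<in> carrier (GL N)" using x by (simp add: y_def)
  have inv: "x * y = 1\<^sub>m N" "y * x = 1\<^sub>m N"
    using G.r_inv[OF x] G.l_inv[OF x] by (simp_all add: y_def)
  note c = GL_carrier_mat[OF x] GL_carrier_mat[OF y] GL_carrier_mat[OF g]
  have key: "M * (x * g * y) = B * M \<longleftrightarrow> M * x * g = B * (M * x)" if "M \<in> X" for M
  proof -
    have M: "M \<in> carrier_mat m N" using X that by blast
    have 1: "M * (x * g * y) = M * x * g * y"
      using assoc_mult_mat[OF M mult_carrier_mat[OF c(1,3)] c(2)] assoc_mult_mat[OF M c(1,3)] by simp
    have 2: "B * (M * x) = B * M * x" using assoc_mult_mat[OF B M c(1)] by simp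
    have 3: "M * x * g * y * x = M * x * g"
    proof -
      have "M * x * g * y * x = M * x * g * (y * x)"
        by (rule assoc_mult_mat) (use M c in auto)
      then show ?thesis using M c by (simp add: inv)
    qed
    have 4: "B * M * x * y = B * M"
    proof -
      have "B * M * x * y = B * M * (x * y)"
        by (rule assoc_mult_mat) (use M c B in auto)
      then show ?thesis using M c B by (simp add: inv)
    qed
    show ?thesis using 1 2 3 4 by metis
  qed
  have cancel: "M * x * y = M" "M * y * x = M" if "M \<in> X" for M
  proof -
    have M: "M \<in> carrier_mat m N" using X that by blast
    show "M * x * y = M" "M * y * x = M"
      using assoc_mult_mat[OF M c(1,2)] assoc_mult_mat[OF M c(2,1)] M by (simp_all add: inv)
  qed
  have "bij_betw (\<lambda>M. M * x) {M \<in> X. M * (x * g * y) = B * M} {M \<in> X. M * g = B * M}"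
  proof (rule bij_betw_byWitness[where f' = "\<lambda>M. M * y"])
    show "(\<lambda>M. M * x) ` {M \<in> X. M * (x * g * y) = B * M} \<subseteq> {M \<in> X. M * g = B * M}"
      using key closed[OF _ x] by blast
    show "(\<lambda>M. M * y) ` {M \<in> X. M * g = B * M} \<subseteq> {M \<in> X. M * (x * g * y) = B * M}"
    proof clarify
      fix M assume M: "M \<in> X" "M * g = B * M"
      then show "M * y \<in> X \<and> M * y * (x * g * y) = B * (M * y)"
        using key[OF closed[OF M(1) y]] closed[OF M(1) y] cancel(2)[OF M(1)] by simp
    qed
  qed (simp_all add: cancel)
  then show ?thesis by (simp add: bij_betw_same_card y_def[symmetric])
qed

text \<open>
  The set \<open>X\<close> is all matrices for \<open>Btilde\<close> and the matrices of full rank for \<open>Btilde_fr\<close>.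
\<close>

lemma expect_twisted_fixed:
  fixes B :: "'a :: {field, finite} mat"
  assumes X: "X \<subseteq> carrier_mat m N" and closed: "\<And>M g. M \<in> X \<Longrightarrow> g \<in> carrier (GL N) \<Longrightarrow> M * g \<in> X"
    and B: "B \<in> carrier_mat m m" and BX: "\<And>M. M \<in> X \<Longrightarrow> B * M \<in> X"
  shows "expect N (\<lambda>g. of_nat (card {M \<in> X. M * g = B * M}))
    = of_nat (card {K \<in> left_kernel ` X. {c \<in> carrier_vec m. transpose_mat B *\<^sub>v c \<in> K} = K})"
proof -
  let ?fixed = "{K \<in> left_kernel ` X. {c \<in> carrier_vec m. transpose_mat B *\<^sub>v c \<in> K} = K}"
  have "(\<Sum>g\<in>carrier (GL N). card {M \<in> X. M * g = B * M}) = card (carrier (GL N :: 'a mat monoid)) * card ?fixed"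
  proof (rule fixed_orbit_count[OF group_GL finite_GL])
    show "finite X" by (rule finite_subset[OF X finite_carrier_mat])
    show "M * g * h = M * (g \<otimes>\<^bsub>GL N\<^esub> h)"
      if "M \<in> X" "g \<in> carrier (GL N)" "h \<in> carrier (GL N)" for M g h
      using that X by (auto intro!: assoc_mult_mat dest: GL_carrier_mat)
    show "left_kernel M = left_kernel M' \<longleftrightarrow> (\<exists>g\<in>carrier (GL N). M * g = M')"
      if "M \<in> X" "M' \<in> X" for M M'
      using that X left_kernel_eq_iff by blast
    show "left_kernel (B * M) = {c \<in> carrier_vec m. transpose_mat B *\<^sub>v c \<in> left_kernel M}"
      if "M \<in> X" for M
      using left_kernel_mult[OF B] that X by blast
  qed (use closed BX in auto)
  then have "(\<Sum>g\<in>carrier (GL N). of_nat (card {M \<in> X. M * g = B * M})) =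
      (of_nat (card (carrier (GL N :: 'a mat monoid)) * card ?fixed) :: complex)"
    unfolding of_nat_sum[symmetric] by (rule arg_cong)
  then show ?thesis using card_GL_pos[where 'a='a, of N] by (simp add: expect_def)
qed

lemma has_stable_mean_abs_cf:
  assumes "class_family f"
  shows "has_stable_mean (abs_cf f) c \<longleftrightarrow> (\<forall>\<^sub>F N in sequentially. expect N (f N) = c)"
  by (rule fun_cong[OF has_stable_mean.abs_eq]) (use assms in \<open>simp add: cf_rel_def eq_onp_def\<close>)

lemma GL_transpose_kernel:
  assumes B: "B \<in> carrier (GL m)"
  shows "{c \<in> carrier_vec m. transpose_mat B *\<^sub>v c \<in> {0\<^sub>v m}} = {0\<^sub>v m}"
proof -
  obtain C where C: "C \<in> carrier (GL m)" "C * transpose_mat B = 1\<^sub>m m"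
    using transpose_in_GL[OF B] by (rule GL_E)
  note c = GL_carrier_mat[OF C(1)] GL_carrier_mat[OF transpose_in_GL[OF B]]
  have "v = 0\<^sub>v m" if "v \<in> carrier_vec m" "transpose_mat B *\<^sub>v v = 0\<^sub>v m" for v
  proof -
    have "v = (C * transpose_mat B) *\<^sub>v v" using C(2) that by simp
    also have "\<dots> = C *\<^sub>v (transpose_mat B *\<^sub>v v)" by (rule assoc_mult_mat_vec[OF c that(1)])
    also have "\<dots> = 0\<^sub>v m" unfolding that(2) using c by (intro eq_vecI) auto
    finally show ?thesis .
  qed
  moreover have "transpose_mat B *\<^sub>v 0\<^sub>v m = 0\<^sub>v m" using c by (intro eq_vecI) auto
  ultimately show ?thesis by auto
qed

lemma has_stable_mean_Btilde:
  fixes B :: "'a :: {field, finite} mat"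
  assumes B: "B \<in> carrier (GL m)"
  shows "has_stable_mean (Btilde m B) (of_nat (card {K \<in> left_kernel ` carrier_mat m m.
    {c \<in> carrier_vec m. transpose_mat B *\<^sub>v c \<in> K} = K}))"
proof -
  note Bc = GL_carrier_mat[OF B]
  have closed: "M * g \<in> carrier_mat m N" if "M \<in> carrier_mat m N" "g \<in> carrier (GL N)" for M g N
    using that by (auto dest: GL_carrier_mat)
  let ?f = "\<lambda>N g. of_nat (card {M \<in> carrier_mat m N. M * g = B * M}) :: complex"
  have "class_family ?f"
    unfolding class_family_def
    by (intro always_eventually allI ballI arg_cong[where f = of_nat] card_twisted_fixed_conj[OF subset_refl closed Bc])
  moreover have "expect N (?f N) = of_nat (card {K \<in> left_kernel ` carrier_mat m m.
    {c \<in> carrier_vec m. transpose_mat B *\<^sub>v c \<in> K} = K})" if "m \<le> N" for N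
    using expect_twisted_fixed[OF subset_refl closed Bc] Bc left_kernels_stable[OF that, where 'a='a] by simp
  ultimately show ?thesis
    unfolding Btilde_def has_stable_mean_abs_cf[OF \<open>class_family ?f\<close>] eventually_sequentially
    by (intro exI[of _ m] allI impI)
qed

text \<open>
  The left kernel of the zero matrix is the whole space, which \<open>B\<close> preserves.
\<close>

lemma fixed_kernels_pos:
  fixes B :: "'a :: {field, finite} mat"
  assumes B: "B \<in> carrier (GL m)"
  shows "card {K \<in> left_kernel ` carrier_mat m m.
    {c \<in> carrier_vec m. transpose_mat B *\<^sub>v c \<in> K} = K} > 0"
proof -
  have "left_kernel (0\<^sub>m m m) = (carrier_vec m :: 'a vec set)"
    by (auto simp: left_kernel_iff[of _ m m])
  then have "(carrier_vec m :: 'a vec set) \<in> left_kernel ` carrier_mat m m"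
    by (metis image_eqI zero_carrier_mat)
  then have "(carrier_vec m :: 'a vec set) \<in> {K \<in> left_kernel ` carrier_mat m m.
      {c \<in> carrier_vec m. transpose_mat B *\<^sub>v c \<in> K} = K}"
    using GL_carrier_mat[OF B] by (auto intro!: mult_mat_vec_carrier[of _ m m])
  then show ?thesis
    by (subst card_gt_0_iff) (auto intro!: finite_imageI finite_carrier_mat)
qed

lemma has_stable_mean_Btilde_fr:
  fixes B :: "'a :: {field, finite} mat"
  assumes B: "B \<in> carrier (GL m)"
  shows "has_stable_mean (Btilde_fr m B) 1"
proof -
  note Bc = GL_carrier_mat[OF B]
  define X :: "nat \<Rightarrow> 'a mat set" where "X = (\<lambda>N. {M \<in> carrier_mat m N. left_kernel M = {0\<^sub>v m}})"
  have XN: "X N \<subseteq> carrier_mat m N" for N by (auto simp: X_def)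
  have closed: "M * g \<in> X N" if "M \<in> X N" "g \<in> carrier (GL N)" for M g N
    using that left_kernel_mult_GL[of M m N g] by (simp add: X_def mult_carrier_mat[OF _ GL_carrier_mat])
  have BX: "B * M \<in> X N" if "M \<in> X N" for M N
    using that left_kernel_mult[OF Bc] GL_transpose_kernel[OF B] Bc by (auto simp: X_def)
  let ?f = "\<lambda>N g. of_nat (card {M \<in> X N. M * g = B * M}) :: complex"
  have "{M \<in> carrier_mat m N. M * g = B * M \<and> vec_space.rank m M = m} = {M \<in> X N. M * g = B * M}" for N g
    unfolding X_def by (rule Collect_cong) (use full_rank_iff_left_kernel[of _ m N] in blast)
  then have fr: "Btilde_fr m B = abs_cf ?f" unfolding Btilde_fr_def by presburger
  have cf: "class_family ?f"
    unfolding class_family_def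
    by (intro always_eventually allI ballI arg_cong[where f = of_nat] card_twisted_fixed_conj[OF XN closed Bc])
  have "expect N (?f N) = 1" if "m \<le> N" for N
  proof -
    have "left_kernel (1\<^sub>m m) = {0\<^sub>v m :: 'a vec}" by (auto simp: left_kernel_def)
    then have "{0\<^sub>v m :: 'a vec} \<in> left_kernel ` carrier_mat m m"
      by (intro image_eqI[of _ left_kernel "1\<^sub>m m"]) simp_all
    then have "{0\<^sub>v m :: 'a vec} \<in> left_kernel ` carrier_mat m N"
      by (simp add: left_kernels_stable[OF that])
    then obtain M :: "'a mat" where M: "M \<in> carrier_mat m N" "{0\<^sub>v m} = left_kernel M" by blast
    then have "M \<in> X N" by (simp add: X_def)
    have im: "left_kernel ` X N = {{0\<^sub>v m}}"
    proof
      show "left_kernel ` X N \<subseteq> {{0\<^sub>v m}}" unfolding X_def by blast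
      show "{{0\<^sub>v m}} \<subseteq> left_kernel ` X N" using imageI[OF \<open>M \<in> X N\<close>] M(2) by simp
    qed
    have "{K \<in> {{0\<^sub>v m}}. {c \<in> carrier_vec m. transpose_mat B *\<^sub>v c \<in> K} = K} = {{0\<^sub>v m}}"
    proof (intro equalityI subsetI)
      fix K assume "K \<in> {{0\<^sub>v m :: 'a vec}}"
      then have "K = {0\<^sub>v m}" by (rule singletonD)
      then show "K \<in> {K \<in> {{0\<^sub>v m}}. {c \<in> carrier_vec m. transpose_mat B *\<^sub>v c \<in> K} = K}"
        using GL_transpose_kernel[OF B] by blast
    qed blast
    then show ?thesis using expect_twisted_fixed[OF XN closed Bc BX, of N] by (simp only: im) simp
  qed
  then show ?thesis
    unfolding fr has_stable_mean_abs_cf[OF cf] eventually_sequentially by (intro exI[of _ m] allI impI)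
qed

lemma has_stable_mean_zero: "has_stable_mean 0 0"
  by transfer (simp add: expect_def)

lemma has_stable_mean_add:
  "has_stable_mean f a \<Longrightarrow> has_stable_mean h b \<Longrightarrow> has_stable_mean (f + h) (a + b)"
proof transfer
  fix f h :: "nat \<Rightarrow> 'a mat \<Rightarrow> complex" and a b :: complex
  assume "\<forall>\<^sub>F N in sequentially. expect N (f N) = a" "\<forall>\<^sub>F N in sequentially. expect N (h N) = b"
  then show "\<forall>\<^sub>F N in sequentially. expect N (\<lambda>g. f N g + h N g) = a + b"
    by eventually_elim (simp only: expect_def sum.distrib add_divide_distrib)
qed

lemma has_stable_mean_scale: "has_stable_mean f a \<Longrightarrow> has_stable_mean (cf_scale c f) (c * a)"
proof transfer
  fix f :: "nat \<Rightarrow> 'a mat \<Rightarrow> complex" and a c :: complex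
  assume "\<forall>\<^sub>F N in sequentially. expect N (f N) = a"
  then show "\<forall>\<^sub>F N in sequentially. expect N (\<lambda>g. c * f N g) = c * a"
    by eventually_elim (simp only: expect_def sum_distrib_left[symmetric] times_divide_eq_right[symmetric])
qed

lemma SCF_has_stable_mean:
  assumes "f \<in> SCF"
  shows "\<exists>c. has_stable_mean f c"
proof -
  let ?S = "{f :: 'a cf. \<exists>c. has_stable_mean f c}"
  have "cf.subspace ?S"
    unfolding cf.subspace_def
    by (blast intro: has_stable_mean_zero has_stable_mean_add has_stable_mean_scale)
  moreover have "{Btilde m B | m B. B \<in> carrier (GL m)} \<subseteq> ?S"
    using has_stable_mean_Btilde by fast
  ultimately have "SCF \<subseteq> ?S" unfolding SCF_def by (rule cf.span_minimal[rotated])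
  then show ?thesis using assms by (simp add: subset_eq)
qed

section \<open>Induced characters\<close>

lemma mat_trace_mult_commute:
  fixes A B :: "'a :: comm_semiring_0 mat"
  assumes A: "A \<in> carrier_mat n k" and B: "B \<in> carrier_mat k n"
  shows "mat_trace (A * B) = mat_trace (B * A)"
proof -
  have "mat_trace (A * B) = (\<Sum>i<n. \<Sum>j<k. A $$ (i, j) * B $$ (j, i))"
    using A B by (simp add: mat_trace_def scalar_prod_def lessThan_atLeast0)
  also have "\<dots> = (\<Sum>j<k. \<Sum>i<n. B $$ (j, i) * A $$ (i, j))"
    by (subst sum.swap) (simp add: mult.commute)
  also have "\<dots> = mat_trace (B * A)"
    using A B by (simp add: mat_trace_def scalar_prod_def lessThan_atLeast0)
  finally show ?thesis .
qed

lemma kronecker_carrier: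
  "A \<in> carrier_mat a a \<Longrightarrow> B \<in> carrier_mat b b \<Longrightarrow> kronecker A B \<in> carrier_mat (a * b) (a * b)"
  by (simp add: kronecker_def)

lemma sum_div_mod: "(\<Sum>i<n * k. f i) = (\<Sum>a<n. \<Sum>b<k. f (a * k + b :: nat))"
proof -
  have "(\<Sum>i\<in>{a * k..<a * k + k}. f i) = (\<Sum>b<k. f (a * k + b))" for a
    by (subst sum.atLeastLessThan_shift_0) (simp add: lessThan_atLeast0)
  then show ?thesis unfolding sum.nat_group[symmetric] by simp
qed

lemma mat_trace_kronecker:
  assumes A: "A \<in> carrier_mat a a" and B: "B \<in> carrier_mat b b"
  shows "mat_trace (kronecker A B) = mat_trace A * mat_trace B"
proof -
  have "mat_trace (kronecker A B) = (\<Sum>i<a * b. A $$ (i div b, i div b) * B $$ (i mod b, i mod b))"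
    using A B by (simp add: mat_trace_def kronecker_def)
  also have "\<dots> = (\<Sum>i<a. \<Sum>j<b. A $$ (i, i) * B $$ (j, j))"
    unfolding sum_div_mod by (intro sum.cong refl) simp_all
  also have "\<dots> = mat_trace A * mat_trace B"
    using A B by (simp add: mat_trace_def sum_product)
  finally show ?thesis .
qed

lemma (in group) cancel_left:
  assumes "a \<in> carrier G" "z \<in> carrier G"
  shows "inv a \<otimes> (a \<otimes> z) = z" "a \<otimes> (inv a \<otimes> z) = z"
  using assms by (simp_all add: m_assoc[symmetric])

text \<open>
  The representative of a coset is chosen as a function of the coset, so that elements of the same
  coset receive the same representative.
\<close>

lemma left_transversal_exists:
  fixes G :: "'a :: {field, finite} mat monoid"
  assumes G: "group G" and fG: "finite (carrier G)" and H: "subgroup H G"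
  shows "\<exists>ts. left_transversal G H ts"
proof -
  interpret G: group G by (rule G)
  interpret H: subgroup H G by (rule H)
  define coset where "coset g = {x \<in> carrier G. inv\<^bsub>G\<^esub> x \<otimes>\<^bsub>G\<^esub> g \<in> H}" for g
  define rep where "rep g = (SOME x. x \<in> coset g)" for g
  have rep: "rep g \<in> coset g" if "g \<in> carrier G" for g
  proof -
    have "g \<in> coset g" using that H.one_closed by (simp add: coset_def)
    then show ?thesis unfolding rep_def by (rule someI)
  qed
  have coset_sub: "coset g \<subseteq> coset g'" if g: "g \<in> carrier G" "g' \<in> carrier G"
    and t: "t \<in> coset g" "t \<in> coset g'" for g g' t
  proof
    fix x assume x: "x \<in> coset g"
    have tc: "t \<in> carrier G" "inv\<^bsub>G\<^esub> t \<otimes>\<^bsub>G\<^esub> g \<in> H" "inv\<^bsub>G\<^esub> t \<otimes>\<^bsub>G\<^esub> g' \<in> H"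
      and xc: "x \<in> carrier G" "inv\<^bsub>G\<^esub> x \<otimes>\<^bsub>G\<^esub> g \<in> H"
      using t x by (auto simp: coset_def)
    have "inv\<^bsub>G\<^esub> x \<otimes>\<^bsub>G\<^esub> g' = (inv\<^bsub>G\<^esub> x \<otimes>\<^bsub>G\<^esub> g) \<otimes>\<^bsub>G\<^esub> (inv\<^bsub>G\<^esub> (inv\<^bsub>G\<^esub> t \<otimes>\<^bsub>G\<^esub> g) \<otimes>\<^bsub>G\<^esub> (inv\<^bsub>G\<^esub> t \<otimes>\<^bsub>G\<^esub> g'))"
      using g tc(1) xc(1) by (simp add: G.inv_mult_group G.m_assoc G.cancel_left)
    moreover have "\<dots> \<in> H" by (intro H.m_closed H.m_inv_closed tc xc)
    ultimately show "x \<in> coset g'" using xc(1) by (simp add: coset_def)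
  qed
  have rep_eq: "rep g = rep g'" if "g \<in> carrier G" "g' \<in> carrier G" "t \<in> coset g" "t \<in> coset g'" for g g' t
  proof -
    have "coset g = coset g'" using coset_sub[of g g' t] coset_sub[of g' g t] that by (intro equalityI)
    then show ?thesis by (simp add: rep_def)
  qed
  obtain ts where ts: "set ts = rep ` carrier G" "distinct ts"
    using finite_distinct_list[of "rep ` carrier G"] fG by auto
  have "\<exists>!t. t \<in> set ts \<and> inv\<^bsub>G\<^esub> t \<otimes>\<^bsub>G\<^esub> g \<in> H" if g: "g \<in> carrier G" for g
  proof (rule ex1I[of _ "rep g"])
    show "rep g \<in> set ts \<and> inv\<^bsub>G\<^esub> rep g \<otimes>\<^bsub>G\<^esub> g \<in> H"
      using rep[OF g] g unfolding ts(1) coset_def by blast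
    fix t assume t: "t \<in> set ts \<and> inv\<^bsub>G\<^esub> t \<otimes>\<^bsub>G\<^esub> g \<in> H"
    then obtain g' where g': "g' \<in> carrier G" "t = rep g'" using ts(1) by blast
    have "t \<in> coset g'" using rep[OF g'(1)] g'(2) by simp
    then have "t \<in> coset g" using t unfolding coset_def by blast
    then show "t = rep g" unfolding g'(2) using rep_eq[OF g'(1) g] \<open>t \<in> coset g'\<close> g'(2) by simp
  qed
  moreover have "set ts \<subseteq> carrier G" unfolding ts(1) using rep by (auto simp: coset_def)
  ultimately have "left_transversal G H ts" unfolding left_transversal_def using ts(2) by blast
  then show ?thesis by blast
qed

lemma sum_over_transversal:
  fixes G :: "'a :: {field, finite} mat monoid"
  assumes G: "group G" and H: "subgroup H G" and ts: "left_transversal G H ts"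
  shows "(\<Sum>x\<in>carrier G. F x) = (\<Sum>t\<in>set ts. \<Sum>h\<in>H. F (t \<otimes>\<^bsub>G\<^esub> h))"
proof -
  interpret G: group G by (rule G)
  interpret H: subgroup H G by (rule H)
  have sub: "t \<in> carrier G" if "t \<in> set ts" for t using ts that by (auto simp: left_transversal_def)
  have un: "t = t'" if "t \<in> set ts" "t' \<in> set ts" "g \<in> carrier G"
    "inv\<^bsub>G\<^esub> t \<otimes>\<^bsub>G\<^esub> g \<in> H" "inv\<^bsub>G\<^esub> t' \<otimes>\<^bsub>G\<^esub> g \<in> H" for t t' g
    using ts that unfolding left_transversal_def by blast
  have can: "inv\<^bsub>G\<^esub> t \<otimes>\<^bsub>G\<^esub> (t \<otimes>\<^bsub>G\<^esub> h) = h" if "t \<in> set ts" "h \<in> H" for t h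
    using sub[OF that(1)] H.mem_carrier[OF that(2)] by (simp add: G.m_assoc[symmetric])
  have "bij_betw (\<lambda>(t, h). t \<otimes>\<^bsub>G\<^esub> h) (set ts \<times> H) (carrier G)"
    unfolding bij_betw_def
  proof
    show "inj_on (\<lambda>(t, h). t \<otimes>\<^bsub>G\<^esub> h) (set ts \<times> H)"
    proof (rule inj_onI, clarify)
      fix t h t' h' assume t: "t \<in> set ts" "t' \<in> set ts" and h: "h \<in> H" "h' \<in> H"
        and eq: "t \<otimes>\<^bsub>G\<^esub> h = t' \<otimes>\<^bsub>G\<^esub> h'"
      have "t \<otimes>\<^bsub>G\<^esub> h \<in> carrier G" using sub[OF t(1)] H.mem_carrier[OF h(1)] by simp
      then have "t = t'"
        using un[OF t, of "t \<otimes>\<^bsub>G\<^esub> h"] can[OF t(1) h(1)] can[OF t(2) h(2)] h eq by simp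
      moreover have "h = h'" using calculation can[OF t(1) h(1)] can[OF t(2) h(2)] eq by metis
      ultimately show "t = t' \<and> h = h'" ..
    qed
    show "(\<lambda>(t, h). t \<otimes>\<^bsub>G\<^esub> h) ` (set ts \<times> H) = carrier G"
    proof
      show "(\<lambda>(t, h). t \<otimes>\<^bsub>G\<^esub> h) ` (set ts \<times> H) \<subseteq> carrier G"
        by (rule image_subsetI) (simp add: case_prod_beta mem_Times_iff sub H.mem_carrier)
      show "carrier G \<subseteq> (\<lambda>(t, h). t \<otimes>\<^bsub>G\<^esub> h) ` (set ts \<times> H)"
      proof
        fix g assume g: "g \<in> carrier G"
        then obtain t where t: "t \<in> set ts" "inv\<^bsub>G\<^esub> t \<otimes>\<^bsub>G\<^esub> g \<in> H"
          using ts unfolding left_transversal_def by blast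
        have "g = t \<otimes>\<^bsub>G\<^esub> (inv\<^bsub>G\<^esub> t \<otimes>\<^bsub>G\<^esub> g)"
          using sub[OF t(1)] g by (simp add: G.m_assoc[symmetric])
        then show "g \<in> (\<lambda>(t, h). t \<otimes>\<^bsub>G\<^esub> h) ` (set ts \<times> H)"
          using t by (intro image_eqI[of _ _ "(t, inv\<^bsub>G\<^esub> t \<otimes>\<^bsub>G\<^esub> g)"]) simp_all
      qed
    qed
  qed
  then have "(\<Sum>x\<in>carrier G. F x) = (\<Sum>p\<in>set ts \<times> H. F (case p of (t, h) \<Rightarrow> t \<otimes>\<^bsub>G\<^esub> h))"
    by (rule sum.reindex_bij_betw[symmetric])
  then show ?thesis by (simp add: sum.cartesian_product case_prod_beta)
qed

lemma trace_induced_rep: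
  assumes H: "subgroup H (GL n :: 'a :: {field, finite} mat monoid)"
    and \<sigma>: "\<And>h. h \<in> H \<Longrightarrow> \<sigma> h \<in> carrier_mat d d"
  shows "\<exists>ts. left_transversal (GL n) H ts \<and> (\<forall>g. mat_trace (act (induced_rep n H d \<sigma>) g) =
      (\<Sum>t\<in>set ts. let h = inv\<^bsub>GL n\<^esub> t * g * t in if h \<in> H then mat_trace (\<sigma> h) else 0))"
proof -
  define ts where "ts = (SOME ts. left_transversal (GL n) H ts)"
  have ts: "left_transversal (GL n) H ts"
    unfolding ts_def by (rule someI_ex[OF left_transversal_exists[OF group_GL finite_GL H]])
  have "mat_trace (act (induced_rep n H d \<sigma>) g) =
      (\<Sum>t\<in>set ts. let h = inv\<^bsub>GL n\<^esub> t * g * t in if h \<in> H then mat_trace (\<sigma> h) else 0)" for g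
  proof -
    let ?h = "\<lambda>t. inv\<^bsub>GL n\<^esub> t * g * t"
    have "mat_trace (act (induced_rep n H d \<sigma>) g) =
        (\<Sum>i<length ts * d. let h = ?h (ts ! (i div d)) in if h \<in> H then \<sigma> h $$ (i mod d, i mod d) else 0)"
      unfolding induced_rep_def Let_def ts_def[symmetric] mult_GL by (simp add: mat_trace_def)
    also have "\<dots> = (\<Sum>a<length ts. \<Sum>b<d. let h = ?h (ts ! a) in if h \<in> H then \<sigma> h $$ (b, b) else 0)"
      unfolding sum_div_mod by (intro sum.cong refl) (simp_all add: Let_def)
    also have "\<dots> = (\<Sum>a<length ts. let h = ?h (ts ! a) in if h \<in> H then mat_trace (\<sigma> h) else 0)"
      by (intro sum.cong refl) (auto simp: Let_def mat_trace_def dest!: \<sigma>)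
    also have "\<dots> = (\<Sum>t\<in>set ts. let h = ?h t in if h \<in> H then mat_trace (\<sigma> h) else 0)"
      using ts by (intro sum.reindex_bij_betw bij_betw_nth) (auto simp: left_transversal_def)
    finally show ?thesis .
  qed
  then show ?thesis using ts by blast
qed

text \<open>
  The usual formula for an induced character. Averaging over the whole group instead of over coset
  representatives removes the choice of the transversal.
\<close>

lemma induced_rep_character_sum:
  fixes H :: "'a :: {field, finite} mat set"
  assumes H: "subgroup H (GL n)"
    and \<sigma>: "\<And>h. h \<in> H \<Longrightarrow> \<sigma> h \<in> carrier_mat d d"
    and conj: "\<And>x h. x \<in> H \<Longrightarrow> h \<in> H \<Longrightarrow> mat_trace (\<sigma> (inv\<^bsub>GL n\<^esub> x * h * x)) = mat_trace (\<sigma> h)"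
    and g: "g \<in> carrier (GL n)"
  shows "of_nat (card H) * mat_trace (act (induced_rep n H d \<sigma>) g) =
    (\<Sum>x\<in>carrier (GL n). let h = inv\<^bsub>GL n\<^esub> x * g * x in if h \<in> H then mat_trace (\<sigma> h) else 0)"
proof -
  let ?G = "GL n :: 'a mat monoid"
  interpret G: group ?G by (rule group_GL)
  interpret H: subgroup H ?G by (rule H)
  let ?f = "\<lambda>h. if h \<in> H then mat_trace (\<sigma> h) else 0"
  obtain ts where ts_tr: "left_transversal ?G H ts \<and> (\<forall>g. mat_trace (act (induced_rep n H d \<sigma>) g) =
      (\<Sum>t\<in>set ts. let h = inv\<^bsub>?G\<^esub> t * g * t in if h \<in> H then mat_trace (\<sigma> h) else 0))"
    using trace_induced_rep[OF H \<sigma>] by (rule exE)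
  note ts = ts_tr[THEN conjunct1] and tr = ts_tr[THEN conjunct2, rule_format]
  \<comment> \<open>The summand depends only on the coset of the conjugating element.\<close>
  have inner: "?f (inv\<^bsub>?G\<^esub> (t \<otimes>\<^bsub>?G\<^esub> h) \<otimes>\<^bsub>?G\<^esub> g \<otimes>\<^bsub>?G\<^esub> (t \<otimes>\<^bsub>?G\<^esub> h))
      = ?f (inv\<^bsub>?G\<^esub> t \<otimes>\<^bsub>?G\<^esub> g \<otimes>\<^bsub>?G\<^esub> t)"
    if t: "t \<in> set ts" and h: "h \<in> H" for t h
  proof -
    have tc: "t \<in> carrier ?G" using ts t by (auto simp: left_transversal_def)
    note hc = H.mem_carrier[OF h]
    define y where "y = inv\<^bsub>?G\<^esub> t \<otimes>\<^bsub>?G\<^esub> g \<otimes>\<^bsub>?G\<^esub> t"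
    have yc: "y \<in> carrier ?G" unfolding y_def by (intro G.m_closed G.inv_closed tc g)
    have eq: "inv\<^bsub>?G\<^esub> (t \<otimes>\<^bsub>?G\<^esub> h) \<otimes>\<^bsub>?G\<^esub> g \<otimes>\<^bsub>?G\<^esub> (t \<otimes>\<^bsub>?G\<^esub> h) = inv\<^bsub>?G\<^esub> h \<otimes>\<^bsub>?G\<^esub> y \<otimes>\<^bsub>?G\<^esub> h"
      unfolding y_def using tc hc g by (simp del: mult_GL add: G.inv_mult_group G.m_assoc)
    have y_eq: "y = h \<otimes>\<^bsub>?G\<^esub> (inv\<^bsub>?G\<^esub> h \<otimes>\<^bsub>?G\<^esub> y \<otimes>\<^bsub>?G\<^esub> h) \<otimes>\<^bsub>?G\<^esub> inv\<^bsub>?G\<^esub> h"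
    proof -
      show ?thesis using hc yc by (simp del: mult_GL one_GL add: G.m_assoc G.cancel_left)
    qed
    have "y \<in> H \<longleftrightarrow> inv\<^bsub>?G\<^esub> h \<otimes>\<^bsub>?G\<^esub> y \<otimes>\<^bsub>?G\<^esub> h \<in> H"
    proof
      assume "y \<in> H"
      then show "inv\<^bsub>?G\<^esub> h \<otimes>\<^bsub>?G\<^esub> y \<otimes>\<^bsub>?G\<^esub> h \<in> H" by (intro H.m_closed H.m_inv_closed h)
    next
      assume conj_in: "inv\<^bsub>?G\<^esub> h \<otimes>\<^bsub>?G\<^esub> y \<otimes>\<^bsub>?G\<^esub> h \<in> H"
      have "h \<otimes>\<^bsub>?G\<^esub> (inv\<^bsub>?G\<^esub> h \<otimes>\<^bsub>?G\<^esub> y \<otimes>\<^bsub>?G\<^esub> h) \<otimes>\<^bsub>?G\<^esub> inv\<^bsub>?G\<^esub> h \<in> H"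
        by (rule H.m_closed[OF H.m_closed[OF h conj_in] H.m_inv_closed[OF h]])
      then show "y \<in> H" unfolding y_eq[symmetric] .
    qed
    then show ?thesis unfolding eq y_def[symmetric] using conj[OF h, of y] by simp
  qed
  have "(\<Sum>x\<in>carrier ?G. ?f (inv\<^bsub>?G\<^esub> x \<otimes>\<^bsub>?G\<^esub> g \<otimes>\<^bsub>?G\<^esub> x)) =
      (\<Sum>t\<in>set ts. \<Sum>h\<in>H. ?f (inv\<^bsub>?G\<^esub> (t \<otimes>\<^bsub>?G\<^esub> h) \<otimes>\<^bsub>?G\<^esub> g \<otimes>\<^bsub>?G\<^esub> (t \<otimes>\<^bsub>?G\<^esub> h)))"
    by (rule sum_over_transversal[OF group_GL H ts])
  also have "\<dots> = (\<Sum>t\<in>set ts. \<Sum>h\<in>H. ?f (inv\<^bsub>?G\<^esub> t \<otimes>\<^bsub>?G\<^esub> g \<otimes>\<^bsub>?G\<^esub> t))"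
    by (intro sum.cong refl inner)
  also have "\<dots> = of_nat (card H) * mat_trace (act (induced_rep n H d \<sigma>) g)"
    unfolding tr by (simp add: sum_distrib_left Let_def cong: if_cong)
  finally show ?thesis by (simp add: Let_def cong: if_cong)
qed

lemma induced_rep_character_conj:
  fixes H :: "'a :: {field, finite} mat set"
  assumes H: "subgroup H (GL n)"
    and \<sigma>: "\<And>h. h \<in> H \<Longrightarrow> \<sigma> h \<in> carrier_mat d d"
    and conj: "\<And>x h. x \<in> H \<Longrightarrow> h \<in> H \<Longrightarrow> mat_trace (\<sigma> (inv\<^bsub>GL n\<^esub> x * h * x)) = mat_trace (\<sigma> h)"
    and g: "g \<in> carrier (GL n)" and x: "x \<in> carrier (GL n)"
  shows "mat_trace (act (induced_rep n H d \<sigma>) (x * g * inv\<^bsub>GL n\<^esub> x)) = mat_trace (act (induced_rep n H d \<sigma>) g)"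
proof -
  let ?G = "GL n :: 'a mat monoid"
  interpret G: group ?G by (rule group_GL)
  interpret H: subgroup H ?G by (rule H)
  let ?f = "\<lambda>h. if h \<in> H then mat_trace (\<sigma> h) else 0"
  let ?\<chi> = "\<lambda>g. mat_trace (act (induced_rep n H d \<sigma>) g)"
  have *: "of_nat (card H) * ?\<chi> g = (\<Sum>x\<in>carrier ?G. ?f (inv\<^bsub>?G\<^esub> x \<otimes>\<^bsub>?G\<^esub> g \<otimes>\<^bsub>?G\<^esub> x))"
    if "g \<in> carrier ?G" for g
    using induced_rep_character_sum[OF H \<sigma> conj that] by (simp add: Let_def cong: if_cong)
  have cl: "x \<otimes>\<^bsub>?G\<^esub> g \<otimes>\<^bsub>?G\<^esub> inv\<^bsub>?G\<^esub> x \<in> carrier ?G" by (intro G.m_closed G.inv_closed x g)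
  have "of_nat (card H) * ?\<chi> (x \<otimes>\<^bsub>?G\<^esub> g \<otimes>\<^bsub>?G\<^esub> inv\<^bsub>?G\<^esub> x) =
      (\<Sum>y\<in>carrier ?G. ?f (inv\<^bsub>?G\<^esub> y \<otimes>\<^bsub>?G\<^esub> (x \<otimes>\<^bsub>?G\<^esub> g \<otimes>\<^bsub>?G\<^esub> inv\<^bsub>?G\<^esub> x) \<otimes>\<^bsub>?G\<^esub> y))"
    by (rule *[OF cl])
  also have "\<dots> = (\<Sum>y\<in>carrier ?G. ?f (inv\<^bsub>?G\<^esub> (x \<otimes>\<^bsub>?G\<^esub> y) \<otimes>\<^bsub>?G\<^esub> (x \<otimes>\<^bsub>?G\<^esub> g \<otimes>\<^bsub>?G\<^esub> inv\<^bsub>?G\<^esub> x) \<otimes>\<^bsub>?G\<^esub> (x \<otimes>\<^bsub>?G\<^esub> y)))"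
    by (rule sum.reindex_bij_betw[symmetric])
      (use G.inj_on_cmult[OF x] G.surj_const_mult[OF x] in \<open>auto simp: bij_betw_def\<close>)
  also have "\<dots> = (\<Sum>y\<in>carrier ?G. ?f (inv\<^bsub>?G\<^esub> y \<otimes>\<^bsub>?G\<^esub> g \<otimes>\<^bsub>?G\<^esub> y))"
  proof (rule sum.cong[OF refl])
    fix y assume y: "y \<in> carrier ?G"
    have "inv\<^bsub>?G\<^esub> (x \<otimes>\<^bsub>?G\<^esub> y) \<otimes>\<^bsub>?G\<^esub> (x \<otimes>\<^bsub>?G\<^esub> g \<otimes>\<^bsub>?G\<^esub> inv\<^bsub>?G\<^esub> x) \<otimes>\<^bsub>?G\<^esub> (x \<otimes>\<^bsub>?G\<^esub> y)
        = inv\<^bsub>?G\<^esub> y \<otimes>\<^bsub>?G\<^esub> g \<otimes>\<^bsub>?G\<^esub> y"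
      using x y g by (simp del: mult_GL one_GL add: G.inv_mult_group G.m_assoc G.cancel_left)
    then show "?f (inv\<^bsub>?G\<^esub> (x \<otimes>\<^bsub>?G\<^esub> y) \<otimes>\<^bsub>?G\<^esub> (x \<otimes>\<^bsub>?G\<^esub> g \<otimes>\<^bsub>?G\<^esub> inv\<^bsub>?G\<^esub> x) \<otimes>\<^bsub>?G\<^esub> (x \<otimes>\<^bsub>?G\<^esub> y))
        = ?f (inv\<^bsub>?G\<^esub> y \<otimes>\<^bsub>?G\<^esub> g \<otimes>\<^bsub>?G\<^esub> y)" by (rule arg_cong)
  qed
  also have "\<dots> = of_nat (card H) * ?\<chi> g" by (rule *[OF g, symmetric])
  finally have "of_nat (card H) * ?\<chi> (x * g * inv\<^bsub>?G\<^esub> x) = of_nat (card H) * ?\<chi> g" by simp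
  moreover have "card H > 0"
    using H.one_closed finite_subset[OF H.subset finite_GL] by (auto simp: card_gt_0_iff)
  ultimately show ?thesis by simp
qed

text \<open>
  Frobenius reciprocity with the trivial character: in the double sum over \<open>g\<close> and the conjugating
  element \<open>x\<close>, each \<open>x\<close> contributes the sum of the trace over the subgroup.
\<close>

lemma expect_induced_rep:
  fixes H :: "'a :: {field, finite} mat set"
  assumes H: "subgroup H (GL n)"
    and \<sigma>: "\<And>h. h \<in> H \<Longrightarrow> \<sigma> h \<in> carrier_mat d d"
    and conj: "\<And>x h. x \<in> H \<Longrightarrow> h \<in> H \<Longrightarrow> mat_trace (\<sigma> (inv\<^bsub>GL n\<^esub> x * h * x)) = mat_trace (\<sigma> h)"
  shows "expect n (\<lambda>g. mat_trace (act (induced_rep n H d \<sigma>) g)) = (\<Sum>h\<in>H. mat_trace (\<sigma> h)) / of_nat (card H)"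
proof -
  let ?G = "GL n :: 'a mat monoid"
  interpret G: group ?G by (rule group_GL)
  interpret H: subgroup H ?G by (rule H)
  let ?f = "\<lambda>h. if h \<in> H then mat_trace (\<sigma> h) else 0"
  let ?\<chi> = "\<lambda>g. mat_trace (act (induced_rep n H d \<sigma>) g)"
  have *: "of_nat (card H) * ?\<chi> g = (\<Sum>x\<in>carrier ?G. ?f (inv\<^bsub>?G\<^esub> x \<otimes>\<^bsub>?G\<^esub> g \<otimes>\<^bsub>?G\<^esub> x))"
    if "g \<in> carrier ?G" for g
    using induced_rep_character_sum[OF H \<sigma> conj that] by (simp add: Let_def cong: if_cong)
  have inner: "(\<Sum>g\<in>carrier ?G. ?f (inv\<^bsub>?G\<^esub> x \<otimes>\<^bsub>?G\<^esub> g \<otimes>\<^bsub>?G\<^esub> x)) = (\<Sum>h\<in>H. mat_trace (\<sigma> h))"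
    if x: "x \<in> carrier ?G" for x
  proof -
    have "(\<Sum>g\<in>carrier ?G. ?f (inv\<^bsub>?G\<^esub> x \<otimes>\<^bsub>?G\<^esub> g \<otimes>\<^bsub>?G\<^esub> x)) = (\<Sum>g\<in>carrier ?G. ?f g)"
    proof (rule sum.reindex_bij_betw, rule bij_betw_byWitness[where f' = "\<lambda>g. x \<otimes>\<^bsub>?G\<^esub> g \<otimes>\<^bsub>?G\<^esub> inv\<^bsub>?G\<^esub> x"])
      show "\<forall>g\<in>carrier ?G. x \<otimes>\<^bsub>?G\<^esub> (inv\<^bsub>?G\<^esub> x \<otimes>\<^bsub>?G\<^esub> g \<otimes>\<^bsub>?G\<^esub> x) \<otimes>\<^bsub>?G\<^esub> inv\<^bsub>?G\<^esub> x = g"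
        using x by (simp del: mult_GL one_GL add: G.m_assoc G.cancel_left)
      show "\<forall>g\<in>carrier ?G. inv\<^bsub>?G\<^esub> x \<otimes>\<^bsub>?G\<^esub> (x \<otimes>\<^bsub>?G\<^esub> g \<otimes>\<^bsub>?G\<^esub> inv\<^bsub>?G\<^esub> x) \<otimes>\<^bsub>?G\<^esub> x = g"
        using x by (simp del: mult_GL one_GL add: G.m_assoc G.cancel_left)
    qed (use x in \<open>auto simp del: mult_GL one_GL\<close>)
    also have "\<dots> = (\<Sum>h\<in>H. mat_trace (\<sigma> h))"
      by (simp add: sum.inter_restrict[OF finite_GL, symmetric] Int_absorb1[OF H.subset])
    finally show ?thesis .
  qed
  have "of_nat (card H) * (\<Sum>g\<in>carrier ?G. ?\<chi> g) =
      (\<Sum>g\<in>carrier ?G. \<Sum>x\<in>carrier ?G. ?f (inv\<^bsub>?G\<^esub> x \<otimes>\<^bsub>?G\<^esub> g \<otimes>\<^bsub>?G\<^esub> x))"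
    unfolding sum_distrib_left by (intro sum.cong refl *)
  also have "\<dots> = (\<Sum>x\<in>carrier ?G. \<Sum>h\<in>H. mat_trace (\<sigma> h))"
    by (subst sum.swap) (intro sum.cong refl inner)
  also have "\<dots> = of_nat (card (carrier ?G)) * (\<Sum>h\<in>H. mat_trace (\<sigma> h))" by simp
  finally have "of_nat (card H) * (\<Sum>g\<in>carrier ?G. ?\<chi> g) = of_nat (card (carrier ?G)) * (\<Sum>h\<in>H. mat_trace (\<sigma> h))" .
  moreover have "card H > 0"
    using H.one_closed finite_subset[OF H.subset finite_GL] by (auto simp: card_gt_0_iff)
  ultimately show ?thesis
    using card_GL_pos[where 'a='a, of n] by (simp add: expect_def field_simps)
qed

section \<open>Parabolic induction and means\<close>

lemma split_block_four_block:
  assumes "A \<in> carrier_mat m m" "B \<in> carrier_mat m r" "C \<in> carrier_mat r m" "D \<in> carrier_mat r r"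
  shows "split_block (four_block_mat A B C D) m m = (A, B, C, D)"
  using assms unfolding split_block_def Let_def by (auto intro!: eq_matI)

lemma parabolicE:
  assumes "p \<in> parabolic m r"
  obtains a b d where "a \<in> carrier (GL m)" "b \<in> carrier_mat m r" "d \<in> carrier (GL r)"
    "p = four_block_mat a b (0\<^sub>m r m) d"
  using assms unfolding parabolic_def by blast

lemma parabolicI:
  "a \<in> carrier (GL m) \<Longrightarrow> b \<in> carrier_mat m r \<Longrightarrow> d \<in> carrier (GL r) \<Longrightarrow>
     four_block_mat a b (0\<^sub>m r m) d \<in> parabolic m r"
  unfolding parabolic_def by blast

lemma parabolic_mult:
  fixes a b d a' b' d' :: "'a :: comm_ring_1 mat"
  assumes "a \<in> carrier_mat m m" "b \<in> carrier_mat m r" "d \<in> carrier_mat r r"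
    and "a' \<in> carrier_mat m m" "b' \<in> carrier_mat m r" "d' \<in> carrier_mat r r"
  shows "four_block_mat a b (0\<^sub>m r m) d * four_block_mat a' b' (0\<^sub>m r m) d'
    = four_block_mat (a * a') (a * b' + b * d') (0\<^sub>m r m) (d * d')"
proof -
  have "four_block_mat a b (0\<^sub>m r m) d * four_block_mat a' b' (0\<^sub>m r m) d' =
      four_block_mat (a * a' + b * 0\<^sub>m r m) (a * b' + b * d') (0\<^sub>m r m * a' + d * 0\<^sub>m r m)
        (0\<^sub>m r m * b' + d * d')"
    by (rule mult_four_block_mat) (use assms in auto)
  also have "a * a' + b * 0\<^sub>m r m = a * a'" using assms by simp
  also have "0\<^sub>m r m * a' + d * 0\<^sub>m r m = 0\<^sub>m r m" using assms by simp
  also have "0\<^sub>m r m * b' + d * d' = d * d'" using assms by simp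
  finally show ?thesis .
qed

lemma parabolic_inverse:
  fixes b :: "'a :: {field, finite} mat"
  assumes a: "a \<in> carrier (GL m)" and b: "b \<in> carrier_mat m r" and d: "d \<in> carrier (GL r)"
  defines "ia \<equiv> inv\<^bsub>GL m\<^esub> a" and "di \<equiv> inv\<^bsub>GL r\<^esub> d"
  shows "four_block_mat a b (0\<^sub>m r m) d \<in> carrier (GL (m + r))"
    and "inv\<^bsub>GL (m + r)\<^esub> (four_block_mat a b (0\<^sub>m r m) d) = four_block_mat ia (- (ia * b * di)) (0\<^sub>m r m) di"
proof -
  interpret A: group "GL m :: 'a mat monoid" by (rule group_GL)
  interpret D: group "GL r :: 'a mat monoid" by (rule group_GL)
  interpret G: group "GL (m + r) :: 'a mat monoid" by (rule group_GL)
  have ia: "ia \<in> carrier (GL m)" and di: "di \<in> carrier (GL r)" using a d by (simp_all add: ia_def di_def)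
  have e: "ia * a = 1\<^sub>m m" "a * ia = 1\<^sub>m m" "di * d = 1\<^sub>m r" "d * di = 1\<^sub>m r"
    using A.l_inv[OF a] A.r_inv[OF a] D.l_inv[OF d] D.r_inv[OF d] by (simp_all add: ia_def di_def)
  note c = GL_carrier_mat[OF a] GL_carrier_mat[OF d] GL_carrier_mat[OF ia] GL_carrier_mat[OF di] b
  let ?p = "four_block_mat a b (0\<^sub>m r m) d"
  let ?q = "four_block_mat ia (- (ia * b * di)) (0\<^sub>m r m) di"
  have ib: "ia * b \<in> carrier_mat m r" "ia * b * di \<in> carrier_mat m r" "b * di \<in> carrier_mat m r"
    using c by auto
  have zero: "X + - X = 0\<^sub>m m r" "- X + X = 0\<^sub>m m r" if "X \<in> carrier_mat m r" for X :: "'a mat"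
    using that by (auto intro!: eq_matI)
  have "?q * ?p = four_block_mat (ia * a) (ia * b + - (ia * b * di) * d) (0\<^sub>m r m) (di * d)"
    by (rule parabolic_mult) (use c ib in auto)
  also have "- (ia * b * di) * d = - (ia * b)"
  proof -
    have "- (ia * b * di) * d = - (ia * b * di * d)" by (rule uminus_mult_left_mat) (use c ib in simp)
    also have "ia * b * di * d = ia * b"
      by (simp only: assoc_mult_mat[OF ib(1) c(4,2)] e right_mult_one_mat[OF ib(1)])
    finally show ?thesis .
  qed
  also have "ia * b + - (ia * b) = 0\<^sub>m m r" using ib(1) by (rule zero)
  finally have qp: "?q * ?p = 1\<^sub>m (m + r)" unfolding e by simp
  have "?p * ?q = four_block_mat (a * ia) (a * - (ia * b * di) + b * di) (0\<^sub>m r m) (d * di)"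
    by (rule parabolic_mult) (use c ib in auto)
  also have "a * - (ia * b * di) = - (b * di)"
  proof -
    have "a * (ia * b * di) = a * (ia * b) * di" by (rule assoc_mult_mat[OF c(1) ib(1) c(4), symmetric])
    also have "a * (ia * b) = b" using assoc_mult_mat[OF c(1,3) b] e b by simp
    finally have "a * (ia * b * di) = b * di" .
    then show ?thesis using uminus_mult_right_mat[of a "ia * b * di"] c ib by simp
  qed
  also have "- (b * di) + b * di = 0\<^sub>m m r" using ib(3) by (rule zero)
  finally have pq: "?p * ?q = 1\<^sub>m (m + r)" unfolding e by simp
  have pc: "?p \<in> carrier_mat (m + r) (m + r)" and qc: "?q \<in> carrier_mat (m + r) (m + r)"
    using c by (auto intro: four_block_carrier_mat)
  show p: "?p \<in> carrier (GL (m + r))" by (rule GL_I[OF pc qc pq qp])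
  have "?q \<in> carrier (GL (m + r))" by (rule GL_I[OF qc pc qp pq])
  then show "inv\<^bsub>GL (m + r)\<^esub> ?p = ?q" using G.inv_equality[of ?q ?p] qp p by simp
qed

lemma subgroup_parabolic: "subgroup (parabolic m r) (GL (m + r) :: 'a :: {field, finite} mat monoid)"
proof -
  interpret A: group "GL m :: 'a mat monoid" by (rule group_GL)
  interpret D: group "GL r :: 'a mat monoid" by (rule group_GL)
  interpret G: group "GL (m + r) :: 'a mat monoid" by (rule group_GL)
  show ?thesis
  proof (rule G.subgroupI)
    show "parabolic m r \<subseteq> (carrier (GL (m + r)) :: 'a mat set)"
    proof
      fix p :: "'a mat" assume "p \<in> parabolic m r"
      then show "p \<in> carrier (GL (m + r))" by (elim parabolicE) (simp add: parabolic_inverse(1))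
    qed
    have "four_block_mat (1\<^sub>m m) (0\<^sub>m m r) (0\<^sub>m r m) (1\<^sub>m r) \<in> (parabolic m r :: 'a mat set)"
      by (rule parabolicI) (simp_all add: one_in_GL)
    then show "parabolic m r \<noteq> ({} :: 'a mat set)" by blast
    fix p :: "'a mat" assume "p \<in> parabolic m r"
    then obtain a b d where p: "a \<in> carrier (GL m)" "b \<in> carrier_mat m r" "d \<in> carrier (GL r)"
      "p = four_block_mat a b (0\<^sub>m r m) d" by (rule parabolicE)
    show "inv\<^bsub>GL (m + r)\<^esub> p \<in> parabolic m r"
      unfolding p(4) parabolic_inverse(2)[OF p(1-3)]
      by (rule parabolicI)
        (use p GL_carrier_mat[OF A.inv_closed[OF p(1)]] GL_carrier_mat[OF D.inv_closed[OF p(3)]] in auto)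
    fix p' :: "'a mat" assume "p' \<in> parabolic m r"
    then obtain a' b' d' where p': "a' \<in> carrier (GL m)" "b' \<in> carrier_mat m r" "d' \<in> carrier (GL r)"
      "p' = four_block_mat a' b' (0\<^sub>m r m) d'" by (rule parabolicE)
    note c = GL_carrier_mat[OF p(1)] p(2) GL_carrier_mat[OF p(3)]
      GL_carrier_mat[OF p'(1)] p'(2) GL_carrier_mat[OF p'(3)]
    show "p \<otimes>\<^bsub>GL (m + r)\<^esub> p' \<in> parabolic m r"
      unfolding p(4) p'(4) mult_GL parabolic_mult[OF c]
      by (rule parabolicI) (use A.m_closed[OF p(1) p'(1)] D.m_closed[OF p(3) p'(3)] c in auto)
  qed
qed

lemma sum_parabolic:
  fixes F :: "'a :: {field, finite} mat \<Rightarrow> 'a mat \<Rightarrow> 'a mat \<Rightarrow> complex"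
  assumes f: "\<And>a b d. a \<in> carrier (GL m) \<Longrightarrow> b \<in> carrier_mat m r \<Longrightarrow> d \<in> carrier (GL r) \<Longrightarrow>
     f (four_block_mat a b (0\<^sub>m r m) d) = F a b d"
  shows "(\<Sum>p\<in>parabolic m r. f p) =
    (\<Sum>a\<in>carrier (GL m). \<Sum>b\<in>carrier_mat m r. \<Sum>d\<in>carrier (GL r). F a b d)"
proof -
  let ?S = "carrier (GL m :: 'a mat monoid) \<times> (carrier_mat m r :: 'a mat set) \<times> carrier (GL r :: 'a mat monoid)"
  let ?q = "\<lambda>(a, b, d). four_block_mat a b (0\<^sub>m r m) d :: 'a mat"
  have "inj_on ?q ?S"
  proof (rule inj_onI)
    fix x y assume xy: "x \<in> ?S" "y \<in> ?S" and q: "?q x = ?q y"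
    obtain a b d where x: "x = (a, b, d)" by (rule prod_cases3)
    obtain a' b' d' where y: "y = (a', b', d')" by (rule prod_cases3)
    note abd = x y
    have b: "b \<in> carrier_mat m r" "b' \<in> carrier_mat m r"
      and eq: "four_block_mat a b (0\<^sub>m r m) d = four_block_mat a' b' (0\<^sub>m r m) d'"
      using xy q by (simp_all add: abd)
    have c: "a \<in> carrier_mat m m" "d \<in> carrier_mat r r" "a' \<in> carrier_mat m m" "d' \<in> carrier_mat r r"
      using xy by (simp_all add: abd GL_carrier_mat)
    have split: "split_block (four_block_mat a b (0\<^sub>m r m) d) m m = (a, b, 0\<^sub>m r m, d)"
      by (rule split_block_four_block[of _ _ _ r]) (use b c in auto)
    have split': "split_block (four_block_mat a' b' (0\<^sub>m r m) d') m m = (a', b', 0\<^sub>m r m, d')"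
      by (rule split_block_four_block[of _ _ _ r]) (use b c in auto)
    have "(a, b, 0\<^sub>m r m :: 'a mat, d) = (a', b', 0\<^sub>m r m, d')"
      using split[symmetric] split' unfolding eq by (rule trans)
    then show "x = y" by (simp add: abd)
  qed
  moreover have "?q ` ?S = parabolic m r"
  proof
    show "?q ` ?S \<subseteq> parabolic m r"
      by (rule image_subsetI) (simp add: case_prod_beta mem_Times_iff parabolicI)
    show "parabolic m r \<subseteq> ?q ` ?S"
    proof
      fix p :: "'a mat" assume "p \<in> parabolic m r"
      then obtain a b d where p: "a \<in> carrier (GL m)" "b \<in> carrier_mat m r" "d \<in> carrier (GL r)"
        "p = four_block_mat a b (0\<^sub>m r m) d" by (rule parabolicE)
      then show "p \<in> ?q ` ?S" by (intro image_eqI[of _ _ "(a, b, d)"]) simp_all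
    qed
  qed
  ultimately have "(\<Sum>p\<in>parabolic m r. f p) = (\<Sum>x\<in>?S. f (?q x))"
    by (intro sum.reindex_bij_betw[symmetric]) (simp add: bij_betw_def)
  also have "\<dots> = (\<Sum>x\<in>?S. F (fst x) (fst (snd x)) (snd (snd x)))"
    by (rule sum.cong[OF refl]) (simp add: case_prod_beta mem_Times_iff f)
  also have "\<dots> = (\<Sum>a\<in>carrier (GL m). \<Sum>b\<in>carrier_mat m r. \<Sum>d\<in>carrier (GL r). F a b d)"
    by (simp add: sum.cartesian_product case_prod_beta)
  finally show ?thesis .
qed

text \<open>
  What the character formulas ask of a representation. The property passes from the factors of a
  parabolic induction to the result by a computation with characters alone, and so extends to
  iterated inductions.
\<close>

definition rep_with_class_character :: "'a :: {field, finite} gl_rep \<Rightarrow> bool" where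
  "rep_with_class_character \<pi> \<longleftrightarrow>
     (\<forall>g\<in>carrier (GL (rk \<pi>)). act \<pi> g \<in> carrier_mat (dg \<pi>) (dg \<pi>)) \<and>
     (\<forall>x\<in>carrier (GL (rk \<pi>)). \<forall>g\<in>carrier (GL (rk \<pi>)).
        mat_trace (act \<pi> (x * g * inv\<^bsub>GL (rk \<pi>)\<^esub> x)) = mat_trace (act \<pi> g))"

definition mean :: "'a :: {field, finite} gl_rep \<Rightarrow> complex" where
  "mean \<pi> = expect (rk \<pi>) (character \<pi>)"

lemma mean_trace: "mean \<pi> = expect (rk \<pi>) (\<lambda>g. mat_trace (act \<pi> g))"
  unfolding mean_def expect_def by (simp add: character_def cong: sum.cong)

text \<open>
  A character vanishes outside its own group, and groups of different rank share no matrix.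
\<close>

lemma expect_character: "expect N (character \<pi>) = (if N = rk \<pi> then mean \<pi> else 0)"
proof (cases "N = rk \<pi>")
  case False
  have "character \<pi> g = 0" if "g \<in> carrier (GL N)" for g
    using GL_carrier_mat[OF that] False GL_carrier_mat[of g "rk \<pi>"] by (auto simp: character_def)
  then show ?thesis using False by (simp add: expect_def)
qed (simp add: mean_def)

lemma rk_par_ind [simp]: "rk (par_ind \<pi>1 \<pi>2) = rk \<pi>1 + rk \<pi>2"
  by (simp add: par_ind_def induced_rep_def Let_def)

text \<open>
  The representation of the parabolic subgroup from which \<open>par_ind\<close> induces: the pullback of the
  outer tensor product along the projection to the Levi factor.
\<close>

definition levi_rep :: "'a :: {field, finite} gl_rep \<Rightarrow> 'a gl_rep \<Rightarrow> 'a mat \<Rightarrow> complex mat" where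
  "levi_rep \<pi>1 \<pi>2 p = (case split_block p (rk \<pi>1) (rk \<pi>1) of
     (g11, g12, g21, g22) \<Rightarrow> kronecker (act \<pi>1 g11) (act \<pi>2 g22))"

lemma par_ind_levi_rep:
  "par_ind \<pi>1 \<pi>2 = induced_rep (rk \<pi>1 + rk \<pi>2) (parabolic (rk \<pi>1) (rk \<pi>2)) (dg \<pi>1 * dg \<pi>2) (levi_rep \<pi>1 \<pi>2)"
  unfolding par_ind_def levi_rep_def ..

lemma levi_rep_block:
  assumes "a \<in> carrier (GL (rk \<pi>1))" "b \<in> carrier_mat (rk \<pi>1) (rk \<pi>2)" "d \<in> carrier (GL (rk \<pi>2))"
  shows "levi_rep \<pi>1 \<pi>2 (four_block_mat a b (0\<^sub>m (rk \<pi>2) (rk \<pi>1)) d) = kronecker (act \<pi>1 a) (act \<pi>2 d)"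
  using split_block_four_block[of a "rk \<pi>1" b "rk \<pi>2" "0\<^sub>m (rk \<pi>2) (rk \<pi>1)" d] assms
  by (simp add: levi_rep_def GL_carrier_mat)

text \<open>
  On a block triangular matrix the trace of the inducing representation is the product of the
  traces of the diagonal blocks. It is therefore invariant under conjugation in the parabolic
  subgroup, and its sum over the parabolic subgroup is the product of the two character sums times
  the number of upper right blocks, a factor that cancels against the order of the subgroup.
\<close>

lemma par_ind_properties:
  fixes \<pi>1 \<pi>2 :: "'a :: {field, finite} gl_rep"
  assumes r1: "rep_with_class_character \<pi>1" and r2: "rep_with_class_character \<pi>2"
  shows rep_with_class_character_par_ind: "rep_with_class_character (par_ind \<pi>1 \<pi>2)"
    and mean_par_ind: "mean (par_ind \<pi>1 \<pi>2) = mean \<pi>1 * mean \<pi>2"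
proof -
  define m r where mr: "m = rk \<pi>1" "r = rk \<pi>2"
  define d1 d2 where d12: "d1 = dg \<pi>1" "d2 = dg \<pi>2"
  interpret A: group "GL m :: 'a mat monoid" by (rule group_GL)
  interpret D: group "GL r :: 'a mat monoid" by (rule group_GL)
  let ?G = "GL (m + r) :: 'a mat monoid"
  interpret G: group ?G by (rule group_GL)
  define \<sigma> where "\<sigma> = levi_rep \<pi>1 \<pi>2"
  have pi: "par_ind \<pi>1 \<pi>2 = induced_rep (m + r) (parabolic m r) (d1 * d2) \<sigma>"
    unfolding mr d12 \<sigma>_def by (rule par_ind_levi_rep)
  have c1: "act \<pi>1 a \<in> carrier_mat d1 d1" if "a \<in> carrier (GL m)" for a
    using r1 that by (simp add: rep_with_class_character_def mr d12)
  have c2: "act \<pi>2 a \<in> carrier_mat d2 d2" if "a \<in> carrier (GL r)" for a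
    using r2 that by (simp add: rep_with_class_character_def mr d12)
  have \<sigma>_block: "\<sigma> (four_block_mat a b (0\<^sub>m r m) d) = kronecker (act \<pi>1 a) (act \<pi>2 d)"
    if "a \<in> carrier (GL m)" "b \<in> carrier_mat m r" "d \<in> carrier (GL r)" for a b d
    using that unfolding mr \<sigma>_def by (rule levi_rep_block)
  have \<sigma>_carrier: "\<sigma> p \<in> carrier_mat (d1 * d2) (d1 * d2)" if p: "p \<in> parabolic m r" for p
    using p by (elim parabolicE) (simp add: \<sigma>_block kronecker_carrier[OF c1 c2])
  have \<sigma>_trace: "mat_trace (\<sigma> (four_block_mat a b (0\<^sub>m r m) d)) = mat_trace (act \<pi>1 a) * mat_trace (act \<pi>2 d)"
    if "a \<in> carrier (GL m)" "b \<in> carrier_mat m r" "d \<in> carrier (GL r)" for a b d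
    unfolding \<sigma>_block[OF that] by (rule mat_trace_kronecker[OF c1[OF that(1)] c2[OF that(3)]])
  have cl1: "mat_trace (act \<pi>1 (inv\<^bsub>GL m\<^esub> x * g * x)) = mat_trace (act \<pi>1 g)"
    if "x \<in> carrier (GL m)" "g \<in> carrier (GL m)" for x g
  proof -
    have "mat_trace (act \<pi>1 (inv\<^bsub>GL m\<^esub> x * g * inv\<^bsub>GL m\<^esub> (inv\<^bsub>GL m\<^esub> x))) = mat_trace (act \<pi>1 g)"
      using r1 A.inv_closed[OF that(1)] that(2) unfolding rep_with_class_character_def mr by blast
    then show ?thesis using that by simp
  qed
  have cl2: "mat_trace (act \<pi>2 (inv\<^bsub>GL r\<^esub> x * g * x)) = mat_trace (act \<pi>2 g)"
    if "x \<in> carrier (GL r)" "g \<in> carrier (GL r)" for x g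
  proof -
    have "mat_trace (act \<pi>2 (inv\<^bsub>GL r\<^esub> x * g * inv\<^bsub>GL r\<^esub> (inv\<^bsub>GL r\<^esub> x))) = mat_trace (act \<pi>2 g)"
      using r2 D.inv_closed[OF that(1)] that(2) unfolding rep_with_class_character_def mr by blast
    then show ?thesis using that by simp
  qed
  have conj: "mat_trace (\<sigma> (inv\<^bsub>?G\<^esub> x * h * x)) = mat_trace (\<sigma> h)"
    if xP: "x \<in> parabolic m r" and hP: "h \<in> parabolic m r" for x h
  proof -
    obtain a b d where x: "a \<in> carrier (GL m)" "b \<in> carrier_mat m r" "d \<in> carrier (GL r)"
      "x = four_block_mat a b (0\<^sub>m r m) d" using xP by (rule parabolicE)
    obtain a' b' d' where h: "a' \<in> carrier (GL m)" "b' \<in> carrier_mat m r" "d' \<in> carrier (GL r)"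
      "h = four_block_mat a' b' (0\<^sub>m r m) d'" using hP by (rule parabolicE)
    let ?ia = "inv\<^bsub>GL m\<^esub> a" and ?id = "inv\<^bsub>GL r\<^esub> d"
    have i: "?ia \<in> carrier (GL m)" "?id \<in> carrier (GL r)" using x by simp_all
    have p: "?ia * a' \<in> carrier (GL m)" "?id * d' \<in> carrier (GL r)"
      "?ia * a' * a \<in> carrier (GL m)" "?id * d' * d \<in> carrier (GL r)"
      using A.m_closed[OF i(1) h(1)] D.m_closed[OF i(2) h(3)]
        A.m_closed[OF A.m_closed[OF i(1) h(1)] x(1)] D.m_closed[OF D.m_closed[OF i(2) h(3)] x(3)] by simp_all
    note c = i[THEN GL_carrier_mat] p[THEN GL_carrier_mat] GL_carrier_mat[OF x(1)] x(2) GL_carrier_mat[OF x(3)]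
      GL_carrier_mat[OF h(1)] h(2) GL_carrier_mat[OF h(3)]
    have i12: "- (?ia * b * ?id) \<in> carrier_mat m r" using c by auto
    define e where "e = ?ia * b' + - (?ia * b * ?id) * d'"
    have e: "e \<in> carrier_mat m r" unfolding e_def using c i12 by (intro add_carrier_mat mult_carrier_mat)
    have "inv\<^bsub>?G\<^esub> x * h = four_block_mat (?ia * a') e (0\<^sub>m r m) (?id * d')"
      unfolding x(4) h(4) parabolic_inverse(2)[OF x(1-3)] e_def
      by (rule parabolic_mult) (use c i12 in simp_all)
    then have "inv\<^bsub>?G\<^esub> x * h * x =
        four_block_mat (?ia * a' * a) (?ia * a' * b + e * d) (0\<^sub>m r m) (?id * d' * d)"
      unfolding x(4) by (simp only:) (rule parabolic_mult, use c e in simp_all)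
    moreover have "?ia * a' * b + e * d \<in> carrier_mat m r"
      using c e by (intro add_carrier_mat mult_carrier_mat)
    ultimately have "mat_trace (\<sigma> (inv\<^bsub>?G\<^esub> x * h * x)) = mat_trace (act \<pi>1 (?ia * a' * a)) * mat_trace (act \<pi>2 (?id * d' * d))"
      using p(3,4) by (simp only: \<sigma>_trace)
    also have "\<dots> = mat_trace (act \<pi>1 a') * mat_trace (act \<pi>2 d')"
      unfolding cl1[OF x(1) h(1)] cl2[OF x(3) h(3)] ..
    also have "\<dots> = mat_trace (\<sigma> h)" unfolding h(4) by (rule \<sigma>_trace[OF h(1-3), symmetric])
    finally show ?thesis .
  qed
  note H = subgroup_parabolic[where 'a='a, of m r]
  have act_carrier: "act (par_ind \<pi>1 \<pi>2) g \<in> carrier_mat (dg (par_ind \<pi>1 \<pi>2)) (dg (par_ind \<pi>1 \<pi>2))" for g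
    unfolding pi by (simp add: induced_rep_def Let_def)
  have "mat_trace (act (par_ind \<pi>1 \<pi>2) (x * g * inv\<^bsub>?G\<^esub> x)) = mat_trace (act (par_ind \<pi>1 \<pi>2) g)"
    if "x \<in> carrier ?G" "g \<in> carrier ?G" for x g
    unfolding pi by (rule induced_rep_character_conj[OF H \<sigma>_carrier conj that(2,1)])
  then show "rep_with_class_character (par_ind \<pi>1 \<pi>2)"
    unfolding rep_with_class_character_def rk_par_ind mr[symmetric] using act_carrier by blast
  have "mean (par_ind \<pi>1 \<pi>2) = (\<Sum>p\<in>parabolic m r. mat_trace (\<sigma> p)) / of_nat (card (parabolic m r :: 'a mat set))"
    unfolding mean_trace rk_par_ind mr[symmetric] unfolding pi
    by (rule expect_induced_rep[OF H \<sigma>_carrier conj])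
  also have "(\<Sum>p\<in>parabolic m r. mat_trace (\<sigma> p)) =
      (\<Sum>a\<in>carrier (GL m). \<Sum>b\<in>(carrier_mat m r :: 'a mat set). \<Sum>d\<in>carrier (GL r). mat_trace (act \<pi>1 a) * mat_trace (act \<pi>2 d))"
    by (rule sum_parabolic) (rule \<sigma>_trace)
  also have "\<dots> = of_nat (card (carrier_mat m r :: 'a mat set)) *
      ((\<Sum>a\<in>carrier (GL m). mat_trace (act \<pi>1 a)) * (\<Sum>d\<in>carrier (GL r). mat_trace (act \<pi>2 d)))"
    unfolding sum_product by (simp add: sum_distrib_left)
  also have "(of_nat (card (parabolic m r :: 'a mat set)) :: complex) = (\<Sum>p\<in>(parabolic m r :: 'a mat set). 1)" by simp
  also have "\<dots> = (\<Sum>a\<in>carrier (GL m :: 'a mat monoid). \<Sum>b\<in>(carrier_mat m r :: 'a mat set). \<Sum>d\<in>carrier (GL r :: 'a mat monoid). 1)"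
    by (rule sum_parabolic) simp
  also have "\<dots> = of_nat (card (carrier_mat m r :: 'a mat set)) *
      (of_nat (card (carrier (GL m :: 'a mat monoid))) * of_nat (card (carrier (GL r :: 'a mat monoid))))"
    by simp
  finally have "mean (par_ind \<pi>1 \<pi>2) = of_nat (card (carrier_mat m r :: 'a mat set)) *
      ((\<Sum>a\<in>carrier (GL m). mat_trace (act \<pi>1 a)) * (\<Sum>d\<in>carrier (GL r). mat_trace (act \<pi>2 d))) /
      (of_nat (card (carrier_mat m r :: 'a mat set)) *
      (of_nat (card (carrier (GL m :: 'a mat monoid))) * of_nat (card (carrier (GL r :: 'a mat monoid)))))" .
  moreover have "card (carrier_mat m r :: 'a mat set) > 0"
    using finite_carrier_mat[where 'a='a, of m r] zero_carrier_mat[of m r]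
    by (metis card_gt_0_iff empty_iff)
  ultimately show "mean (par_ind \<pi>1 \<pi>2) = mean \<pi>1 * mean \<pi>2"
    unfolding mean_trace mr[symmetric] expect_def by simp
qed

lemma is_rep_class_character:
  assumes "is_rep \<pi>"
  shows "rep_with_class_character \<pi>"
proof -
  let ?G = "GL (rk \<pi>) :: 'a mat monoid" and ?H = "GL (dg \<pi>) :: complex mat monoid"
  interpret G: group ?G by (rule group_GL)
  interpret H: group ?H by (rule group_GL)
  interpret group_hom ?G ?H "act \<pi>"
    using assms by unfold_locales (simp add: is_rep_def)
  have c: "act \<pi> g \<in> carrier_mat (dg \<pi>) (dg \<pi>)" if "g \<in> carrier ?G" for g
    using hom_closed[OF that] by (rule GL_carrier_mat)
  have "mat_trace (act \<pi> (x * g * inv\<^bsub>?G\<^esub> x)) = mat_trace (act \<pi> g)"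
    if x: "x \<in> carrier ?G" and g: "g \<in> carrier ?G" for x g
  proof -
    note ix = G.inv_closed[OF x]
    have "act \<pi> (x * g * inv\<^bsub>?G\<^esub> x) = act \<pi> (x * g) * act \<pi> (inv\<^bsub>?G\<^esub> x)"
      using hom_mult[OF G.m_closed[OF x g] ix] by simp
    then have "mat_trace (act \<pi> (x * g * inv\<^bsub>?G\<^esub> x)) = mat_trace (act \<pi> (inv\<^bsub>?G\<^esub> x) * act \<pi> (x * g))"
      using mat_trace_mult_commute[OF c[OF G.m_closed[OF x g]] c[OF ix]] by simp
    also have "act \<pi> (inv\<^bsub>?G\<^esub> x) * act \<pi> (x * g) = act \<pi> (inv\<^bsub>?G\<^esub> x \<otimes>\<^bsub>?G\<^esub> (x \<otimes>\<^bsub>?G\<^esub> g))"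
      using hom_mult[OF ix G.m_closed[OF x g]] by simp
    also have "\<dots> = act \<pi> g" unfolding G.cancel_left(1)[OF x g] ..
    finally show ?thesis .
  qed
  then show ?thesis unfolding rep_with_class_character_def using c by blast
qed

section \<open>Invariant vectors\<close>

definition fixed_vector :: "'a :: {field, finite} gl_rep \<Rightarrow> complex vec \<Rightarrow> bool" where
  "fixed_vector \<pi> v \<longleftrightarrow> v \<in> carrier_vec (dg \<pi>) \<and> (\<forall>g\<in>carrier (GL (rk \<pi>)). act \<pi> g *\<^sub>v v = v)"

definition no_invariants :: "'a :: {field, finite} gl_rep \<Rightarrow> bool" where
  "no_invariants \<pi> \<longleftrightarrow> (\<forall>v. fixed_vector \<pi> v \<longrightarrow> v = 0\<^sub>v (dg \<pi>))"

definition acts_trivially :: "'a :: {field, finite} gl_rep \<Rightarrow> bool" where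
  "acts_trivially \<pi> \<longleftrightarrow> dg \<pi> = 1 \<and> (\<forall>g\<in>carrier (GL (rk \<pi>)). act \<pi> g = 1\<^sub>m 1)"

lemma is_rep_closed:
  assumes "is_rep \<pi>" "g \<in> carrier (GL (rk \<pi>))"
  shows "act \<pi> g \<in> carrier (GL (dg \<pi>))"
  using assms unfolding is_rep_def hom_def by blast

lemma is_rep_carrier_mat:
  "is_rep \<pi> \<Longrightarrow> g \<in> carrier (GL (rk \<pi>)) \<Longrightarrow> act \<pi> g \<in> carrier_mat (dg \<pi>) (dg \<pi>)"
  by (rule GL_carrier_mat[OF is_rep_closed])

lemma is_rep_mult:
  assumes "is_rep \<pi>" "g \<in> carrier (GL (rk \<pi>))" "h \<in> carrier (GL (rk \<pi>))"
  shows "act \<pi> (g * h) = act \<pi> g * act \<pi> h"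
  using assms unfolding is_rep_def hom_def by simp

text \<open>
  The columns of the operator \<open>\<Sum>\<^sub>g \<pi>(g)\<close> are invariant vectors.
\<close>

lemma sum_act_eq_0:
  assumes \<pi>: "is_rep \<pi>" and no: "no_invariants \<pi>" and i: "i < dg \<pi>" and j: "j < dg \<pi>"
  shows "(\<Sum>g\<in>carrier (GL (rk \<pi>)). act \<pi> g $$ (i, j)) = 0"
proof -
  let ?G = "GL (rk \<pi>) :: 'a mat monoid"
  interpret G: group ?G by (rule group_GL)
  define v where "v = vec (dg \<pi>) (\<lambda>i. \<Sum>g\<in>carrier ?G. act \<pi> g $$ (i, j))"
  have v: "v \<in> carrier_vec (dg \<pi>)" by (simp add: v_def)
  note c = is_rep_carrier_mat[OF \<pi>]
  have "act \<pi> h *\<^sub>v v = v" if h: "h \<in> carrier ?G" for h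
  proof (rule eq_vecI)
    fix i assume "i < dim_vec v"
    then have i: "i < dg \<pi>" by (simp add: v_def)
    have "(act \<pi> h *\<^sub>v v) $ i = (\<Sum>k<dg \<pi>. \<Sum>g\<in>carrier ?G. act \<pi> h $$ (i, k) * act \<pi> g $$ (k, j))"
      unfolding mult_vec_index_sum[OF c[OF h] v i] by (simp add: v_def sum_distrib_left)
    also have "\<dots> = (\<Sum>g\<in>carrier ?G. \<Sum>k<dg \<pi>. act \<pi> h $$ (i, k) * act \<pi> g $$ (k, j))"
      by (rule sum.swap)
    also have "\<dots> = (\<Sum>g\<in>carrier ?G. act \<pi> (h \<otimes>\<^bsub>?G\<^esub> g) $$ (i, j))"
    proof (rule sum.cong[OF refl])
      fix g assume g: "g \<in> carrier ?G"
      show "(\<Sum>k<dg \<pi>. act \<pi> h $$ (i, k) * act \<pi> g $$ (k, j)) = act \<pi> (h \<otimes>\<^bsub>?G\<^esub> g) $$ (i, j)"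
        using c[OF h] c[OF g] i j
        by (simp add: is_rep_mult[OF \<pi> h g] scalar_prod_def lessThan_atLeast0)
    qed
    also have "\<dots> = (\<Sum>g\<in>carrier ?G. act \<pi> g $$ (i, j))"
      by (rule sum.reindex_bij_betw)
        (use G.inj_on_cmult[OF h] G.surj_const_mult[OF h] in \<open>auto simp: bij_betw_def\<close>)
    finally show "(act \<pi> h *\<^sub>v v) $ i = v $ i" using i by (simp add: v_def)
  qed (use c[OF h] in \<open>simp add: v_def\<close>)
  then have "v = 0\<^sub>v (dg \<pi>)" using no v unfolding no_invariants_def fixed_vector_def by blast
  then have "v $ i = 0" using i by simp
  then show ?thesis using i by (simp add: v_def)
qed

lemma mean_no_invariants:
  assumes \<pi>: "is_rep \<pi>" and no: "no_invariants \<pi>"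
  shows "mean \<pi> = 0"
proof -
  have "(\<Sum>g\<in>carrier (GL (rk \<pi>)). mat_trace (act \<pi> g)) =
      (\<Sum>g\<in>carrier (GL (rk \<pi>)). \<Sum>i<dg \<pi>. act \<pi> g $$ (i, i))"
    by (intro sum.cong refl) (auto simp: mat_trace_def dest: is_rep_carrier_mat[OF \<pi>])
  also have "\<dots> = (\<Sum>i<dg \<pi>. \<Sum>g\<in>carrier (GL (rk \<pi>)). act \<pi> g $$ (i, i))" by (rule sum.swap)
  also have "\<dots> = 0" by (rule sum.neutral) (simp add: sum_act_eq_0[OF \<pi> no])
  finally show ?thesis by (simp add: mean_trace expect_def)
qed

lemma character_acts_trivially:
  assumes "acts_trivially \<pi>"
  shows "character \<pi> = character (triv_rep (rk \<pi>))"
  using assms by (auto simp: fun_eq_iff character_def acts_trivially_def triv_rep_def mat_trace_def)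

lemma mean_acts_trivially:
  fixes \<pi> :: "'a :: {field, finite} gl_rep"
  assumes "acts_trivially \<pi>"
  shows "mean \<pi> = 1"
proof -
  have "(\<Sum>g\<in>carrier (GL (rk \<pi>)). mat_trace (act \<pi> g)) = (\<Sum>g\<in>carrier (GL (rk \<pi>) :: 'a mat monoid). 1)"
    using assms by (intro sum.cong refl) (simp add: acts_trivially_def mat_trace_def)
  then show ?thesis using card_GL_pos[where 'a='a, of "rk \<pi>"] by (simp add: mean_trace expect_def)
qed

lemma acts_trivially_triv_rep: "acts_trivially (triv_rep n)"
  by (simp add: acts_trivially_def triv_rep_def)

lemma rk_triv_rep [simp]: "rk (triv_rep n) = n" and dg_triv_rep [simp]: "dg (triv_rep n) = 1"
  by (simp_all add: triv_rep_def)

lemma is_rep_triv_rep: "is_rep (triv_rep n)"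
  using one_in_GL[of 1, where 'a=complex] by (auto simp: is_rep_def hom_def triv_rep_def)

lemma subspace_vecI:
  assumes "W \<subseteq> carrier_vec d" "0\<^sub>v d \<in> W" "\<And>v w. v \<in> W \<Longrightarrow> w \<in> W \<Longrightarrow> v + w \<in> W"
    and "\<And>c v. v \<in> W \<Longrightarrow> c \<cdot>\<^sub>v v \<in> W"
  shows "VectorSpace.subspace class_ring W (module_vec TYPE('a :: field) d)"
proof -
  have vs: "vectorspace class_ring (module_vec TYPE('a) d)" by (rule vec_vs)
  then have "Module.module class_ring (module_vec TYPE('a) d)" by (simp add: vectorspace_def)
  then have "LinearCombinations.submodule class_ring W (module_vec TYPE('a) d)"
    by (rule LinearCombinations.submodule.intro) (use assms in \<open>auto simp: module_vec_simps\<close>)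
  then show ?thesis using vs by (rule VectorSpace.subspace.intro[rotated])
qed

text \<open>
  The invariant vectors form a subrepresentation. If it is everything, each group element acts as
  the identity, every subspace is a subrepresentation, and irreducibility forces dimension \<open>1\<close>.
\<close>

lemma irreducible_rep_cases:
  fixes \<pi> :: "'a :: {field, finite} gl_rep"
  assumes irr: "irreducible_rep \<pi>"
  obtains "no_invariants \<pi>" | "acts_trivially \<pi>"
proof (cases "no_invariants \<pi>")
  case False
  let ?d = "dg \<pi>"
  have \<pi>: "is_rep \<pi>" and pos: "?d > 0"
    and sub: "\<And>W. VectorSpace.subspace class_ring W (module_vec TYPE(complex) ?d) \<Longrightarrow>
       (\<forall>g\<in>carrier (GL (rk \<pi>)). \<forall>v\<in>W. act \<pi> g *\<^sub>v v \<in> W) \<Longrightarrow>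
       W = {0\<^sub>v ?d} \<or> W = carrier_vec ?d"
    using irr unfolding irreducible_rep_def by blast+
  note c = is_rep_carrier_mat[OF \<pi>]
  have "{v. fixed_vector \<pi> v} = {0\<^sub>v ?d} \<or> {v. fixed_vector \<pi> v} = carrier_vec ?d"
  proof (rule sub)
    show "VectorSpace.subspace class_ring {v. fixed_vector \<pi> v} (module_vec TYPE(complex) ?d)"
    proof (rule subspace_vecI)
      show "{v. fixed_vector \<pi> v} \<subseteq> carrier_vec ?d" by (auto simp: fixed_vector_def)
      have "act \<pi> g *\<^sub>v 0\<^sub>v ?d = 0\<^sub>v ?d" if "g \<in> carrier (GL (rk \<pi>))" for g
        using c[OF that] by (intro eq_vecI) auto
      then show "0\<^sub>v ?d \<in> {v. fixed_vector \<pi> v}" by (simp add: fixed_vector_def)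
      show "v + w \<in> {v. fixed_vector \<pi> v}" if "v \<in> {v. fixed_vector \<pi> v}" "w \<in> {v. fixed_vector \<pi> v}" for v w
        using that by (simp add: fixed_vector_def mult_add_distrib_mat_vec[OF c])
      show "a \<cdot>\<^sub>v v \<in> {v. fixed_vector \<pi> v}" if "v \<in> {v. fixed_vector \<pi> v}" for a v
        using that by (simp add: fixed_vector_def mult_mat_vec[OF c])
    qed
    show "\<forall>g\<in>carrier (GL (rk \<pi>)). \<forall>v\<in>{v. fixed_vector \<pi> v}. act \<pi> g *\<^sub>v v \<in> {v. fixed_vector \<pi> v}"
      by (simp add: fixed_vector_def)
  qed
  moreover have "{v. fixed_vector \<pi> v} \<noteq> {0\<^sub>v ?d}"
    using False unfolding no_invariants_def by blast
  ultimately have all: "{v. fixed_vector \<pi> v} = carrier_vec ?d" by blast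
  have act1: "act \<pi> g = 1\<^sub>m ?d" if g: "g \<in> carrier (GL (rk \<pi>))" for g
  proof (rule eq_matI)
    fix i j assume "i < dim_row (1\<^sub>m ?d :: complex mat)" "j < dim_col (1\<^sub>m ?d :: complex mat)"
    then have ij: "i < ?d" "j < ?d" by simp_all
    have "fixed_vector \<pi> (unit_vec ?d j)" using all unit_vec_carrier by blast
    then have "act \<pi> g *\<^sub>v unit_vec ?d j = unit_vec ?d j" using g unfolding fixed_vector_def by blast
    then have "(act \<pi> g *\<^sub>v unit_vec ?d j) $ i = unit_vec ?d j $ i" by (rule arg_cong)
    then show "act \<pi> g $$ (i, j) = 1\<^sub>m ?d $$ (i, j)" using c[OF g] ij by simp
  qed (use c[OF g] in auto)
  have "?d = 1"
  proof (rule ccontr)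
    assume "?d \<noteq> 1"
    then have d: "0 < ?d" "1 < ?d" using pos by auto
    \<comment> \<open>A coordinate hyperplane would be a proper nonzero subrepresentation.\<close>
    let ?W = "{v \<in> carrier_vec ?d. v $ 1 = (0 :: complex)}"
    have "?W = {0\<^sub>v ?d} \<or> ?W = carrier_vec ?d"
    proof (rule sub)
      show "VectorSpace.subspace class_ring ?W (module_vec TYPE(complex) ?d)"
        by (rule subspace_vecI) (use d in auto)
      show "\<forall>g\<in>carrier (GL (rk \<pi>)). \<forall>v\<in>?W. act \<pi> g *\<^sub>v v \<in> ?W" by (simp add: act1)
    qed
    moreover have "unit_vec ?d 0 \<in> ?W" using d by simp
    moreover have "unit_vec ?d 0 \<noteq> (0\<^sub>v ?d :: complex vec)"
      using d by (metis index_unit_vec(1) index_zero_vec(1) zero_neq_one)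
    moreover have "unit_vec ?d 1 \<notin> ?W" using d by simp
    moreover have "unit_vec ?d 1 \<in> (carrier_vec ?d :: complex vec set)" by simp
    ultimately show False by blast
  qed
  then have "acts_trivially \<pi>" using act1 by (simp add: acts_trivially_def)
  then show ?thesis using that by blast
qed (use that in blast)

lemma irreducible_triv_rep: "irreducible_rep (triv_rep n)"
proof -
  have "W = {0\<^sub>v 1} \<or> W = carrier_vec 1"
    if W: "VectorSpace.subspace class_ring W (module_vec TYPE(complex) 1)" for W
  proof (cases "W = {0\<^sub>v 1}")
    case False
    interpret LinearCombinations.submodule class_ring W "module_vec TYPE(complex) 1"
      using W by (simp add: VectorSpace.subspace_def)
    have sub: "W \<subseteq> carrier_vec 1" using subset by (simp add: module_vec_simps)
    have zero: "0\<^sub>v 1 \<in> W" using zero_closed by (simp add: module_vec_simps)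
    have smult: "a \<cdot>\<^sub>v v \<in> W" if "v \<in> W" for a v
      using smult_closed[of a v] that by (simp add: module_vec_simps)
    obtain v where v: "v \<in> W" "v \<noteq> 0\<^sub>v 1" using False zero by blast
    have vc: "v \<in> carrier_vec 1" using sub v(1) by blast
    have v0: "v $ 0 \<noteq> 0"
    proof
      assume "v $ 0 = 0"
      then have "v = 0\<^sub>v 1" using vc by (intro eq_vecI) auto
      then show False using v(2) by simp
    qed
    have "u \<in> W" if u: "u \<in> carrier_vec 1" for u
    proof -
      have "u = (u $ 0 / v $ 0) \<cdot>\<^sub>v v" using u vc v0 by (intro eq_vecI) auto
      then show ?thesis using smult[OF v(1), of "u $ 0 / v $ 0"] by simp
    qed
    then show ?thesis using sub by blast
  qed simp
  then show ?thesis unfolding irreducible_rep_def using is_rep_triv_rep by simp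
qed

text \<open>
  An injective intertwiner maps nonzero invariant vectors to nonzero invariant vectors.
\<close>

lemma no_invariants_pull_back:
  assumes T: "intertwines T \<sigma> \<pi>"
    and inj: "\<forall>v\<in>carrier_vec (dg \<sigma>). T *\<^sub>v v = 0\<^sub>v (dg \<pi>) \<longrightarrow> v = 0\<^sub>v (dg \<sigma>)"
    and \<sigma>: "is_rep \<sigma>" and \<pi>: "\<And>g. g \<in> carrier (GL (rk \<pi>)) \<Longrightarrow> act \<pi> g \<in> carrier_mat (dg \<pi>) (dg \<pi>)"
    and no: "no_invariants \<pi>"
  shows "no_invariants \<sigma>"
  unfolding no_invariants_def
proof (intro allI impI)
  fix v assume fx: "fixed_vector \<sigma> v"
  then have v: "v \<in> carrier_vec (dg \<sigma>)" by (simp add: fixed_vector_def)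
  have rk: "rk \<sigma> = rk \<pi>" and Tc: "T \<in> carrier_mat (dg \<pi>) (dg \<sigma>)"
    and comm: "\<And>g. g \<in> carrier (GL (rk \<pi>)) \<Longrightarrow> T * act \<sigma> g = act \<pi> g * T"
    using T unfolding intertwines_def by blast+
  have "act \<pi> g *\<^sub>v (T *\<^sub>v v) = T *\<^sub>v v" if g: "g \<in> carrier (GL (rk \<pi>))" for g
  proof -
    have g': "g \<in> carrier (GL (rk \<sigma>))" using g rk by simp
    have "act \<pi> g *\<^sub>v (T *\<^sub>v v) = (act \<pi> g * T) *\<^sub>v v"
      by (rule assoc_mult_mat_vec[OF \<pi>[OF g] Tc v, symmetric])
    also have "\<dots> = (T * act \<sigma> g) *\<^sub>v v" unfolding comm[OF g] ..
    also have "\<dots> = T *\<^sub>v (act \<sigma> g *\<^sub>v v)"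
      by (rule assoc_mult_mat_vec[OF Tc is_rep_carrier_mat[OF \<sigma> g'] v])
    also have "act \<sigma> g *\<^sub>v v = v" using fx g' unfolding fixed_vector_def by blast
    finally show ?thesis .
  qed
  then have "fixed_vector \<pi> (T *\<^sub>v v)"
    unfolding fixed_vector_def using mult_mat_vec_carrier[OF Tc v] by blast
  then have "T *\<^sub>v v = 0\<^sub>v (dg \<pi>)" using no unfolding no_invariants_def by blast
  then show "v = 0\<^sub>v (dg \<sigma>)" using inj v by blast
qed

lemma no_invariants_constituent:
  assumes "constituent \<sigma> \<pi>" and "rep_with_class_character \<pi>" and "no_invariants \<pi>"
  shows "no_invariants \<sigma>"
proof -
  obtain T where T: "intertwines T \<sigma> \<pi>"
    "\<forall>v\<in>carrier_vec (dg \<sigma>). T *\<^sub>v v = 0\<^sub>v (dg \<pi>) \<longrightarrow> v = 0\<^sub>v (dg \<sigma>)"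
    using assms(1) unfolding constituent_def by blast
  show ?thesis
  proof (rule no_invariants_pull_back[OF T])
    show "is_rep \<sigma>" using assms(1) by (simp add: constituent_def irreducible_rep_def)
    show "act \<pi> g \<in> carrier_mat (dg \<pi>) (dg \<pi>)" if "g \<in> carrier (GL (rk \<pi>))" for g
      using assms(2) that by (simp add: rep_with_class_character_def)
  qed (rule assms(3))
qed

text \<open>
  The coset representatives that \<open>par_ind\<close> uses.
\<close>

definition parabolic_reps :: "nat \<Rightarrow> nat \<Rightarrow> 'a :: {field, finite} mat list" where
  "parabolic_reps m r = (SOME ts. left_transversal (GL (m + r)) (parabolic m r) ts)"

lemma left_transversal_parabolic_reps:
  "left_transversal (GL (m + r)) (parabolic m r) (parabolic_reps m r)"
  unfolding parabolic_reps_def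
  by (rule someI_ex[OF left_transversal_exists[OF group_GL finite_GL subgroup_parabolic]])

lemma par_ind_entries:
  fixes \<pi>1 \<pi>2 :: "'a :: {field, finite} gl_rep"
  defines "ts \<equiv> parabolic_reps (rk \<pi>1) (rk \<pi>2) :: 'a mat list" and "d \<equiv> dg \<pi>1 * dg \<pi>2"
  shows dg_par_ind: "dg (par_ind \<pi>1 \<pi>2) = length ts * d"
    and act_par_ind_carrier: "act (par_ind \<pi>1 \<pi>2) g \<in> carrier_mat (length ts * d) (length ts * d)"
    and act_par_ind_index: "i < length ts * d \<Longrightarrow> j < length ts * d \<Longrightarrow>
      act (par_ind \<pi>1 \<pi>2) g $$ (i, j) =
        (let h = inv\<^bsub>GL (rk \<pi>1 + rk \<pi>2)\<^esub> (ts ! (i div d)) * g * ts ! (j div d)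
         in if h \<in> parabolic (rk \<pi>1) (rk \<pi>2) then levi_rep \<pi>1 \<pi>2 h $$ (i mod d, j mod d) else 0)"
proof -
  have "par_ind \<pi>1 \<pi>2 = GLRep (rk \<pi>1 + rk \<pi>2) (length ts * d) (\<lambda>g. mat (length ts * d) (length ts * d) (\<lambda>(i, j).
      let h = inv\<^bsub>GL (rk \<pi>1 + rk \<pi>2)\<^esub> (ts ! (i div d)) * g * ts ! (j div d)
      in if h \<in> parabolic (rk \<pi>1) (rk \<pi>2) then levi_rep \<pi>1 \<pi>2 h $$ (i mod d, j mod d) else 0))"
    unfolding par_ind_levi_rep induced_rep_def Let_def ts_def d_def parabolic_reps_def mult_GL ..
  then show "dg (par_ind \<pi>1 \<pi>2) = length ts * d"
    and "act (par_ind \<pi>1 \<pi>2) g \<in> carrier_mat (length ts * d) (length ts * d)"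
    and "i < length ts * d \<Longrightarrow> j < length ts * d \<Longrightarrow> act (par_ind \<pi>1 \<pi>2) g $$ (i, j) =
        (let h = inv\<^bsub>GL (rk \<pi>1 + rk \<pi>2)\<^esub> (ts ! (i div d)) * g * ts ! (j div d)
         in if h \<in> parabolic (rk \<pi>1) (rk \<pi>2) then levi_rep \<pi>1 \<pi>2 h $$ (i mod d, j mod d) else 0)"
    by simp_all
qed

text \<open>
  An invariant vector of the induced representation consists of one block of coordinates per coset,
  and each block is invariant under the inducing representation (Frobenius reciprocity on vectors).
  Such a block is in particular fixed by the block diagonal matrices with blocks \<open>g\<close> and the
  identity. Averaging over \<open>g\<close> turns the first tensor factor into \<open>\<Sum>\<^sub>g \<rho>(g) = 0\<close>, so the block is zero.
\<close>

lemma no_invariants_par_ind: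
  fixes \<rho> \<pi> :: "'a :: {field, finite} gl_rep"
  assumes \<rho>: "is_rep \<rho>" and no: "no_invariants \<rho>"
    and \<pi>: "act \<pi> (1\<^sub>m (rk \<pi>)) \<in> carrier_mat (dg \<pi>) (dg \<pi>)"
  shows "no_invariants (par_ind \<rho> \<pi>)"
proof -
  let ?m = "rk \<rho>" and ?r = "rk \<pi>"
  let ?G = "GL (?m + ?r) :: 'a mat monoid" and ?H = "parabolic ?m ?r :: 'a mat set"
  define D where "D = dg \<rho> * dg \<pi>"
  define ts where "ts = (parabolic_reps ?m ?r :: 'a mat list)"
  define \<sigma> where "\<sigma> = levi_rep \<rho> \<pi>"
  interpret G: group ?G by (rule group_GL)
  interpret H: subgroup ?H ?G by (rule subgroup_parabolic)
  note dg = dg_par_ind[of \<rho> \<pi>, folded ts_def D_def] and act_c = act_par_ind_carrier[of \<rho> \<pi>, folded ts_def D_def]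
    and act = act_par_ind_index[of _ \<rho> \<pi>, folded ts_def D_def \<sigma>_def] and \<sigma> = levi_rep_block[of _ \<rho> _ \<pi>, folded \<sigma>_def]
    and ts = left_transversal_parabolic_reps[of ?m ?r, where 'a='a, folded ts_def]
  have tsc: "ts ! a \<in> carrier ?G" if "a < length ts" for a
    using ts nth_mem[OF that] unfolding left_transversal_def by blast
  have dist: "distinct ts" using ts unfolding left_transversal_def by blast
  have same: "a' = a" if a: "a < length ts" "a' < length ts" and H: "inv\<^bsub>?G\<^esub> (ts ! a) \<otimes>\<^bsub>?G\<^esub> ts ! a' \<in> ?H" for a a'
  proof -
    have "\<exists>!t. t \<in> set ts \<and> inv\<^bsub>?G\<^esub> t \<otimes>\<^bsub>?G\<^esub> ts ! a' \<in> ?H"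
      using ts tsc[OF a(2)] unfolding left_transversal_def by blast
    moreover have "inv\<^bsub>?G\<^esub> (ts ! a') \<otimes>\<^bsub>?G\<^esub> ts ! a' \<in> ?H"
      using G.l_inv[OF tsc[OF a(2)]] H.one_closed by simp
    ultimately have "ts ! a = ts ! a'" using H nth_mem[OF a(1)] nth_mem[OF a(2)] by blast
    then show ?thesis using nth_eq_iff_index_eq[OF dist a] by simp
  qed
  show ?thesis
    unfolding no_invariants_def
  proof (intro allI impI)
    fix v assume "fixed_vector (par_ind \<rho> \<pi>) v"
    then have v: "v \<in> carrier_vec (length ts * D)"
      and fx: "\<And>g. g \<in> carrier ?G \<Longrightarrow> act (par_ind \<rho> \<pi>) g *\<^sub>v v = v"
      unfolding fixed_vector_def dg rk_par_ind by blast+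
    \<comment> \<open>With \<open>g = t h t\<inverse>\<close> for the representative \<open>t\<close> of the coset, the row of blocks of \<open>g\<close> at \<open>t\<close>
      has \<open>\<sigma> h\<close> on the diagonal and zeros elsewhere.\<close>
    have block: "(\<Sum>b'<D. \<sigma> h $$ (b, b') * v $ (a * D + b')) = v $ (a * D + b)"
      if a: "a < length ts" and b: "b < D" and h: "h \<in> ?H" for a b h
    proof -
      let ?t = "ts ! a"
      note t = tsc[OF a] and hc = H.mem_carrier[OF h]
      define g where "g = ?t \<otimes>\<^bsub>?G\<^esub> h \<otimes>\<^bsub>?G\<^esub> inv\<^bsub>?G\<^esub> ?t"
      have g: "g \<in> carrier ?G" unfolding g_def by (intro G.m_closed G.inv_closed t hc)
      have idx: "a' * D + b' < length ts * D" if "a' < length ts" "b' < D" for a' b'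
      proof -
        have "a' * D + b' < Suc a' * D" using that by simp
        also have "\<dots> \<le> length ts * D" using that by (intro mult_le_mono1) simp
        finally show ?thesis .
      qed
      have entry: "act (par_ind \<rho> \<pi>) g $$ (a * D + b, a' * D + b') = (if a' = a then \<sigma> h $$ (b, b') else 0)"
        if a': "a' < length ts" and b': "b' < D" for a' b'
      proof -
        have e: "act (par_ind \<rho> \<pi>) g $$ (a * D + b, a' * D + b') =
            (let k = inv\<^bsub>?G\<^esub> ?t \<otimes>\<^bsub>?G\<^esub> g \<otimes>\<^bsub>?G\<^esub> ts ! a' in if k \<in> ?H then \<sigma> k $$ (b, b') else 0)"
          using act[OF idx[OF a b] idx[OF a' b'], of g] b b' by (simp cong: if_cong)
        have k: "inv\<^bsub>?G\<^esub> ?t \<otimes>\<^bsub>?G\<^esub> g \<otimes>\<^bsub>?G\<^esub> ts ! a' = h \<otimes>\<^bsub>?G\<^esub> (inv\<^bsub>?G\<^esub> ?t \<otimes>\<^bsub>?G\<^esub> ts ! a')"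
          unfolding g_def using t hc tsc[OF a'] by (simp del: mult_GL one_GL add: G.m_assoc G.cancel_left)
        show ?thesis
        proof (cases "a' = a")
          case True
          have "h \<otimes>\<^bsub>?G\<^esub> (inv\<^bsub>?G\<^esub> ?t \<otimes>\<^bsub>?G\<^esub> ?t) = h"
            using G.l_inv[OF t] G.r_one[OF hc] by (simp only:)
          then show ?thesis unfolding e k using True h by (simp only: Let_def if_True refl)
        next
          case False
          have "h \<otimes>\<^bsub>?G\<^esub> (inv\<^bsub>?G\<^esub> ?t \<otimes>\<^bsub>?G\<^esub> ts ! a') \<notin> ?H"
          proof
            assume "h \<otimes>\<^bsub>?G\<^esub> (inv\<^bsub>?G\<^esub> ?t \<otimes>\<^bsub>?G\<^esub> ts ! a') \<in> ?H"
            then have "inv\<^bsub>?G\<^esub> h \<otimes>\<^bsub>?G\<^esub> (h \<otimes>\<^bsub>?G\<^esub> (inv\<^bsub>?G\<^esub> ?t \<otimes>\<^bsub>?G\<^esub> ts ! a')) \<in> ?H"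
              by (rule H.m_closed[OF H.m_inv_closed[OF h]])
            then have "inv\<^bsub>?G\<^esub> ?t \<otimes>\<^bsub>?G\<^esub> ts ! a' \<in> ?H"
              unfolding G.cancel_left(1)[OF hc G.m_closed[OF G.inv_closed[OF t] tsc[OF a']]] .
            then show False using same[OF a a'] False by blast
          qed
          then show ?thesis unfolding e k using False by (simp only: Let_def if_False)
        qed
      qed
      have "v $ (a * D + b) = (act (par_ind \<rho> \<pi>) g *\<^sub>v v) $ (a * D + b)" unfolding fx[OF g] ..
      also have "\<dots> = (\<Sum>a'<length ts. \<Sum>b'<D. act (par_ind \<rho> \<pi>) g $$ (a * D + b, a' * D + b') * v $ (a' * D + b'))"
        unfolding mult_vec_index_sum[OF act_c v idx[OF a b]] by (rule sum_div_mod)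
      also have "\<dots> = (\<Sum>a'<length ts. if a' = a then \<Sum>b'<D. \<sigma> h $$ (b, b') * v $ (a * D + b') else 0)"
        by (intro sum.cong refl) (simp add: entry)
      also have "\<dots> = (\<Sum>b'<D. \<sigma> h $$ (b, b') * v $ (a * D + b'))" using a by simp
      finally show ?thesis by simp
    qed
    have zero: "v $ (a * D + b) = 0" if a: "a < length ts" and b: "b < D" for a b
    proof -
      let ?A = "act \<pi> (1\<^sub>m ?r)" and ?n = "dg \<pi>"
      have n: "?n > 0" using b by (cases "?n = 0") (simp_all add: D_def)
      have dv: "b' div ?n < dg \<rho>" if "b' < D" for b' using that n by (simp add: less_mult_imp_div_less D_def)
      have "v $ (a * D + b) =
          (\<Sum>b'<D. act \<rho> g $$ (b div ?n, b' div ?n) * (?A $$ (b mod ?n, b' mod ?n) * v $ (a * D + b')))"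
        if g: "g \<in> carrier (GL ?m)" for g
      proof -
        have "four_block_mat g (0\<^sub>m ?m ?r) (0\<^sub>m ?r ?m) (1\<^sub>m ?r) \<in> ?H"
          by (rule parabolicI[OF g _ one_in_GL]) simp
        then have "(\<Sum>b'<D. kronecker (act \<rho> g) ?A $$ (b, b') * v $ (a * D + b')) = v $ (a * D + b)"
          using block[OF a b] \<sigma>[OF g zero_carrier_mat one_in_GL] by metis
        moreover have "kronecker (act \<rho> g) ?A $$ (b, b') = act \<rho> g $$ (b div ?n, b' div ?n) * ?A $$ (b mod ?n, b' mod ?n)"
          if "b' < D" for b'
          using is_rep_carrier_mat[OF \<rho> g] \<pi> b that by (simp add: kronecker_def D_def)
        ultimately show ?thesis by (simp add: mult.assoc)
      qed
      then have "(\<Sum>g\<in>carrier (GL ?m :: 'a mat monoid). v $ (a * D + b)) =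
          (\<Sum>g\<in>carrier (GL ?m). \<Sum>b'<D. act \<rho> g $$ (b div ?n, b' div ?n) * (?A $$ (b mod ?n, b' mod ?n) * v $ (a * D + b')))"
        by (rule sum.cong[OF refl])
      also have "\<dots> = (\<Sum>b'<D. (\<Sum>g\<in>carrier (GL ?m). act \<rho> g $$ (b div ?n, b' div ?n)) * (?A $$ (b mod ?n, b' mod ?n) * v $ (a * D + b')))"
        by (subst sum.swap) (simp add: sum_distrib_right)
      also have "\<dots> = 0"
        by (rule sum.neutral) (simp add: sum_act_eq_0[OF \<rho> no dv[OF b] dv])
      finally show ?thesis using card_GL_pos[where 'a='a, of ?m] by simp
    qed
    show "v = 0\<^sub>v (dg (par_ind \<rho> \<pi>))"
      unfolding dg
    proof (rule eq_vecI)
      fix i assume "i < dim_vec (0\<^sub>v (length ts * D) :: complex vec)"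
      then have i: "i < length ts * D" by simp
      then have D: "D > 0" by (cases "D = 0") auto
      have "v $ (i div D * D + i mod D) = 0"
        by (rule zero) (use i D in \<open>simp_all add: less_mult_imp_div_less\<close>)
      then show "v $ i = 0\<^sub>v (length ts * D) $ i" using i by (simp only: div_mult_mod_eq index_zero_vec)
    qed (use v in simp)
  qed
qed

section \<open>Cuspidal representations and Zelevinsky labels\<close>

lemma rk_par_pow: "rk (par_pow \<rho> n) = n * rk \<rho>"
  by (induction n) simp_all

lemma rep_with_class_character_triv_rep: "rep_with_class_character (triv_rep n)"
  by (rule is_rep_class_character[OF is_rep_triv_rep])

lemma rep_with_class_character_par_pow:
  "is_rep \<rho> \<Longrightarrow> rep_with_class_character (par_pow \<rho> n)"
  by (induction n)
    (simp_all add: rep_with_class_character_triv_rep rep_with_class_character_par_ind is_rep_class_character)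

lemma no_invariants_par_pow:
  assumes \<rho>: "is_rep \<rho>" "no_invariants \<rho>" and "n \<ge> 1"
  shows "no_invariants (par_pow \<rho> n)"
proof -
  obtain k where k: "n = Suc k" using \<open>n \<ge> 1\<close> by (cases n) auto
  have "act (par_pow \<rho> k) (1\<^sub>m (rk (par_pow \<rho> k))) \<in> carrier_mat (dg (par_pow \<rho> k)) (dg (par_pow \<rho> k))"
    using rep_with_class_character_par_pow[OF \<rho>(1), of k] one_in_GL
    unfolding rep_with_class_character_def by blast
  then show ?thesis unfolding k by (simp add: no_invariants_par_ind[OF \<rho>])
qed

text \<open>
  Inducing the trivial representation from a parabolic subgroup gives a permutation representation
  on the cosets, and the constant vector spans a trivial subrepresentation. The row sums are \<open>1\<close>
  because a group element maps exactly one coset to a given coset.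
\<close>

lemma constituent_triv_par_ind:
  fixes \<rho> :: "'a :: {field, finite} gl_rep"
  assumes irr: "irreducible_rep \<rho>" and triv: "acts_trivially \<rho>" and rk: "rk \<rho> = m + r"
  shows "constituent \<rho> (par_ind (triv_rep m) (triv_rep r))"
proof -
  let ?\<pi> = "par_ind (triv_rep m) (triv_rep r) :: 'a gl_rep"
  let ?G = "GL (m + r) :: 'a mat monoid" and ?H = "parabolic m r :: 'a mat set"
  interpret G: group ?G by (rule group_GL)
  interpret H: subgroup ?H ?G by (rule subgroup_parabolic)
  define ts where "ts = (parabolic_reps m r :: 'a mat list)"
  have ts: "left_transversal ?G ?H ts"
    unfolding ts_def by (rule left_transversal_parabolic_reps)
  have tsc: "t \<in> carrier ?G" if "t \<in> set ts" for t
    using ts that unfolding left_transversal_def by blast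
  have dist: "distinct ts" using ts unfolding left_transversal_def by blast
  have ex1: "\<exists>!t. t \<in> set ts \<and> inv\<^bsub>?G\<^esub> t \<otimes>\<^bsub>?G\<^esub> g \<in> ?H" if "g \<in> carrier ?G" for g
    using ts that unfolding left_transversal_def by blast
  have len: "length ts > 0"
  proof -
    obtain t where "t \<in> set ts" using ex1[OF G.one_closed] by (elim ex1E conjE)
    then show ?thesis by (rule length_pos_if_in_set)
  qed
  have dg: "dg ?\<pi> = length ts" using dg_par_ind[of "triv_rep m" "triv_rep r :: 'a gl_rep"] by (simp add: ts_def)
  have c: "act ?\<pi> g \<in> carrier_mat (length ts) (length ts)" for g
    using act_par_ind_carrier[of "triv_rep m" "triv_rep r :: 'a gl_rep" g] by (simp add: ts_def)
  have levi: "levi_rep (triv_rep m) (triv_rep r) h $$ (0, 0) = 1" if "h \<in> ?H" for h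
  proof -
    obtain a b d where "a \<in> carrier (GL m)" "b \<in> carrier_mat m r" "d \<in> carrier (GL r)"
      and h: "h = four_block_mat a b (0\<^sub>m r m) d" using \<open>h \<in> ?H\<close> by (rule parabolicE)
    then have "levi_rep (triv_rep m) (triv_rep r) h = kronecker (1\<^sub>m 1) (1\<^sub>m 1)"
      using levi_rep_block[of a "triv_rep m" b "triv_rep r" d] by (simp add: triv_rep_def)
    then show ?thesis by (simp add: kronecker_def)
  qed
  have row: "(\<Sum>j<length ts. act ?\<pi> g $$ (i, j)) = 1" if g: "g \<in> carrier ?G" and i: "i < length ts" for g i
  proof -
    have s: "ts ! i \<in> carrier ?G" by (rule tsc[OF nth_mem[OF i]])
    have swap: "inv\<^bsub>?G\<^esub> (ts ! i) \<otimes>\<^bsub>?G\<^esub> g \<otimes>\<^bsub>?G\<^esub> t \<in> ?H \<longleftrightarrow>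
        inv\<^bsub>?G\<^esub> t \<otimes>\<^bsub>?G\<^esub> (inv\<^bsub>?G\<^esub> g \<otimes>\<^bsub>?G\<^esub> ts ! i) \<in> ?H" (is "?x \<in> ?H \<longleftrightarrow> ?y \<in> ?H")
      if t: "t \<in> carrier ?G" for t
    proof -
      have "inv\<^bsub>?G\<^esub> ?x = ?y" "inv\<^bsub>?G\<^esub> ?y = ?x"
        using s g t by (simp_all del: mult_GL one_GL add: G.inv_mult_group G.m_assoc)
      then show ?thesis using H.m_inv_closed[of ?x] H.m_inv_closed[of ?y] by auto
    qed
    obtain t where t: "t \<in> set ts" "inv\<^bsub>?G\<^esub> t \<otimes>\<^bsub>?G\<^esub> (inv\<^bsub>?G\<^esub> g \<otimes>\<^bsub>?G\<^esub> ts ! i) \<in> ?H"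
      and un: "\<And>t'. t' \<in> set ts \<Longrightarrow> inv\<^bsub>?G\<^esub> t' \<otimes>\<^bsub>?G\<^esub> (inv\<^bsub>?G\<^esub> g \<otimes>\<^bsub>?G\<^esub> ts ! i) \<in> ?H \<Longrightarrow> t' = t"
      using ex1[OF G.m_closed[OF G.inv_closed[OF g] s]] by blast
    have "(\<Sum>j<length ts. act ?\<pi> g $$ (i, j)) =
        (\<Sum>j<length ts. if inv\<^bsub>?G\<^esub> (ts ! i) \<otimes>\<^bsub>?G\<^esub> g \<otimes>\<^bsub>?G\<^esub> ts ! j \<in> ?H then 1 else 0)"
    proof (rule sum.cong[OF refl])
      fix j assume "j \<in> {..<length ts}"
      then have j: "j < length ts" by simp
      show "act ?\<pi> g $$ (i, j) = (if inv\<^bsub>?G\<^esub> (ts ! i) \<otimes>\<^bsub>?G\<^esub> g \<otimes>\<^bsub>?G\<^esub> ts ! j \<in> ?H then 1 else 0)"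
        using act_par_ind_index[of i "triv_rep m" "triv_rep r :: 'a gl_rep" j g] i j
        by (simp add: ts_def[symmetric] Let_def levi)
    qed
    also have "\<dots> = (\<Sum>t'\<in>set ts. if inv\<^bsub>?G\<^esub> (ts ! i) \<otimes>\<^bsub>?G\<^esub> g \<otimes>\<^bsub>?G\<^esub> t' \<in> ?H then 1 else 0)"
      by (rule sum.reindex_bij_betw[OF bij_betw_nth[OF dist refl refl]])
    also have "\<dots> = (\<Sum>t'\<in>set ts. if t' = t then 1 else 0)"
    proof (rule sum.cong[OF refl])
      fix t' assume t': "t' \<in> set ts"
      have "inv\<^bsub>?G\<^esub> (ts ! i) \<otimes>\<^bsub>?G\<^esub> g \<otimes>\<^bsub>?G\<^esub> t' \<in> ?H \<longleftrightarrow> t' = t"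
        unfolding swap[OF tsc[OF t']] using t(2) un[OF t'] by blast
      then show "(if inv\<^bsub>?G\<^esub> (ts ! i) \<otimes>\<^bsub>?G\<^esub> g \<otimes>\<^bsub>?G\<^esub> t' \<in> ?H then 1 else 0 :: complex) = (if t' = t then 1 else 0)"
        by (simp only:)
    qed
    also have "\<dots> = 1" using t(1) by simp
    finally show ?thesis .
  qed
  define T where "T = mat (length ts) 1 (\<lambda>_. 1 :: complex)"
  have T: "T \<in> carrier_mat (length ts) 1" by (simp add: T_def)
  have d1: "dg \<rho> = 1" and a1: "\<And>g. g \<in> carrier ?G \<Longrightarrow> act \<rho> g = 1\<^sub>m 1"
    using triv unfolding acts_trivially_def rk by blast+
  have "T * act \<rho> g = act ?\<pi> g * T" if g: "g \<in> carrier ?G" for g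
  proof (rule eq_matI)
    fix i j assume "i < dim_row (act ?\<pi> g * T)" "j < dim_col (act ?\<pi> g * T)"
    then have ij: "i < length ts" "j = 0" using c[of g] T by auto
    have "(act ?\<pi> g * T) $$ (i, 0) = (\<Sum>j<length ts. act ?\<pi> g $$ (i, j))"
      using c[of g] ij by (simp add: T_def scalar_prod_def lessThan_atLeast0)
    then show "(T * act \<rho> g) $$ (i, j) = (act ?\<pi> g * T) $$ (i, j)"
      unfolding a1[OF g] using ij T row[OF g ij(1)] by (simp add: T_def)
  qed (use a1[OF g] c[of g] T in auto)
  then have "intertwines T \<rho> ?\<pi>" unfolding intertwines_def using T by (simp add: rk d1 dg)
  moreover have "v = 0\<^sub>v (dg \<rho>)" if v: "v \<in> carrier_vec (dg \<rho>)" and Tv: "T *\<^sub>v v = 0\<^sub>v (dg ?\<pi>)" for v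
  proof (rule eq_vecI)
    have v1: "v \<in> carrier_vec 1" using v d1 by simp
    have "v $ 0 = (T *\<^sub>v v) $ 0" unfolding mult_vec_index_sum[OF T v1 len] using len by (simp add: T_def)
    also have "\<dots> = 0" unfolding Tv using len dg by simp
    finally have "v $ 0 = 0" .
    then show "v $ i = 0\<^sub>v (dg \<rho>) $ i" if "i < dim_vec (0\<^sub>v (dg \<rho>) :: complex vec)" for i
      using that d1 by simp
  qed (use v in simp)
  ultimately show ?thesis unfolding constituent_def using irr by blast
qed

lemma cuspidal_acts_trivially:
  assumes "cuspidal \<rho>" and "acts_trivially \<rho>"
  shows "rk \<rho> = 1"
proof (rule ccontr)
  assume "rk \<rho> \<noteq> 1"
  then have rk: "rk \<rho> - 1 \<ge> 1" "rk \<rho> = 1 + (rk \<rho> - 1)"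
    using assms(1) unfolding cuspidal_def by auto
  have "constituent \<rho> (par_ind (triv_rep 1) (triv_rep (rk \<rho> - 1)))"
    by (rule constituent_triv_par_ind[OF _ assms(2) rk(2)]) (use assms(1) in \<open>simp add: cuspidal_def\<close>)
  moreover have "irreducible_rep (triv_rep 1 :: 'a gl_rep)" "irreducible_rep (triv_rep (rk \<rho> - 1) :: 'a gl_rep)"
    by (rule irreducible_triv_rep)+
  moreover have "rk (triv_rep 1 :: 'a gl_rep) \<ge> 1" "rk (triv_rep (rk \<rho> - 1) :: 'a gl_rep) \<ge> 1"
    "rk (triv_rep 1 :: 'a gl_rep) + rk (triv_rep (rk \<rho> - 1) :: 'a gl_rep) = rk \<rho>"
    using rk by simp_all
  ultimately show False using assms(1) unfolding cuspidal_def by blast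
qed

lemma iso_rep_rk: "(\<sigma>, \<pi>) \<in> iso_rep \<Longrightarrow> rk \<sigma> = rk \<pi>"
  unfolding iso_rep_def intertwines_def by blast

lemma no_invariants_iso:
  assumes "(\<sigma>, \<pi>) \<in> iso_rep" and "no_invariants \<sigma>"
  shows "no_invariants \<pi>"
proof -
  obtain T where \<sigma>: "is_rep \<sigma>" and \<pi>: "is_rep \<pi>" and dg: "dg \<sigma> = dg \<pi>" and T: "T \<in> carrier (GL (dg \<pi>))"
    and int: "intertwines T \<sigma> \<pi>"
    using assms(1) unfolding iso_rep_def by blast
  have rk: "rk \<sigma> = rk \<pi>" and comm: "\<And>g. g \<in> carrier (GL (rk \<pi>)) \<Longrightarrow> T * act \<sigma> g = act \<pi> g * T"
    using int unfolding intertwines_def by blast+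
  obtain S where S: "S \<in> carrier (GL (dg \<pi>))" "T * S = 1\<^sub>m (dg \<pi>)" "S * T = 1\<^sub>m (dg \<pi>)" using T by (rule GL_E)
  note Tc = GL_carrier_mat[OF T] and Sc = GL_carrier_mat[OF S(1)]
  have "S * act \<pi> g = act \<sigma> g * S" if g: "g \<in> carrier (GL (rk \<sigma>))" for g
  proof -
    have g': "g \<in> carrier (GL (rk \<pi>))" using g rk by simp
    have c: "act \<pi> g \<in> carrier_mat (dg \<pi>) (dg \<pi>)" "act \<sigma> g \<in> carrier_mat (dg \<pi>) (dg \<pi>)"
      using is_rep_carrier_mat[OF \<pi> g'] is_rep_carrier_mat[OF \<sigma> g] dg by simp_all
    have "S * act \<pi> g = S * (act \<pi> g * (T * S))" using c S(2) by simp
    also have "act \<pi> g * (T * S) = T * act \<sigma> g * S"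
      unfolding comm[OF g'] by (rule assoc_mult_mat[OF c(1) Tc Sc, symmetric])
    also have "S * (T * act \<sigma> g * S) = S * (T * act \<sigma> g) * S"
      by (rule assoc_mult_mat[OF Sc mult_carrier_mat[OF Tc c(2)] Sc, symmetric])
    also have "S * (T * act \<sigma> g) = S * T * act \<sigma> g" by (rule assoc_mult_mat[OF Sc Tc c(2), symmetric])
    also have "\<dots> = act \<sigma> g" unfolding S(3) using c(2) by simp
    finally show ?thesis .
  qed
  then have int': "intertwines S \<pi> \<sigma>" unfolding intertwines_def using rk dg Sc by simp
  show ?thesis
  proof (rule no_invariants_pull_back[OF int' _ \<pi> _ assms(2)])
    show "\<forall>v\<in>carrier_vec (dg \<pi>). S *\<^sub>v v = 0\<^sub>v (dg \<sigma>) \<longrightarrow> v = 0\<^sub>v (dg \<pi>)"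
    proof (intro ballI impI)
      fix v :: "complex vec" assume v: "v \<in> carrier_vec (dg \<pi>)" and Sv: "S *\<^sub>v v = 0\<^sub>v (dg \<sigma>)"
      have "v = (T * S) *\<^sub>v v" using v S(2) by simp
      also have "\<dots> = T *\<^sub>v (S *\<^sub>v v)" by (rule assoc_mult_mat_vec[OF Tc Sc v])
      also have "\<dots> = 0\<^sub>v (dg \<pi>)" unfolding Sv dg using Tc by (intro eq_vecI) auto
      finally show "v = 0\<^sub>v (dg \<pi>)" .
    qed
  qed (use is_rep_carrier_mat[OF \<sigma>] in blast)
qed

text \<open>
  The relation \<open>iso_rep\<close> sees only the values of the action on the group, so two representations
  that act trivially are interchangeable in it.
\<close>

lemma acts_trivially_iso_iff:
  assumes \<sigma>: "is_rep \<sigma>" "acts_trivially \<sigma>" and \<sigma>': "is_rep \<sigma>'" "acts_trivially \<sigma>'" and rk: "rk \<sigma> = rk \<sigma>'"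
  shows "(\<sigma>, \<pi>) \<in> iso_rep \<longleftrightarrow> (\<sigma>', \<pi>) \<in> iso_rep"
proof -
  have dg: "dg \<sigma> = 1" "dg \<sigma>' = 1" and act: "\<And>g. g \<in> carrier (GL (rk \<sigma>')) \<Longrightarrow> act \<sigma> g = act \<sigma>' g"
    using \<sigma>(2) \<sigma>'(2) rk by (simp_all add: acts_trivially_def)
  have "intertwines T \<sigma> \<pi> \<longleftrightarrow> intertwines T \<sigma>' \<pi>" for T
    unfolding intertwines_def using dg rk act by (auto simp: rk)
  then show ?thesis unfolding iso_rep_def using \<sigma>(1) \<sigma>'(1) dg by simp
qed

lemma iso_rep_refl:
  assumes \<pi>: "is_rep \<pi>"
  shows "(\<pi>, \<pi>) \<in> iso_rep"
proof -
  have "1\<^sub>m (dg \<pi>) * act \<pi> g = act \<pi> g * 1\<^sub>m (dg \<pi>)" if "g \<in> carrier (GL (rk \<pi>))" for g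
    using is_rep_carrier_mat[OF \<pi> that] by simp
  then have "intertwines (1\<^sub>m (dg \<pi>)) \<pi> \<pi>" by (simp add: intertwines_def)
  then show ?thesis unfolding iso_rep_def using \<pi> one_in_GL by blast
qed

lemma iso_triv_acts_trivially:
  assumes "(\<pi>, triv_rep n) \<in> iso_rep"
  shows "acts_trivially \<pi>"
proof -
  obtain T where \<pi>: "is_rep \<pi>" and dg: "dg \<pi> = 1" and T: "T \<in> carrier (GL 1)"
    and int: "intertwines T \<pi> (triv_rep n)"
    using assms unfolding iso_rep_def by auto
  have rk: "rk \<pi> = n" and comm: "\<And>g. g \<in> carrier (GL n) \<Longrightarrow> T * act \<pi> g = 1\<^sub>m 1 * T"
    using int unfolding intertwines_def by (simp_all add: triv_rep_def)
  obtain S where S: "S \<in> carrier (GL 1)" "S * T = 1\<^sub>m 1" using T by (rule GL_E)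
  note Tc = GL_carrier_mat[OF T] and Sc = GL_carrier_mat[OF S(1)]
  have "act \<pi> g = 1\<^sub>m 1" if g: "g \<in> carrier (GL n)" for g
  proof -
    have c: "act \<pi> g \<in> carrier_mat 1 1" using is_rep_carrier_mat[OF \<pi>, of g] g rk dg by simp
    have "act \<pi> g = S * T * act \<pi> g" using c S(2) by simp
    also have "\<dots> = S * (T * act \<pi> g)" by (rule assoc_mult_mat[OF Sc Tc c])
    also have "T * act \<pi> g = T" unfolding comm[OF g] using Tc by simp
    finally show ?thesis using S(2) by simp
  qed
  then show ?thesis using dg rk by (simp add: acts_trivially_def)
qed

lemma cuspidal_class_cases:
  assumes "C \<in> cuspidal_classes"
  obtains \<rho>0 where "cuspidal \<rho>0" "C = iso_rep `` {\<rho>0}"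
  using assms unfolding cuspidal_classes_def by (auto elim!: quotientE)

lemma class_deg_pos:
  assumes "C \<in> cuspidal_classes"
  shows "class_deg C \<ge> 1"
proof -
  obtain \<rho>0 where \<rho>0: "cuspidal \<rho>0" "C = iso_rep `` {\<rho>0}" using assms by (rule cuspidal_class_cases)
  then have "\<rho>0 \<in> C" using iso_rep_refl[of \<rho>0] by (simp add: cuspidal_def irreducible_rep_def)
  then have "(SOME \<rho>. \<rho> \<in> C) \<in> C" by (rule someI)
  then have "rk \<rho>0 = class_deg C" unfolding class_deg_def using \<rho>0(2) iso_rep_rk by blast
  then show ?thesis using \<rho>0(1) by (simp add: cuspidal_def)
qed

text \<open>
  A cuspidal representation with invariants is trivial, hence of rank \<open>1\<close>, because in higher rank the
  trivial representation is a constituent of an induced one; so its class is the trivial class.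
\<close>

lemma nontrivial_class_no_invariants:
  assumes C: "C \<in> cuspidal_classes" "C \<noteq> triv_class" and \<rho>: "\<rho> \<in> C"
  shows "is_rep \<rho>" and "no_invariants \<rho>"
proof -
  obtain \<rho>0 where \<rho>0: "cuspidal \<rho>0" "C = iso_rep `` {\<rho>0}" using C(1) by (rule cuspidal_class_cases)
  have irr: "irreducible_rep \<rho>0" using \<rho>0(1) by (simp add: cuspidal_def)
  have iso: "(\<rho>0, \<rho>) \<in> iso_rep" using \<rho> \<rho>0(2) by blast
  then show "is_rep \<rho>" unfolding iso_rep_def by blast
  show "no_invariants \<rho>"
  proof (rule irreducible_rep_cases[OF irr])
    assume "no_invariants \<rho>0"
    then show ?thesis by (rule no_invariants_iso[OF iso])
  next
    assume triv: "acts_trivially \<rho>0"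
    have "rk \<rho>0 = rk (triv_rep 1 :: 'a gl_rep)" using cuspidal_acts_trivially[OF \<rho>0(1) triv] by simp
    then have "(\<rho>0, \<pi>) \<in> iso_rep \<longleftrightarrow> (triv_rep 1, \<pi>) \<in> iso_rep" for \<pi>
      using irr triv is_rep_triv_rep acts_trivially_triv_rep
      by (intro acts_trivially_iso_iff) (simp_all add: irreducible_rep_def)
    then have "C = triv_class" unfolding \<rho>0(2) triv_class_def by blast
    then show ?thesis using C(2) by contradiction
  qed
qed

lemma triv_class_cuspidal: "triv_class \<in> cuspidal_classes"
proof -
  have "cuspidal (triv_rep 1)"
    unfolding cuspidal_def using irreducible_triv_rep by fastforce
  then show ?thesis unfolding cuspidal_classes_def triv_class_def by (intro quotientI) simp
qed

lemma labelled_constituent: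
  assumes "schur_labelling \<rho> \<phi>" "is_partition \<alpha>"
  shows "constituent (\<phi> \<alpha>) (par_pow \<rho> (sum_list \<alpha>))"
  using assms unfolding schur_labelling_def by blast

lemma is_partition_sum_pos: "is_partition \<alpha> \<Longrightarrow> \<alpha> \<noteq> [] \<Longrightarrow> sum_list \<alpha> \<ge> 1"
  by (cases \<alpha>) (auto simp: is_partition_def)

lemma no_invariants_nontrivial_class:
  assumes C: "C \<in> cuspidal_classes" "C \<noteq> triv_class" and \<Phi>: "zelevinsky_system \<Phi>"
    and \<alpha>: "is_partition \<alpha>" "\<alpha> \<noteq> []"
  shows "no_invariants (\<Phi> C \<alpha>)"
proof -
  obtain \<rho> where \<rho>: "\<rho> \<in> C" "schur_labelling \<rho> (\<Phi> C)"
    using \<Phi> C(1) unfolding zelevinsky_system_def by blast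
  note no = nontrivial_class_no_invariants[OF C \<rho>(1)]
  show ?thesis
    by (rule no_invariants_constituent[OF labelled_constituent[OF \<rho>(2) \<alpha>(1)]
          rep_with_class_character_par_pow[OF no(1)] no_invariants_par_pow[OF no is_partition_sum_pos[OF \<alpha>]]])
qed

lemma triv_class_labelling:
  assumes "zelevinsky_system \<Phi>"
  obtains \<rho> where "\<rho> \<in> triv_class" "is_rep \<rho>" "rk \<rho> = 1" "schur_labelling \<rho> (\<Phi> triv_class)"
proof -
  obtain \<rho> where \<rho>: "\<rho> \<in> triv_class" "schur_labelling \<rho> (\<Phi> triv_class)"
    using assms triv_class_cuspidal unfolding zelevinsky_system_def by blast
  then have iso: "(triv_rep 1, \<rho>) \<in> iso_rep" by (simp add: triv_class_def)
  then have "is_rep \<rho>" "rk \<rho> = 1" using iso_rep_rk[OF iso] by (simp_all add: iso_rep_def)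
  then show ?thesis using that \<rho> by blast
qed

lemma triv_class_one_row:
  assumes "zelevinsky_system \<Phi>" "n \<ge> 1"
  shows "(\<Phi> triv_class [n], triv_rep n) \<in> iso_rep"
  using assms triv_class_labelling[OF assms(1)] unfolding schur_labelling_def by metis

text \<open>
  With invariants, the representation labelled \<open>\<alpha>\<close> would be trivial and so isomorphic to the one
  labelled \<open>[n]\<close>, contradicting uniqueness of the label.
\<close>

lemma no_invariants_triv_class:
  assumes \<Phi>: "zelevinsky_system \<Phi>" and \<alpha>: "is_partition \<alpha>" "length \<alpha> \<ge> 2"
  shows "no_invariants (\<Phi> triv_class \<alpha>)"
proof -
  let ?\<phi> = "\<Phi> triv_class" and ?n = "sum_list \<alpha>"
  obtain \<rho> where \<rho>: "\<rho> \<in> triv_class" "is_rep \<rho>" "rk \<rho> = 1" "schur_labelling \<rho> ?\<phi>"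
    using \<Phi> by (rule triv_class_labelling)
  have con: "constituent (?\<phi> \<alpha>) (par_pow \<rho> ?n)" by (rule labelled_constituent[OF \<rho>(4) \<alpha>(1)])
  then have irr: "irreducible_rep (?\<phi> \<alpha>)" by (simp add: constituent_def)
  then have rep: "is_rep (?\<phi> \<alpha>)" by (simp add: irreducible_rep_def)
  have rk: "rk (?\<phi> \<alpha>) = ?n"
    using con rk_par_pow[of \<rho> ?n] \<rho>(3) unfolding constituent_def intertwines_def by auto
  have n: "?n \<ge> 1" by (rule is_partition_sum_pos[OF \<alpha>(1)]) (use \<alpha>(2) in auto)
  note row = triv_class_one_row[OF \<Phi> n]
  have un: "\<exists>!\<beta>. is_partition \<beta> \<and> sum_list \<beta> = ?n \<and> (?\<phi> \<alpha>, ?\<phi> \<beta>) \<in> iso_rep"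
    using con \<rho>(4) unfolding schur_labelling_def by blast
  show ?thesis
  proof (rule irreducible_rep_cases[OF irr])
    assume triv: "acts_trivially (?\<phi> \<alpha>)"
    have rrow: "is_rep (?\<phi> [?n])" using row by (simp add: iso_rep_def)
    have "(?\<phi> \<alpha>, ?\<phi> [?n]) \<in> iso_rep \<longleftrightarrow> (?\<phi> [?n], ?\<phi> [?n]) \<in> iso_rep"
      by (rule acts_trivially_iso_iff[OF rep triv rrow iso_triv_acts_trivially[OF row]])
        (use rk iso_rep_rk[OF row] in simp)
    then have "(?\<phi> \<alpha>, ?\<phi> [?n]) \<in> iso_rep" using iso_rep_refl[OF rrow] by blast
    moreover have "is_partition [k]" if "k \<ge> 1" for k using that by (simp add: is_partition_def)
    from this[OF n] have "is_partition [?n] \<and> sum_list [?n] = ?n" by simp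
    moreover have "(?\<phi> \<alpha>, ?\<phi> \<alpha>) \<in> iso_rep" by (rule iso_rep_refl[OF rep])
    ultimately have "\<alpha> = [?n]" using un \<alpha>(1) by blast
    then have "length \<alpha> = length [?n]" by (rule arg_cong)
    then show ?thesis using \<alpha>(2) by simp
  qed
qed

section \<open>The stable means of characters\<close>

lemma zelevinsky_system_is_rep:
  assumes "zelevinsky_system \<Phi>" "C \<in> cuspidal_classes" "is_partition \<alpha>"
  shows "is_rep (\<Phi> C \<alpha>)"
proof -
  obtain \<rho> where "schur_labelling \<rho> (\<Phi> C)" using assms(1,2) unfolding zelevinsky_system_def by blast
  then have "constituent (\<Phi> C \<alpha>) (par_pow \<rho> (sum_list \<alpha>))" using assms(3) by (rule labelled_constituent)
  then show ?thesis by (simp add: constituent_def irreducible_rep_def)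
qed

lemma mean_foldr_par_ind:
  assumes "\<And>C. C \<in> set Cs \<Longrightarrow> is_rep (f C)"
  shows "rep_with_class_character (foldr (\<lambda>C. par_ind (f C)) Cs (triv_rep 0)) \<and>
    mean (foldr (\<lambda>C. par_ind (f C)) Cs (triv_rep 0)) = (\<Prod>C\<leftarrow>Cs. mean (f C))"
  using assms
proof (induction Cs)
  case Nil
  then show ?case
    by (simp add: rep_with_class_character_triv_rep mean_acts_trivially[OF acts_trivially_triv_rep])
next
  case (Cons C Cs)
  then show ?case
    using is_rep_class_character[of "f C"] by (simp add: rep_with_class_character_par_ind mean_par_ind)
qed

lemma irrep_of_properties:
  assumes \<Phi>: "zelevinsky_system \<Phi>" and \<mu>: "multipartition \<mu>"
  shows rep_with_class_character_irrep_of: "rep_with_class_character (irrep_of \<Phi> \<mu>)"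
    and mean_irrep_of: "mean (irrep_of \<Phi> \<mu>) = (\<Prod>C\<in>multi_supp \<mu>. mean (\<Phi> C (\<mu> C)))"
proof -
  define Cs where "Cs = (SOME Cs. distinct Cs \<and> set Cs = multi_supp \<mu>)"
  have "\<exists>Cs. distinct Cs \<and> set Cs = multi_supp \<mu>"
    using \<mu> finite_distinct_list[of "multi_supp \<mu>"] unfolding multipartition_def by blast
  then have Cs: "distinct Cs" "set Cs = multi_supp \<mu>" unfolding Cs_def by (metis (mono_tags, lifting) someI_ex)+
  have "is_rep (\<Phi> C (\<mu> C))" if "C \<in> set Cs" for C
    using that \<mu> zelevinsky_system_is_rep[OF \<Phi>] unfolding Cs(2) multi_supp_def multipartition_def by blast
  then have *: "rep_with_class_character (irrep_of \<Phi> \<mu>) \<and> mean (irrep_of \<Phi> \<mu>) = (\<Prod>C\<leftarrow>Cs. mean (\<Phi> C (\<mu> C)))"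
    unfolding irrep_of_def Cs_def[symmetric] by (rule mean_foldr_par_ind)
  then show "rep_with_class_character (irrep_of \<Phi> \<mu>)" by blast
  show "mean (irrep_of \<Phi> \<mu>) = (\<Prod>C\<in>multi_supp \<mu>. mean (\<Phi> C (\<mu> C)))"
    using * prod.distinct_set_conv_list[OF Cs(1), of "\<lambda>C. mean (\<Phi> C (\<mu> C))"] unfolding Cs(2) by simp
qed

lemma character_conj:
  fixes \<pi> :: "'a :: {field, finite} gl_rep"
  assumes \<pi>: "rep_with_class_character \<pi>" and x: "x \<in> carrier (GL N)" and g: "g \<in> carrier (GL N)"
  shows "character \<pi> (x \<otimes>\<^bsub>GL N\<^esub> g \<otimes>\<^bsub>GL N\<^esub> inv\<^bsub>GL N\<^esub> x) = character \<pi> g"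
proof -
  interpret G: group "GL N :: 'a mat monoid" by (rule group_GL)
  have y: "x \<otimes>\<^bsub>GL N\<^esub> g \<otimes>\<^bsub>GL N\<^esub> inv\<^bsub>GL N\<^esub> x \<in> carrier (GL N)" by (intro G.m_closed G.inv_closed x g)
  show ?thesis
  proof (cases "N = rk \<pi>")
    case True
    have "mat_trace (act \<pi> (x * g * inv\<^bsub>GL (rk \<pi>)\<^esub> x)) = mat_trace (act \<pi> g)"
      using \<pi> x g unfolding rep_with_class_character_def True by blast
    then show ?thesis using g y unfolding character_def True by simp
  next
    case False
    have "h \<notin> carrier (GL (rk \<pi>))" if "h \<in> carrier (GL N)" for h :: "'a mat"
      using False GL_carrier_mat[OF that] GL_carrier_mat[of h "rk \<pi>"] by auto
    then show ?thesis using g y by (simp only: character_def if_False)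
  qed
qed

lemma has_stable_mean_characters:
  assumes "\<forall>\<^sub>F N in sequentially. rep_with_class_character (\<pi> N) \<and> expect N (character (\<pi> N)) = c"
  shows "has_stable_mean (abs_cf (\<lambda>N. character (\<pi> N))) c"
proof -
  have "class_family (\<lambda>N. character (\<pi> N))"
    unfolding class_family_def using assms
    by (rule eventually_mono) (intro ballI character_conj, erule conjunct1)
  note mean = has_stable_mean_abs_cf[OF this]
  show ?thesis
    unfolding mean using assms by (rule eventually_mono) (erule conjunct2)
qed

lemma has_stable_mean_circ_one:
  fixes \<pi> :: "'a :: {field, finite} gl_rep"
  assumes irr: "irreducible_rep \<pi>"
  shows "has_stable_mean (circ_one \<pi>) (if character \<pi> = character (triv_rep (rk \<pi>)) then 1 else 0)"
proof -
  have rep: "is_rep \<pi>" using irr by (simp add: irreducible_rep_def)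
  have mean: "mean \<pi> = (if character \<pi> = character (triv_rep (rk \<pi>)) then 1 else 0)"
  proof (rule irreducible_rep_cases[OF irr])
    assume "no_invariants \<pi>"
    then have 0: "mean \<pi> = 0" by (rule mean_no_invariants[OF rep])
    have 1: "mean (triv_rep (rk \<pi>) :: 'a gl_rep) = 1" by (rule mean_acts_trivially[OF acts_trivially_triv_rep])
    have "character \<pi> \<noteq> character (triv_rep (rk \<pi>))"
    proof
      assume "character \<pi> = character (triv_rep (rk \<pi>))"
      then have "mean \<pi> = mean (triv_rep (rk \<pi>) :: 'a gl_rep)" unfolding mean_def by simp
      then show False using 0 1 by simp
    qed
    then show ?thesis using 0 by simp
  next
    assume triv: "acts_trivially \<pi>"
    then show ?thesis using mean_acts_trivially[OF triv] character_acts_trivially[OF triv] by simp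
  qed
  have "rep_with_class_character (par_ind \<pi> (triv_rep (N - rk \<pi>))) \<and>
      expect N (character (par_ind \<pi> (triv_rep (N - rk \<pi>)))) = mean \<pi>" if "rk \<pi> \<le> N" for N
    using that is_rep_class_character[OF rep]
    by (simp add: expect_character rep_with_class_character_par_ind mean_par_ind
        rep_with_class_character_triv_rep mean_acts_trivially[OF acts_trivially_triv_rep])
  then have "has_stable_mean (circ_one \<pi>) (mean \<pi>)"
    unfolding circ_one_def by (intro has_stable_mean_characters eventually_sequentiallyI)
  then show ?thesis unfolding mean .
qed

text \<open>
  The bound \<open>N \<ge> \<parallel>\<mu>\<parallel> + |\<nu>| + 1\<close> makes the padded first row positive and at least as long as
  every row of \<open>\<nu>\<close>. For empty \<open>\<mu>\<close> the representation has to be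
  identified as the one labelled \<open>[N]\<close>; otherwise a single factor without invariants makes the
  product of the means vanish.
\<close>

lemma has_stable_mean_chi_stable:
  fixes \<Phi> :: "'a :: {field, finite} gl_rep set \<Rightarrow> nat list \<Rightarrow> 'a gl_rep"
  assumes \<Phi>: "zelevinsky_system \<Phi>" and \<mu>: "multipartition \<mu>"
  shows "has_stable_mean (chi_stable \<Phi> \<mu>) (if multi_norm \<mu> = 0 then 1 else 0)"
proof -
  let ?\<nu> = "\<mu> triv_class" and ?n = "multi_norm \<mu>"
  have fin: "finite (multi_supp \<mu>)" and part: "\<And>C. C \<in> cuspidal_classes \<Longrightarrow> is_partition (\<mu> C)"
    using \<mu> by (simp_all add: multipartition_def)
  have \<nu>: "is_partition ?\<nu>" by (rule part[OF triv_class_cuspidal])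
  have "rep_with_class_character (irrep_of \<Phi> (multi_pad \<mu> N)) \<and>
      expect N (character (irrep_of \<Phi> (multi_pad \<mu> N))) = (if ?n = 0 then 1 else 0)"
    if N: "N \<ge> ?n + sum_list ?\<nu> + 1" for N
  proof -
    let ?\<alpha> = "(N - ?n) # ?\<nu>"
    let ?\<mu>' = "\<mu>(triv_class := ?\<alpha>)"
    have "0 \<notin> set ?\<nu>" using \<nu> by (simp add: is_partition_def)
    then have "filter (\<lambda>k. k \<noteq> 0) ?\<nu> = ?\<nu>" by (intro filter_True ballI) metis
    then have pad: "multi_pad \<mu> N = ?\<mu>'" using N by (simp add: multi_pad_def)
    have "k \<le> N - ?n" if "k \<in> set ?\<nu>" for k
      using member_le_sum_list[OF that] N by linarith
    then have \<alpha>: "is_partition ?\<alpha>" using \<nu> N by (auto simp: is_partition_def)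
    have supp: "multi_supp ?\<mu>' = insert triv_class (multi_supp \<mu>)"
      using triv_class_cuspidal by (auto simp: multi_supp_def)
    have \<mu>': "multipartition ?\<mu>'"
      unfolding multipartition_def supp using fin part \<alpha> by simp
    have rep: "rep_with_class_character (irrep_of \<Phi> ?\<mu>')" by (rule rep_with_class_character_irrep_of[OF \<Phi> \<mu>'])
    have mean: "mean (irrep_of \<Phi> ?\<mu>') = (\<Prod>C\<in>multi_supp ?\<mu>'. mean (\<Phi> C (?\<mu>' C)))"
      by (rule mean_irrep_of[OF \<Phi> \<mu>'])
    have mean0: "mean (irrep_of \<Phi> ?\<mu>') = 0" if C: "C \<in> multi_supp ?\<mu>'" and no: "no_invariants (\<Phi> C (?\<mu>' C))" for C
    proof -
      have "is_rep (\<Phi> C (?\<mu>' C))"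
        by (rule zelevinsky_system_is_rep[OF \<Phi>]) (use C \<mu>' in \<open>simp_all add: multi_supp_def multipartition_def\<close>)
      then have "mean (\<Phi> C (?\<mu>' C)) = 0" using no by (rule mean_no_invariants)
      then have "\<exists>C\<in>multi_supp ?\<mu>'. mean (\<Phi> C (?\<mu>' C)) = 0" using C by (rule bexI)
      then show ?thesis unfolding mean by (intro prod_zero) (simp add: supp fin)
    qed
    show ?thesis
    proof (cases "?n = 0")
      case True
      have "multi_supp \<mu> = {}"
      proof (rule ccontr)
        assume "multi_supp \<mu> \<noteq> {}"
        then obtain C where C: "C \<in> multi_supp \<mu>" by blast
        then have "class_deg C * sum_list (\<mu> C) = 0"
          using True fin unfolding multi_norm_def by (simp only: sum_eq_0_iff)
        moreover have "class_deg C \<ge> 1" using C class_deg_pos[of C] by (simp add: multi_supp_def)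
        moreover have "sum_list (\<mu> C) \<ge> 1"
          using C part[of C] is_partition_sum_pos[of "\<mu> C"] by (simp add: multi_supp_def)
        ultimately show False by (metis mult_is_0 not_one_le_zero)
      qed
      moreover from this have "?\<nu> = []" using triv_class_cuspidal by (auto simp: multi_supp_def)
      ultimately have \<alpha>N: "?\<alpha> = [N]" and suppN: "multi_supp ?\<mu>' = {triv_class}" using True supp by simp_all
      have "N \<ge> 1" using N by simp
      note row = triv_class_one_row[OF \<Phi> this]
      have "mean (irrep_of \<Phi> ?\<mu>') = 1"
        unfolding mean suppN using mean_acts_trivially[OF iso_triv_acts_trivially[OF row]] \<alpha>N by simp
      moreover have "rk (irrep_of \<Phi> ?\<mu>') = N"
      proof -
        have one: "(SOME Cs. distinct Cs \<and> set Cs = {triv_class :: 'a gl_rep set}) = [triv_class]"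
        proof (rule some_equality)
          fix Cs assume Cs: "distinct Cs \<and> set Cs = {triv_class :: 'a gl_rep set}"
          then have "length Cs = 1" using distinct_card[of Cs] by simp
          then obtain C where "Cs = [C]" by (auto simp: length_Suc_conv)
          then show "Cs = [triv_class]" using Cs by simp
        qed simp
        show ?thesis using iso_rep_rk[OF row] \<alpha>N unfolding irrep_of_def suppN one by simp
      qed
      ultimately show ?thesis using rep True unfolding pad by (simp add: expect_character)
    next
      case False
      have "mean (irrep_of \<Phi> ?\<mu>') = 0"
      proof (cases "multi_supp \<mu> \<subseteq> {triv_class}")
        case False
        then obtain C where C: "C \<in> multi_supp \<mu>" "C \<noteq> triv_class" by blast
        then have "no_invariants (\<Phi> C (\<mu> C))"
          using no_invariants_nontrivial_class[OF _ C(2) \<Phi>] part by (simp add: multi_supp_def)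
        then show ?thesis using C by (intro mean0[of C]) (simp_all add: supp)
      next
        case True
        moreover have "multi_supp \<mu> \<noteq> {}" using \<open>?n \<noteq> 0\<close> by (auto simp: multi_norm_def)
        ultimately have "?\<nu> \<noteq> []" by (auto simp: multi_supp_def)
        then have "length ?\<alpha> \<ge> 2" by (cases ?\<nu>) simp_all
        then have "no_invariants (\<Phi> triv_class ?\<alpha>)" by (rule no_invariants_triv_class[OF \<Phi> \<alpha>])
        then show ?thesis by (intro mean0[of triv_class]) (simp_all add: supp)
      qed
      then show ?thesis using rep False unfolding pad by (simp add: expect_character)
    qed
  qed
  then show ?thesis
    unfolding chi_stable_def
    by (intro has_stable_mean_characters eventually_sequentiallyI)
qed

theorem corollary3p3:
  shows "(\<forall>f \<in> (SCF :: 'a :: {field, finite} cf set). \<exists>c. has_stable_mean f c) \<and>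
    (\<forall>m. \<forall>B \<in> carrier (GL m :: 'a mat monoid).
       \<exists>k :: nat. k > 0 \<and> has_stable_mean (Btilde m B) (of_nat k)) \<and>
    (\<forall>m. \<forall>B \<in> carrier (GL m :: 'a mat monoid). has_stable_mean (Btilde_fr m B) 1) \<and>
    (\<forall>m. \<forall>\<pi> :: 'a gl_rep. rk \<pi> = m \<and> irreducible_rep \<pi> \<longrightarrow>
       has_stable_mean (circ_one \<pi>)
         (if character \<pi> = character (triv_rep m) then 1 else 0)) \<and>
    (\<forall>\<Phi> :: 'a gl_rep set \<Rightarrow> nat list \<Rightarrow> 'a gl_rep. zelevinsky_system \<Phi> \<longrightarrow>
       (\<forall>\<mu>. multipartition \<mu> \<longrightarrow>
         has_stable_mean (chi_stable \<Phi> \<mu>) (if multi_norm \<mu> = 0 then 1 else 0)))"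
proof (intro conjI allI ballI impI)
  show "\<exists>c. has_stable_mean f c" if "f \<in> SCF" for f :: "'a cf"
    using that by (rule SCF_has_stable_mean)
  show "\<exists>k :: nat. k > 0 \<and> has_stable_mean (Btilde m B) (of_nat k)"
    if "B \<in> carrier (GL m)" for m and B :: "'a mat"
    using fixed_kernels_pos[OF that] has_stable_mean_Btilde[OF that] by (intro exI conjI)
  show "has_stable_mean (Btilde_fr m B) 1" if "B \<in> carrier (GL m)" for m and B :: "'a mat"
    using that by (rule has_stable_mean_Btilde_fr)
  show "has_stable_mean (circ_one \<pi>) (if character \<pi> = character (triv_rep m) then 1 else 0)"
    if "rk \<pi> = m \<and> irreducible_rep \<pi>" for m and \<pi> :: "'a gl_rep"
    using has_stable_mean_circ_one[of \<pi>] that by simp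
qed (rule has_stable_mean_chi_stable)

end
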